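(* Let $\bar{\mathcal M},\bar{\mathcal U}>0$ and set $$X:=\{(u,m)\in W^{1,\infty}(\mathbb T^d)\times L^\infty(\mathbb T^d)\ :\ \|Du\|_\infty\le\bar{\mathcal U},\ \|m\|_\infty\le\bar{\mathcal M}\}.$$ There exists $\gamma_0>0$, only depending on $\kappa,\bar{\mathcal M},\bar{\mathcal U}$ (in particular through the constants $L_{\bar{\mathcal U}},\alpha_{\bar{\mathcal U}},\beta_{\bar{\mathcal U}}$ associated with $H$), such that if $$F(x,m)+\gamma_0 m\ \text{ is nondecreasing for } m\in[0,\bar{\mathcal M}],\ x\in\mathbb T^d,$$ then the stationary ergodic system $$\begin{cases}\bar\lambda-\kappa\Delta u+H(x,Du)=F(x,m),\\ -\kappa\Delta m-\mathrm{div}(mH_p(x,Du))=0,\\ \int_{\mathbb T^d}m=1,\quad\int_{\mathbb T^d}u=0\end{cases}$$ in the unknown $(\bar\lambda,u,m)$, $\bar\lambda\in\mathbb R$, admits at most one solution $(\bar\lambda,u,m)$ with $(u,m)\in X$.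
   Context: $\mathbb T^d=\mathbb R^d/\mathbb Z^d$ is the flat torus, $\kappa>0$ is a constant, and $m$ is a probability density. $H_p,H_{pp}$ denote derivatives in $p$. Standing assumptions. $H:\mathbb T^d\times\mathbb R^d\to\mathbb R$ is measurable in $x$, $p\mapsto H(x,p)$ is $C^2$, and for a.e. $x$: for every $K>0$ there is $L_K>0$ with $|H_p(x,p)|\le L_K$ for all $|p|\le K$; and for every $K>0$ there are $\alpha_K,\beta_K>0$ with $\alpha_K I\le H_{pp}(x,p)\le\beta_K I$ for all $|p|\le K$. $F:\mathbb T^d\times[0,\infty)\to\mathbb R$ is measurable in $x$ and, for a.e. $x$: for every $K>0$ there are $c_K,\ell_K>0$ with $|F(x,m)|\le c_K$ and $|F(x,m)-F(x,m')|\le\ell_K|m-m'|$ whenever $m,m'\ge0$, $|m|,|m'|\le K$. *)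

theory Defs
  imports "HOL-Analysis.Analysis" "HOL-Probability.Essential_Supremum"
begin

section \<open>Functions on the flat torus\<close>

text \<open>Functions on the torus are represented by functions on \<open>real ^ 'n\<close> invariant under
  integer translations, and the measure of the torus is Lebesgue measure on the closed unit cube
  (whose boundary is a null set).\<close>

definition periodic :: "(real ^ 'n \<Rightarrow> 'b) \<Rightarrow> bool" where
  "periodic f \<longleftrightarrow> (\<forall>x k. (\<forall>i. k $ i \<in> \<int>) \<longrightarrow> f (x + k) = f x)"

definition torus :: "(real ^ 'n) measure" where
  "torus = lebesgue_on (cbox 0 1)"

definition Linf_norm :: "(real ^ 'n \<Rightarrow> 'b::real_normed_vector) \<Rightarrow> ennreal" where
  "Linf_norm f = esssup torus (\<lambda>x. ennreal (norm (f x)))"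

definition Linf :: "(real ^ 'n \<Rightarrow> 'b::real_normed_vector) set" where
  "Linf = {f. periodic f \<and> f \<in> borel_measurable torus \<and> Linf_norm f < \<infinity>}"


section \<open>Classical derivatives\<close>

text \<open>These operators are only meaningful where the function is differentiable, which
  \<open>Ck\<close> below guarantees.\<close>

definition partial_deriv :: "'n \<Rightarrow> (real ^ 'n \<Rightarrow> real) \<Rightarrow> real ^ 'n \<Rightarrow> real" where
  "partial_deriv i f x = frechet_derivative f (at x) (axis i 1)"

definition grad :: "(real ^ 'n \<Rightarrow> real) \<Rightarrow> real ^ 'n \<Rightarrow> real ^ 'n" where
  "grad f x = (\<chi> i. partial_deriv i f x)"

definition hessian :: "(real ^ 'n \<Rightarrow> real) \<Rightarrow> real ^ 'n \<Rightarrow> real ^ 'n ^ 'n" where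
  "hessian f x = (\<chi> i j. partial_deriv i (partial_deriv j f) x)"

definition laplacian :: "(real ^ 'n \<Rightarrow> real) \<Rightarrow> real ^ 'n \<Rightarrow> real" where
  "laplacian f x = (\<Sum>i\<in>UNIV. partial_deriv i (partial_deriv i f) x)"

text \<open>A list of indices encodes an iterated partial derivative.\<close>

definition Ck :: "nat \<Rightarrow> (real ^ 'n \<Rightarrow> real) \<Rightarrow> bool" where
  "Ck k f \<longleftrightarrow>
     (\<forall>is. length is < k \<longrightarrow> (\<forall>x. foldr partial_deriv is f differentiable (at x))) \<and>
     (\<forall>is. length is = k \<longrightarrow> continuous_on UNIV (foldr partial_deriv is f))"

definition test_function :: "(real ^ 'n \<Rightarrow> real) \<Rightarrow> bool" where
  "test_function \<phi> \<longleftrightarrow> periodic \<phi> \<and> (\<forall>k. Ck k \<phi>)"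


section \<open>Weak gradients and the space \<open>W\<^sup>1\<^sup>,\<^sup>\<infinity>\<close>\<close>

definition weak_gradient :: "(real ^ 'n \<Rightarrow> real) \<Rightarrow> (real ^ 'n \<Rightarrow> real ^ 'n) \<Rightarrow> bool" where
  "weak_gradient u G \<longleftrightarrow> periodic G \<and> integrable torus G \<and>
     (\<forall>\<phi>. test_function \<phi> \<longrightarrow>
        (\<integral>x. u x *\<^sub>R grad \<phi> x \<partial>torus) = - (\<integral>x. \<phi> x *\<^sub>R G x \<partial>torus))"

text \<open>The weak gradient is unique up to null sets; \<open>D u\<close> is some representative of it.\<close>

definition D :: "(real ^ 'n \<Rightarrow> real) \<Rightarrow> real ^ 'n \<Rightarrow> real ^ 'n" where
  "D u = (SOME G. weak_gradient u G)"

definition W1inf :: "(real ^ 'n \<Rightarrow> real) set" where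
  "W1inf = {u \<in> Linf. \<exists>G \<in> Linf. weak_gradient u G}"

definition X :: "real \<Rightarrow> real \<Rightarrow> ((real ^ 'n \<Rightarrow> real) \<times> (real ^ 'n \<Rightarrow> real)) set" where
  "X U M = {(u, m). u \<in> W1inf \<and> m \<in> Linf \<and>
     Linf_norm (D u) \<le> ennreal U \<and> Linf_norm m \<le> ennreal M}"


section \<open>Hamiltonian and coupling\<close>

definition loewner_le :: "real ^ 'n ^ 'n \<Rightarrow> real ^ 'n ^ 'n \<Rightarrow> bool" where
  "loewner_le A B \<longleftrightarrow> (\<forall>v. v \<bullet> (A *v v) \<le> v \<bullet> (B *v v))"

text \<open>The constants in the assumptions on \<open>H\<close> and \<open>F\<close> depend on the radius \<open>K\<close> only; they are
  uniform in \<open>x\<close>.\<close>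

definition H_bounds ::
  "(real ^ 'n \<Rightarrow> real ^ 'n \<Rightarrow> real) \<Rightarrow> real \<Rightarrow> real \<Rightarrow> real \<Rightarrow> real \<Rightarrow> bool" where
  "H_bounds H K L \<alpha> \<beta> \<longleftrightarrow>
     (AE x in torus. \<forall>p. norm p \<le> K \<longrightarrow>
        norm (grad (H x) p) \<le> L \<and>
        loewner_le (mat \<alpha>) (hessian (H x) p) \<and> loewner_le (hessian (H x) p) (mat \<beta>))"

definition admissible_H :: "(real ^ 'n \<Rightarrow> real ^ 'n \<Rightarrow> real) \<Rightarrow> bool" where
  "admissible_H H \<longleftrightarrow>
     (\<forall>p. periodic (\<lambda>x. H x p) \<and> (\<lambda>x. H x p) \<in> borel_measurable torus) \<and>
     (\<forall>x. Ck 2 (H x)) \<and>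
     (\<forall>K>0. \<exists>L>0. \<exists>\<alpha>>0. \<exists>\<beta>>0. H_bounds H K L \<alpha> \<beta>)"

text \<open>Only the values of \<open>F x\<close> on the nonnegative reals are relevant.\<close>

definition admissible_F :: "(real ^ 'n \<Rightarrow> real \<Rightarrow> real) \<Rightarrow> bool" where
  "admissible_F F \<longleftrightarrow>
     (\<forall>m\<ge>0. periodic (\<lambda>x. F x m) \<and> (\<lambda>x. F x m) \<in> borel_measurable torus) \<and>
     (\<forall>K>0. \<exists>c>0. \<exists>l>0. AE x in torus.
        (\<forall>m\<in>{0..K}. \<bar>F x m\<bar> \<le> c) \<and>
        (\<forall>m\<in>{0..K}. \<forall>m'\<in>{0..K}. \<bar>F x m - F x m'\<bar> \<le> l * \<bar>m - m'\<bar>))"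


section \<open>The stationary ergodic system\<close>

text \<open>Both equations are understood in the sense of distributions on the torus, integrating by
  parts once in the first equation and twice in the diffusion term of the second one (where \<open>m\<close>
  is merely bounded). The assumptions on \<open>H\<close> do not bound \<open>H x 0\<close>, so integrability of
  \<open>H x (D u x)\<close> has to be part of the notion of solution: the Bochner integral of a
  non-integrable function would be 0. All other integrands are bounded and measurable
  for \<open>(u, m) \<in> X U M\<close>.\<close>

definition weak_HJB ::
  "real \<Rightarrow> (real ^ 'n \<Rightarrow> real ^ 'n \<Rightarrow> real) \<Rightarrow> (real ^ 'n \<Rightarrow> real \<Rightarrow> real) \<Rightarrow>
   real \<Rightarrow> (real ^ 'n \<Rightarrow> real) \<Rightarrow> (real ^ 'n \<Rightarrow> real) \<Rightarrow> bool" where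
  "weak_HJB \<kappa> H F lam u m \<longleftrightarrow> integrable torus (\<lambda>x. H x (D u x)) \<and>
     (\<forall>\<phi>. test_function \<phi> \<longrightarrow>
        (\<integral>x. lam * \<phi> x + \<kappa> * (D u x \<bullet> grad \<phi> x) + H x (D u x) * \<phi> x \<partial>torus)
          = (\<integral>x. F x (m x) * \<phi> x \<partial>torus))"

definition weak_FP ::
  "real \<Rightarrow> (real ^ 'n \<Rightarrow> real ^ 'n \<Rightarrow> real) \<Rightarrow>
   (real ^ 'n \<Rightarrow> real) \<Rightarrow> (real ^ 'n \<Rightarrow> real) \<Rightarrow> bool" where
  "weak_FP \<kappa> H u m \<longleftrightarrow>
     (\<forall>\<phi>. test_function \<phi> \<longrightarrow>
        (\<integral>x. - \<kappa> * m x * laplacian \<phi> x + m x * (grad (H x) (D u x) \<bullet> grad \<phi> x) \<partial>torus) = 0)"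

definition ergodic_solution ::
  "real \<Rightarrow> (real ^ 'n \<Rightarrow> real ^ 'n \<Rightarrow> real) \<Rightarrow> (real ^ 'n \<Rightarrow> real \<Rightarrow> real) \<Rightarrow>
   real \<Rightarrow> (real ^ 'n \<Rightarrow> real) \<Rightarrow> (real ^ 'n \<Rightarrow> real) \<Rightarrow> bool" where
  "ergodic_solution \<kappa> H F lam u m \<longleftrightarrow>
     weak_HJB \<kappa> H F lam u m \<and> weak_FP \<kappa> H u m \<and>
     (AE x in torus. 0 \<le> m x) \<and> (\<integral>x. m x \<partial>torus) = 1 \<and> (\<integral>x. u x \<partial>torus) = 0"

end

theory Submission
  imports Defs "HOL-Probability.Probability_Measure"
begin

text \<open>
  The argument is that of Lasry and Lions, with the monotonicity of \<open>F\<close> replaced by a smallness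
  condition that is absorbed by a quantitative stability estimate for the Fokker--Planck equation.

  Take two solutions and put \<open>\<mu> = m\<^sub>1 - m\<^sub>2\<close>, \<open>P = Du\<^sub>1 - Du\<^sub>2\<close> and \<open>b\<^sub>i = H\<^sub>p(x, Du\<^sub>i)\<close>. Testing the
  difference of the Hamilton--Jacobi equations with \<open>\<mu>\<close> and the difference of the Fokker--Planck
  equations with \<open>u\<^sub>1 - u\<^sub>2\<close> (\<open>duality_pairing\<close>), the diffusion terms cancel, and uniform convexity of
  \<open>H\<close> on the ball of radius \<open>U\<close> gives
  \<open>\<alpha>/2 \<integral> (m\<^sub>1 + m\<^sub>2) |P|\<^sup>2 \<le> - \<integral> (F(x, m\<^sub>1) - F(x, m\<^sub>2)) \<mu> \<le> \<gamma> \<integral> \<mu>\<^sup>2\<close>.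
  On the other hand \<open>\<mu>\<close> has mean zero and solves \<open>- \<kappa> \<Delta>\<mu> - div (\<mu> b\<^sub>1) = div (m\<^sub>2 (b\<^sub>1 - b\<^sub>2))\<close>, and
  \<open>weak_L2_bound\<close> gives \<open>\<integral> \<mu>\<^sup>2 \<le> C \<integral> |m\<^sub>2 (b\<^sub>1 - b\<^sub>2)|\<^sup>2 \<le> C M \<beta>\<^sup>2 \<integral> m\<^sub>2 |P|\<^sup>2\<close> with a constant \<open>C\<close> that
  depends on the drift only through its bound \<open>L\<close>. For \<open>\<gamma>\<close> small both integrals vanish. Hence
  \<open>m\<^sub>1 = m\<^sub>2\<close>; since a density that solves a Fokker--Planck equation is positive almost everywhere
  (\<open>density_positive\<close>), also \<open>P = 0\<close>, and then \<open>u\<^sub>1 = u\<^sub>2\<close> because both have mean zero, and the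
  constants agree.

  The heart of the matter is the estimate \<open>\<integral> v\<^sup>2 \<le> C\<close> for mean-zero solutions of
  \<open>- \<kappa> \<Delta>v - div (v b) = div g\<close> with \<open>\<integral> |g|\<^sup>2 \<le> 1\<close>. The equation may have first-order terms of any
  size compared with \<open>\<kappa>\<close>, so the energy estimate alone does not close. Testing with \<open>arctan v\<close> bounds
  the gradient of \<open>arsinh v\<close> by a constant that does not see the size of \<open>v\<close>; by the Poincare
  inequality \<open>arsinh v\<close> stays close to its mean, and since \<open>v\<close> has mean zero this gives
  \<open>\<integral> v arsinh v \<le> K \<parallel>v\<parallel>\<close> (\<open>arsinh_oscillation\<close>). The energy estimate and the Ehrling
  inequality show that \<open>\<parallel>v\<parallel>\<close> is controlled by \<open>\<integral> |v|\<close> once \<open>\<parallel>v\<parallel> \<ge> 1\<close>, so that the left side is at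
  least of order \<open>\<parallel>v\<parallel> arsinh (c \<parallel>v\<parallel>)\<close>, and \<open>\<parallel>v\<parallel>\<close> is bounded (\<open>unit_source_bound\<close>). The same
  oscillation bound, applied to large multiples of a density, forces the density to be positive.

  All this needs smooth \<open>v\<close>, whereas \<open>m\<close> is only bounded. The solutions are therefore convolved with
  nonnegative trigonometric polynomials: the convolution of the drift term \<open>m b\<close> differs from the
  drift of the convolution by an error that tends to zero in mean square and joins the source \<open>g\<close>.
  Trigonometric polynomials are used because their convolutions with bounded functions are again
  trigonometric polynomials, so that smoothness and differentiation under the integral come from
  finite sums, and because they are legitimate test functions.
\<close>

section \<open>The torus as a probability space\<close>

abbreviation torus_integral :: "(real^'n \<Rightarrow> 'b::{banach, second_countable_topology}) \<Rightarrow> 'b"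
  (binder "\<integral>" 10) where
  "torus_integral \<equiv> integral\<^sup>L torus"

lemma space_torus: "space torus = cbox 0 1"
  by (simp add: torus_def space_restrict_space)

lemma prob_space_torus: "prob_space (torus :: (real^'n) measure)"
proof
  have "emeasure (torus :: (real^'n) measure) (space torus) = emeasure lborel (cbox (0::real^'n) 1)"
    by (simp add: torus_def space_restrict_space emeasure_restrict_space)
  also have "\<dots> = 1"
    by (subst emeasure_lborel_cbox) (auto simp: Basis_vec_def inner_axis intro!: prod.neutral)
  finally show "emeasure (torus :: (real^'n) measure) (space torus) = 1" .
qed

interpretation torus: prob_space "torus :: (real^'n) measure"
  by (rule prob_space_torus)

lemma borel_measurable_torus_continuous:
  fixes f :: "real^'n \<Rightarrow> 'b::euclidean_space"
  assumes "continuous_on UNIV f"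
  shows "f \<in> borel_measurable torus"
  unfolding torus_def
  by (rule continuous_imp_measurable_on_sets_lebesgue) (use assms continuous_on_subset in auto)

text \<open>
  An algebra of integrable functions, so that integrability of products is settled by structural
  rules.
\<close>

definition ess_bdd :: "(real^'n \<Rightarrow> real) \<Rightarrow> bool" where
  "ess_bdd f \<longleftrightarrow> f \<in> borel_measurable torus \<and> (\<exists>B. AE x in torus. \<bar>f x\<bar> \<le> B)"

lemma ess_bddI:
  "f \<in> borel_measurable torus \<Longrightarrow> (AE x in torus. \<bar>f x\<bar> \<le> B) \<Longrightarrow> ess_bdd f"
  by (auto simp: ess_bdd_def)

lemma ess_bdd_measurable: "ess_bdd f \<Longrightarrow> f \<in> borel_measurable torus"
  by (simp add: ess_bdd_def)

lemma ess_bddE: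
  assumes "ess_bdd f"
  obtains B where "B \<ge> 0" "AE x in torus. \<bar>f x\<bar> \<le> B" "f \<in> borel_measurable torus"
proof -
  obtain B where B: "AE x in torus. \<bar>f x\<bar> \<le> B" and m: "f \<in> borel_measurable torus"
    using assms by (auto simp: ess_bdd_def)
  have "AE x in torus. \<bar>f x\<bar> \<le> max B 0"
    using B by eventually_elim auto
  then show ?thesis using that m by (metis max.cobounded2)
qed

lemma ess_bdd_continuous_comp:
  fixes \<phi> :: "real \<Rightarrow> real"
  assumes "ess_bdd f" "continuous_on UNIV \<phi>"
  shows "ess_bdd (\<lambda>x. \<phi> (f x))"
proof -
  obtain B where B: "AE x in torus. \<bar>f x\<bar> \<le> B" and m[measurable]: "f \<in> borel_measurable torus"
    using assms(1) by (auto simp: ess_bdd_def)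
  have "compact (\<phi> ` {-B..B})"
    using assms(2) by (intro compact_continuous_image continuous_on_subset[OF assms(2)]) auto
  then have "bounded (\<phi> ` {-B..B})"
    by (rule compact_imp_bounded)
  then obtain C where "\<forall>y\<in>{-B..B}. \<bar>\<phi> y\<bar> \<le> C"
    unfolding bounded_iff by auto
  then have C: "\<And>y. y \<in> {-B..B} \<Longrightarrow> \<bar>\<phi> y\<bar> \<le> C"
    by blast
  have [measurable]: "\<phi> \<in> borel_measurable borel"
    by (rule borel_measurable_continuous_onI[OF assms(2)])
  show ?thesis
  proof (rule ess_bddI)
    show "AE x in torus. \<bar>\<phi> (f x)\<bar> \<le> C"
      using B by eventually_elim (auto intro!: C)
  qed measurable
qed

lemma ess_bdd_const: "ess_bdd (\<lambda>x. c)"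
  by (rule ess_bddI[of _ "\<bar>c\<bar>"]) auto

lemma
  assumes "ess_bdd f" "ess_bdd g"
  shows ess_bdd_add: "ess_bdd (\<lambda>x. f x + g x)"
    and ess_bdd_mult: "ess_bdd (\<lambda>x. f x * g x)"
proof -
  obtain A B where A: "AE x in torus. \<bar>f x\<bar> \<le> A" "f \<in> borel_measurable torus"
    and B: "AE x in torus. \<bar>g x\<bar> \<le> B" "g \<in> borel_measurable torus"
    using assms by (auto simp: ess_bdd_def)
  have "AE x in torus. \<bar>f x + g x\<bar> \<le> A + B"
    using A(1) B(1) by eventually_elim auto
  then show "ess_bdd (\<lambda>x. f x + g x)"
    by (rule ess_bddI[OF borel_measurable_add[OF A(2) B(2)]])
  have "AE x in torus. \<bar>f x * g x\<bar> \<le> A * B"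
    using A(1) B(1)
    by eventually_elim (auto simp: abs_mult intro!: mult_mono order_trans[OF abs_ge_zero])
  then show "ess_bdd (\<lambda>x. f x * g x)"
    by (rule ess_bddI[OF borel_measurable_times[OF A(2) B(2)]])
qed

lemma ess_bdd_minus: "ess_bdd f \<Longrightarrow> ess_bdd (\<lambda>x. - f x)"
  using ess_bdd_mult[OF ess_bdd_const[of "-1"], of f] by simp

lemma ess_bdd_diff: "ess_bdd f \<Longrightarrow> ess_bdd g \<Longrightarrow> ess_bdd (\<lambda>x. f x - g x)"
  using ess_bdd_add[of f "\<lambda>x. - g x"] ess_bdd_minus[of g] by simp

lemma ess_bdd_power: "ess_bdd f \<Longrightarrow> ess_bdd (\<lambda>x. f x ^ n)"
  by (induction n) (auto intro: ess_bdd_const ess_bdd_mult)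

lemma ess_bdd_divide: "ess_bdd f \<Longrightarrow> ess_bdd (\<lambda>x. f x / c)"
  using ess_bdd_mult[OF ess_bdd_const[of "1/c"], of f] by simp

lemma ess_bdd_abs: "ess_bdd f \<Longrightarrow> ess_bdd (\<lambda>x. \<bar>f x\<bar>)"
  by (rule ess_bdd_continuous_comp) (auto intro: continuous_intros)

lemma ess_bdd_sum: "(\<And>i. i \<in> I \<Longrightarrow> ess_bdd (f i)) \<Longrightarrow> ess_bdd (\<lambda>x. \<Sum>i\<in>I. f i x)"
  by (induction I rule: infinite_finite_induct) (auto intro: ess_bdd_const ess_bdd_add)

lemma ess_bdd_continuous:
  assumes "continuous_on UNIV f" shows "ess_bdd f"
proof -
  have "compact (f ` cbox 0 1)"
    by (intro compact_continuous_image continuous_on_subset[OF assms]) auto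
  then have "bounded (f ` cbox 0 1)"
    by (rule compact_imp_bounded)
  then obtain C where C: "\<And>x. x \<in> cbox 0 1 \<Longrightarrow> \<bar>f x\<bar> \<le> C"
    unfolding bounded_iff by auto
  show ?thesis
    by (rule ess_bddI[of _ C])
       (auto intro!: borel_measurable_torus_continuous assms C AE_I2 simp: space_torus)
qed

lemmas ess_bdd_intros = ess_bdd_const ess_bdd_add ess_bdd_mult ess_bdd_minus
  ess_bdd_diff ess_bdd_power ess_bdd_divide ess_bdd_abs ess_bdd_sum

lemma ess_bdd_integrable: "ess_bdd f \<Longrightarrow> integrable torus f"
  by (auto simp: ess_bdd_def intro!: torus.integrable_const_bound)

lemmas ess_bdd_rules = ess_bdd_integrable ess_bdd_intros

lemma ess_bdd_inner:
  fixes f g :: "real^'n \<Rightarrow> real^'n"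
  shows "(\<And>i. ess_bdd (\<lambda>x. f x $ i)) \<Longrightarrow> (\<And>i. ess_bdd (\<lambda>x. g x $ i))
    \<Longrightarrow> ess_bdd (\<lambda>x. f x \<bullet> g x)"
  by (auto simp: inner_vec_def intro!: ess_bdd_intros)

text \<open>
  Nonnegativity of the quadratic form \<open>\<integral> (a f - b g)\<^sup>2\<close>.
\<close>

lemma Cauchy_Schwarz_torus:
  assumes f: "ess_bdd f" and g: "ess_bdd g"
  shows "(\<integral>x. f x * g x)^2 \<le> (\<integral>x. (f x)^2) * (\<integral>x. (g x)^2)"
proof -
  define F G P where "F = (\<integral>x. (f x)^2)" "G = (\<integral>x. (g x)^2)" "P = (\<integral>x. f x * g x)"
  have int: "integrable torus (\<lambda>x. (f x)^2)" "integrable torus (\<lambda>x. (g x)^2)"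
    "integrable torus (\<lambda>x. f x * g x)"
    by (auto intro!: ess_bdd_integrable ess_bdd_intros f g)
  have nn: "a^2 * F - 2 * a * b * P + b^2 * G \<ge> 0" for a b
  proof -
    have "0 \<le> (\<integral>x. (a * f x - b * g x)^2)" by simp
    also have "\<dots> = (\<integral>x. a^2 * (f x)^2 - 2 * a * b * (f x * g x) + b^2 * (g x)^2)"
      by (simp add: power2_eq_square algebra_simps)
    also have "\<dots> = a^2 * F - 2 * a * b * P + b^2 * G"
      using int by (simp add: F_G_P_def)
    finally show ?thesis .
  qed
  have "G \<ge> 0" by (simp add: F_G_P_def)
  have "P^2 \<le> F * G"
  proof (cases "G = 0")
    case False
    then have "0 < G" using \<open>G \<ge> 0\<close> by simp
    have "0 \<le> G * (G * F - P^2)"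
      using nn[of G P] by (simp add: power2_eq_square algebra_simps)
    then show ?thesis using \<open>0 < G\<close> by (simp add: zero_le_mult_iff mult.commute)
  next
    case True
    have "2 * t * P \<le> F" for t using nn[of 1 t] True by simp
    from this[of "(F + 1) / (2 * P)"] have "P = 0" by (cases "P = 0") auto
    then show ?thesis using True by simp
  qed
  then show ?thesis by (simp add: F_G_P_def)
qed

lemma integral_torus_continuous:
  assumes "continuous_on UNIV (f :: real^'n \<Rightarrow> real)"
  shows "integral\<^sup>L torus f = integral (cbox 0 1) f"
  using ess_bdd_integrable[OF ess_bdd_continuous[OF assms]]
  unfolding torus_def by (intro lebesgue_integral_eq_integral) auto

section \<open>Translations, Poincare and Ehrling inequalities\<close>

lemma periodic_add_axis:
  assumes "periodic f" "k \<in> \<int>" shows "f (x + axis i k) = f x"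
proof -
  have "\<forall>j. axis i k $ j \<in> \<int>" using assms(2) by (auto simp: axis_def)
  then show ?thesis using assms(1) unfolding periodic_def by blast
qed

text \<open>
  The shifted cube is cut at the hyperplane \<open>x\<^sub>i = 1\<close>; the part beyond it is moved back by one period
  and fills the slab that the shift has left empty.
\<close>

lemma integral_shift_axis:
  fixes f :: "real^'n \<Rightarrow> real"
  assumes cont: "continuous_on UNIV f" and per: "periodic f" and s: "0 \<le> s" "s \<le> 1"
  shows "integral (cbox 0 1) (\<lambda>x. f (x + axis i s)) = integral (cbox 0 1) f"
proof -
  let ?e = "axis i 1 :: real^'n"
  have int: "f integrable_on cbox a b" for a b
    by (intro integrable_continuous continuous_on_subset[OF cont]) auto
  have e: "?e \<in> Basis" by (simp add: axis_in_Basis_iff)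
  have nth: "x \<bullet> ?e = x $ i" for x by (simp add: inner_axis)
  have mem: "x \<in> cbox a b \<longleftrightarrow> (a $ i \<le> x $ i \<and> x $ i \<le> b $ i) \<and>
      (\<forall>j. j \<noteq> i \<longrightarrow> a $ j \<le> x $ j \<and> x $ j \<le> b $ j)" for x a b :: "real^'n"
    unfolding mem_box_cart by metis
  have "integral (cbox 0 1) (\<lambda>x. f (x + axis i s)) = integral (cbox (axis i s) (1 + axis i s)) f"
    using integral_shift_cbox[of "axis i s" "axis i s" "1 + axis i s" f] by simp
  also have "\<dots> = integral (cbox (axis i s) (1 + axis i s) \<inter> {x. x \<bullet> ?e \<le> 1}) f
      + integral (cbox (axis i s) (1 + axis i s) \<inter> {x. x \<bullet> ?e \<ge> 1}) f"
    by (rule integral_split[OF int e])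
  also have "cbox (axis i s) (1 + axis i s) \<inter> {x. x \<bullet> ?e \<le> 1} = cbox (axis i s) 1"
    using s unfolding nth set_eq_iff Int_iff mem_Collect_eq mem by (auto simp: axis_def)
  also have "cbox (axis i s) (1 + axis i s) \<inter> {x. x \<bullet> ?e \<ge> 1} = cbox ?e (1 + axis i s)"
    using s unfolding nth set_eq_iff Int_iff mem_Collect_eq mem by (auto simp: axis_def)
  also have "integral (cbox ?e (1 + axis i s)) f
      = integral (cbox 0 (1 + axis i s - ?e)) (\<lambda>x. f (x + ?e))"
    using integral_shift_cbox[of ?e ?e "1 + axis i s" f] by simp
  also have "\<dots> = integral (cbox 0 (1 + axis i s - ?e)) f"
    using periodic_add_axis[OF per] by simp
  also have "cbox 0 (1 + axis i s - ?e) = cbox 0 1 \<inter> {x. x \<bullet> ?e \<le> s}"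
    using s unfolding nth set_eq_iff Int_iff mem_Collect_eq mem by (auto simp: axis_def)
  also have "cbox (axis i s) 1 = cbox 0 1 \<inter> {x. x \<bullet> ?e \<ge> s}"
    using s unfolding nth set_eq_iff Int_iff mem_Collect_eq mem by (auto simp: axis_def)
  also have "integral (cbox 0 1 \<inter> {x. s \<le> x \<bullet> ?e}) f + integral (cbox 0 1 \<inter> {x. x \<bullet> ?e \<le> s}) f
      = integral (cbox 0 1) f"
    using integral_split[OF int e, of 0 1 s] by simp
  finally show ?thesis .
qed

text \<open>
  The shift is decomposed into shifts along the coordinate axes, each of which is reduced to
  \<open>[0, 1)\<close> by periodicity.
\<close>

lemma integral_torus_shift:
  fixes f :: "real^'n \<Rightarrow> real"
  assumes cont: "continuous_on UNIV f" and per: "periodic f"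
  shows "(\<integral>x. f (x + z)) = integral\<^sup>L torus f"
proof -
  have cont': "continuous_on UNIV (\<lambda>x. f (x + w))" for w
    by (intro continuous_on_compose2[OF cont] continuous_intros) auto
  have per': "periodic (\<lambda>x. f (x + w))" for w
    using per unfolding periodic_def by (metis add.assoc add.commute)
  have step: "integral (cbox 0 1) (\<lambda>x. f (x + w + axis i s)) = integral (cbox 0 1) (\<lambda>x. f (x + w))" for w :: "real^'n" and i s
  proof -
    have "axis i s = axis i (frac s) + axis i (of_int \<lfloor>s\<rfloor>)"
      by (simp add: vec_eq_iff axis_def frac_def)
    then have "f (x + w + axis i s) = f (x + axis i (frac s) + w)" for x
      using periodic_add_axis[OF per, of "of_int \<lfloor>s\<rfloor>" "x + axis i (frac s) + w" i]
      by (simp add: add_ac)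
    then show ?thesis
      using integral_shift_axis[OF cont'[of w] per'[of w], of "frac s" i]
      by (simp add: frac_ge_0 less_imp_le[OF frac_lt_1])
  qed
  have "integral (cbox 0 1) (\<lambda>x. f (x + (\<Sum>i\<in>I. axis i (z $ i)))) = integral (cbox 0 1) f" for I
  proof (induction I rule: infinite_finite_induct)
    case (insert i I)
    then show ?case using step[of "\<Sum>i\<in>I. axis i (z $ i)" i "z $ i"]
      by (simp add: add_ac)
  qed auto
  moreover have "(\<Sum>i\<in>UNIV. axis i (z $ i)) = z"
    by (simp add: vec_eq_iff axis_def if_distrib cong: if_cong)
  ultimately show ?thesis
    by (metis integral_torus_continuous cont cont')
qed

text \<open>
  The gradient is carried along as a second argument, since the functions to be differentiated are
  compositions such as \<open>arsinh \<circ> v\<close> for which an explicit gradient is at hand.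
\<close>

definition C1_periodic :: "(real^'n \<Rightarrow> real) \<Rightarrow> (real^'n \<Rightarrow> real^'n) \<Rightarrow> bool" where
  "C1_periodic f g \<longleftrightarrow> periodic f \<and> periodic g \<and> continuous_on UNIV g \<and>
     (\<forall>x. (f has_derivative (\<lambda>h. g x \<bullet> h)) (at x))"

lemma C1_periodic_continuous: "C1_periodic f g \<Longrightarrow> continuous_on UNIV f"
  unfolding C1_periodic_def by (auto intro!: continuous_at_imp_continuous_on has_derivative_continuous)

lemma integral_torus_swap:
  fixes \<Phi> :: "real^'n \<Rightarrow> 'b::euclidean_space \<Rightarrow> real"
  assumes "continuous_on UNIV (\<lambda>(x, y). \<Phi> x y)"
  shows "(\<integral>x. integral (cbox c d) (\<Phi> x)) = integral (cbox c d) (\<lambda>y. \<integral>x. \<Phi> x y)"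
proof -
  have 1: "continuous_on UNIV (\<lambda>x. integral (cbox c d) (\<Phi> x))"
    by (rule integral_continuous_on_param) (rule continuous_on_subset[OF assms], simp)
  have 2: "continuous_on UNIV (\<lambda>x. \<Phi> x y)" for y
  proof -
    have "continuous_on UNIV (\<lambda>x::real^'n. (x, y))" by (intro continuous_intros)
    from continuous_on_compose2[OF assms this] show ?thesis by simp
  qed
  have "(\<integral>x. integral (cbox c d) (\<Phi> x)) = integral (cbox 0 1) (\<lambda>x. integral (cbox c d) (\<Phi> x))"
    by (rule integral_torus_continuous[OF 1])
  also have "\<dots> = integral (cbox c d) (\<lambda>y. integral (cbox 0 1) (\<lambda>x. \<Phi> x y))"
    by (rule integral_swap_continuous) (rule continuous_on_subset[OF assms], simp)
  also have "\<dots> = integral (cbox c d) (\<lambda>y. \<integral>x. \<Phi> x y)"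
    by (simp add: integral_torus_continuous[OF 2])
  finally show ?thesis .
qed

text \<open>
  Jensen's inequality for the square: expand \<open>\<integral> (a - \<integral>a)\<^sup>2 \<ge> 0\<close>.
\<close>

lemma integral_square_le:
  fixes a :: "'b::euclidean_space \<Rightarrow> real"
  assumes a: "continuous_on (cbox c d) a" and content: "measure lborel (cbox c d) = 1"
  shows "(integral (cbox c d) a)^2 \<le> integral (cbox c d) (\<lambda>y. (a y)^2)"
proof -
  let ?I = "integral (cbox c d)"
  have int: "a integrable_on cbox c d" "(\<lambda>y. (a y)^2) integrable_on cbox c d"
    by (auto intro!: integrable_continuous continuous_intros a)
  have "((\<lambda>y. (a y)^2 - 2 * ?I a * a y + (?I a)^2)
      has_integral (?I (\<lambda>y. (a y)^2) - 2 * ?I a * ?I a + measure lborel (cbox c d) *\<^sub>R (?I a)^2)) (cbox c d)"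
    by (intro has_integral_add has_integral_diff has_integral_mult_right has_integral_const
        integrable_integral int)
  moreover have "(a y)^2 - 2 * ?I a * a y + (?I a)^2 \<ge> 0" for y
    using zero_le_power2[of "a y - ?I a"] by (simp add: power2_eq_square algebra_simps)
  ultimately have "?I (\<lambda>y. (a y)^2) - 2 * ?I a * ?I a + measure lborel (cbox c d) *\<^sub>R (?I a)^2 \<ge> 0"
    by (rule has_integral_nonneg)
  then show ?thesis by (simp add: content power2_eq_square)
qed

lemma C1_periodic_line_integral:
  assumes "C1_periodic f g"
  shows "f (x + z) - f x = integral (cbox 0 1) (\<lambda>t. g (x + t *\<^sub>R z) \<bullet> z)"
proof -
  have d: "(f has_derivative (\<lambda>h. g y \<bullet> h)) (at y within S)" for y S
    using assms by (auto simp: C1_periodic_def intro: has_derivative_at_withinI)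
  have "((\<lambda>t. f (x + t *\<^sub>R z)) has_vector_derivative (g (x + t *\<^sub>R z) \<bullet> z)) (at t within {0..1})" for t
  proof -
    have "((\<lambda>t. x + t *\<^sub>R z) has_derivative (\<lambda>s. s *\<^sub>R z)) (at t within {0..1})"
      by (auto intro!: derivative_eq_intros)
    from has_derivative_compose[OF this d] show ?thesis
      by (simp add: has_vector_derivative_def)
  qed
  then have "((\<lambda>t. g (x + t *\<^sub>R z) \<bullet> z) has_integral (f (x + 1 *\<^sub>R z) - f (x + 0 *\<^sub>R z))) {0..1}"
    by (intro fundamental_theorem_of_calculus) auto
  then show ?thesis by (simp add: integral_unique)
qed

lemma continuous_on_compose_UNIV:
  "continuous_on UNIV f \<Longrightarrow> continuous_on A g \<Longrightarrow> continuous_on A (\<lambda>x. f (g x))"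
  by (rule continuous_on_compose2) auto

lemma periodic_compose: "periodic f \<Longrightarrow> periodic (\<lambda>x. F (f x))"
  by (simp add: periodic_def)

text \<open>
  Integration by parts on the torus. Integrate the derivative along segments: the increment
  \<open>f (x + z) - f x\<close> has integral zero, and it is also the average over the segment of the translates
  of the directional derivative, which all have the same integral.
\<close>

lemma integral_directional_derivative:
  assumes fg: "C1_periodic f g"
  shows "(\<integral>x. g x \<bullet> z) = 0"
proof -
  have g: "continuous_on UNIV g" "periodic g" and f: "periodic f"
    using fg by (auto simp: C1_periodic_def)
  have f_cont: "continuous_on UNIV f" by (rule C1_periodic_continuous[OF fg])
  have "(\<integral>x. f (x + z) - f x) = (\<integral>x. f (x + z)) - (\<integral>x. f x)"
    by (intro Bochner_Integration.integral_diff ess_bdd_integrable ess_bdd_continuous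
        continuous_on_compose_UNIV[OF f_cont] continuous_intros)
  then have "0 = (\<integral>x. f (x + z) - f x)"
    by (simp add: integral_torus_shift[OF f_cont f])
  also have "\<dots> = (\<integral>x. integral (cbox 0 1) (\<lambda>t. g (x + t *\<^sub>R z) \<bullet> z))"
    by (simp only: C1_periodic_line_integral[OF fg])
  also have "\<dots> = integral (cbox 0 1) (\<lambda>t::real. \<integral>x. g (x + t *\<^sub>R z) \<bullet> z)"
    by (intro integral_torus_swap)
       (auto simp: case_prod_unfold intro!: continuous_intros continuous_on_compose_UNIV[OF g(1)])
  also have "\<dots> = integral (cbox 0 1) (\<lambda>t::real. \<integral>x. g x \<bullet> z)"
    by (intro integral_cong integral_torus_shift periodic_compose[OF g(2), of "\<lambda>y. y \<bullet> z"]
        continuous_intros g(1))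
  also have "\<dots> = (\<integral>x. g x \<bullet> z)" by simp
  finally show ?thesis by simp
qed

text \<open>
  Write the increment as an average of the gradient over the segment from \<open>x\<close> to \<open>x + z\<close>, apply
  Jensen's inequality and use that all translates of \<open>g\<close> have the same norm.
\<close>

lemma shift_estimate:
  assumes fg: "C1_periodic f g"
  shows "(\<integral>x. (f (x + z) - f x)^2) \<le> (norm z)^2 * (\<integral>x. (norm (g x))^2)"
proof -
  have g: "continuous_on UNIV g" "periodic g" and f: "periodic f"
    using fg by (auto simp: C1_periodic_def)
  have f_cont: "continuous_on UNIV f" by (rule C1_periodic_continuous[OF fg])
  note cont = continuous_on_compose_UNIV[OF g(1)] continuous_on_compose_UNIV[OF f_cont] continuous_intros
  have cont2: "continuous_on UNIV (\<lambda>(x, t). (g (x + t *\<^sub>R z) \<bullet> z)^2)"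
    unfolding case_prod_unfold by (intro cont)
  have "(\<integral>x. (f (x + z) - f x)^2)
      \<le> (\<integral>x. integral (cbox 0 1) (\<lambda>t. (g (x + t *\<^sub>R z) \<bullet> z)^2))"
  proof (rule integral_mono)
    show "integrable torus (\<lambda>x. (f (x + z) - f x)^2)"
      by (intro ess_bdd_integrable ess_bdd_continuous cont)
    show "integrable torus (\<lambda>x. integral (cbox 0 1) (\<lambda>t. (g (x + t *\<^sub>R z) \<bullet> z)^2))"
      by (intro ess_bdd_integrable ess_bdd_continuous integral_continuous_on_param
          continuous_on_subset[OF cont2]) simp
    show "(f (x + z) - f x)^2 \<le> integral (cbox 0 1) (\<lambda>t. (g (x + t *\<^sub>R z) \<bullet> z)^2)" for x
      unfolding C1_periodic_line_integral[OF fg]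
      by (rule integral_square_le) (auto intro!: cont)
  qed
  also have "\<dots> = integral (cbox 0 1) (\<lambda>t::real. \<integral>x. (g (x + t *\<^sub>R z) \<bullet> z)^2)"
    by (rule integral_torus_swap[OF cont2])
  also have "\<dots> = integral (cbox 0 1) (\<lambda>t::real. \<integral>x. (g x \<bullet> z)^2)"
    by (intro integral_cong integral_torus_shift periodic_compose[OF g(2), of "\<lambda>y. (y \<bullet> z)^2"] cont)
  also have "\<dots> = (\<integral>x. (g x \<bullet> z)^2)" by simp
  also have "\<dots> \<le> (\<integral>x. (norm z)^2 * (norm (g x))^2)"
  proof (rule integral_mono)
    show "(g x \<bullet> z)^2 \<le> (norm z)^2 * (norm (g x))^2" for x
      using Cauchy_Schwarz_ineq[of "g x" z] by (simp add: power2_norm_eq_inner mult.commute)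
  qed (intro ess_bdd_integrable ess_bdd_continuous continuous_intros g(1))+
  finally show ?thesis by simp
qed

text \<open>
  The deviation of \<open>f\<close> from its average over a box of side \<open>h\<close> is an average of increments. The box is
  parametrized by the unit cube, so that \<open>h\<close> enters only through the length of the shifts, which is at
  most \<open>h\<close> times the square root of the dimension.
\<close>

lemma average_estimate:
  fixes f :: "real^'n \<Rightarrow> real" and h :: real
  assumes fg: "C1_periodic f g"
  shows "(\<integral>x. (f x - integral (cbox 0 1) (\<lambda>z. f (x + h *\<^sub>R z)))^2)
    \<le> CARD('n) * h^2 * (\<integral>x. (norm (g x))^2)"
proof -
  have f: "periodic f" using fg by (auto simp: C1_periodic_def)
  have f_cont: "continuous_on UNIV f" by (rule C1_periodic_continuous[OF fg])
  note cont = continuous_on_compose_UNIV[OF f_cont] continuous_intros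
  have cont2: "continuous_on UNIV (\<lambda>(x, z). (f (x + h *\<^sub>R z) - f x)^2)"
    unfolding case_prod_unfold by (intro cont)
  have cont3: "continuous_on UNIV (\<lambda>(x, z). f (x + h *\<^sub>R z))"
    unfolding case_prod_unfold by (intro cont)
  have content: "measure lborel (cbox 0 (1::real^'n)) = 1"
    using torus.prob_space by (simp add: torus_def measure_restrict_space space_restrict_space)
  define E where "E = (\<integral>x. (norm (g x))^2)"
  have "E \<ge> 0" by (simp add: E_def)
  have square: "(f x - integral (cbox 0 1) (\<lambda>z. f (x + h *\<^sub>R z)))^2
      \<le> integral (cbox 0 1) (\<lambda>z. (f (x + h *\<^sub>R z) - f x)^2)" for x
  proof -
    have "integral (cbox 0 1) (\<lambda>z. f (x + h *\<^sub>R z) - f x)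
        = integral (cbox 0 1) (\<lambda>z. f (x + h *\<^sub>R z)) - integral (cbox 0 (1::real^'n)) (\<lambda>z. f x)"
      by (intro integral_diff integrable_continuous cont)
    also have "integral (cbox 0 (1::real^'n)) (\<lambda>z. f x) = f x" by (simp add: content)
    finally have "(f x - integral (cbox 0 1) (\<lambda>z. f (x + h *\<^sub>R z)))^2
        = (integral (cbox 0 1) (\<lambda>z. f (x + h *\<^sub>R z) - f x))^2" by (simp add: power2_commute)
    also have "\<dots> \<le> integral (cbox 0 1) (\<lambda>z. (f (x + h *\<^sub>R z) - f x)^2)"
      by (intro integral_square_le cont content)
    finally show ?thesis .
  qed
  have "(\<integral>x. (f x - integral (cbox 0 1) (\<lambda>z. f (x + h *\<^sub>R z)))^2)
      \<le> (\<integral>x. integral (cbox 0 1) (\<lambda>z. (f (x + h *\<^sub>R z) - f x)^2))"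
    using square
    by (intro integral_mono ess_bdd_integrable ess_bdd_continuous f_cont continuous_on_power
        continuous_on_diff integral_continuous_on_param continuous_on_subset[OF cont2]
        continuous_on_subset[OF cont3]) auto
  also have "\<dots> = integral (cbox 0 1) (\<lambda>z. \<integral>x. (f (x + h *\<^sub>R z) - f x)^2)"
    by (rule integral_torus_swap[OF cont2])
  also have "\<dots> \<le> integral (cbox 0 (1::real^'n)) (\<lambda>z. CARD('n) * h^2 * E)"
  proof (rule integral_le)
    have "continuous_on UNIV (\<lambda>z. integral (cbox 0 1) (\<lambda>x. (f (x + h *\<^sub>R z) - f x)^2))"
      by (intro integral_continuous_on_param) (simp add: case_prod_unfold, intro cont)
    moreover have "(\<integral>x. (f (x + h *\<^sub>R z) - f x)^2)
        = integral (cbox 0 1) (\<lambda>x. (f (x + h *\<^sub>R z) - f x)^2)" for z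
      by (intro integral_torus_continuous cont)
    ultimately show "(\<lambda>z. \<integral>x. (f (x + h *\<^sub>R z) - f x)^2) integrable_on cbox 0 1"
      by (simp add: integrable_continuous continuous_on_subset)
    show "(\<integral>x. (f (x + h *\<^sub>R z) - f x)^2) \<le> CARD('n) * h^2 * E"
      if "z \<in> cbox 0 1" for z :: "real^'n"
    proof -
      have "z \<bullet> z \<le> (\<Sum>i\<in>(UNIV::'n set). 1)"
        unfolding inner_vec_def using that
        by (intro sum_mono) (auto simp: mem_box_cart intro!: mult_le_one)
      then have "(norm (h *\<^sub>R z))^2 * E \<le> (h^2 * CARD('n)) * E"
        by (intro mult_right_mono \<open>E \<ge> 0\<close>)
           (auto simp: power_mult_distrib power2_norm_eq_inner intro!: mult_left_mono)
      then show ?thesis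
        using shift_estimate[OF fg, of "h *\<^sub>R z"] by (simp add: E_def mult_ac)
    qed
  qed (rule integrable_const)
  also have "\<dots> = CARD('n) * h^2 * E" by (simp add: content)
  finally show ?thesis by (simp add: E_def)
qed

text \<open>
  For \<open>h = 1\<close> the box is a full period and the local average is the mean.
\<close>

lemma Poincare_torus:
  fixes f :: "real^'n \<Rightarrow> real"
  assumes fg: "C1_periodic f g"
  shows "(\<integral>x. (f x - integral\<^sup>L torus f)^2) \<le> CARD('n) * (\<integral>x. (norm (g x))^2)"
proof -
  have f: "periodic f" using fg by (auto simp: C1_periodic_def)
  have f_cont: "continuous_on UNIV f" by (rule C1_periodic_continuous[OF fg])
  have "integral (cbox 0 1) (\<lambda>z. f (x + 1 *\<^sub>R z)) = integral\<^sup>L torus f" for x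
  proof -
    have "integral (cbox 0 1) (\<lambda>z. f (x + 1 *\<^sub>R z)) = (\<integral>z. f (z + x))"
      by (subst integral_torus_continuous)
         (auto intro!: continuous_on_compose_UNIV[OF f_cont] continuous_intros simp: add.commute)
    then show ?thesis by (simp add: integral_torus_shift[OF f_cont f])
  qed
  then show ?thesis using average_estimate[OF fg, of 1] by simp
qed

text \<open>
  Local averages over boxes of side \<open>h \<le> 1\<close> are bounded pointwise by the \<open>L\<^sup>1\<close> norm divided by the
  volume of the box, and they are close to \<open>f\<close> in mean square. This interpolation inequality replaces
  the Sobolev embedding in the estimate below.
\<close>

lemma Ehrling_torus:
  fixes f :: "real^'n \<Rightarrow> real" and h :: real
  assumes fg: "C1_periodic f g" and h: "0 < h" "h \<le> 1"
  shows "(\<integral>x. (f x)^2) \<le> 2 * CARD('n) * h^2 * (\<integral>x. (norm (g x))^2)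
    + 2 * ((\<integral>x. \<bar>f x\<bar>) / h ^ CARD('n))^2"
proof -
  have f: "periodic f" using fg by (auto simp: C1_periodic_def)
  have f_cont: "continuous_on UNIV f" by (rule C1_periodic_continuous[OF fg])
  note cont = continuous_on_compose_UNIV[OF f_cont] continuous_intros
  define A where "A x = integral (cbox 0 1) (\<lambda>z. f (x + h *\<^sub>R z))" for x
  define B where "B = (\<integral>x. \<bar>f x\<bar>) / h ^ CARD('n)"
  have A_cont: "continuous_on UNIV A"
    unfolding A_def by (intro integral_continuous_on_param) (simp add: case_prod_unfold, intro cont)
  have A_le: "\<bar>A x\<bar> \<le> B" for x
  proof -
    let ?F = "\<lambda>y. \<bar>f (x + y)\<bar>"
    have F: "continuous_on S ?F" for S by (intro cont)
    have sub: "cbox 0 (h *\<^sub>R 1) \<subseteq> cbox 0 (1::real^'n)"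
    proof
      fix y :: "real^'n" assume "y \<in> cbox 0 (h *\<^sub>R 1)"
      then have "0 \<le> y $ i \<and> y $ i \<le> h" for i by (simp add: mem_box_cart)
      then have "0 \<le> y $ i \<and> y $ i \<le> 1" for i using h(2) order_trans by blast
      then show "y \<in> cbox 0 1" by (simp add: mem_box_cart)
    qed
    have "((\<lambda>z. ?F (h *\<^sub>R z + 0)) has_integral (1 / (\<bar>h\<bar> ^ DIM(real^'n))) *\<^sub>R integral (cbox 0 (h *\<^sub>R 1)) ?F)
      ((\<lambda>z. (1 / h) *\<^sub>R z + - ((1 / h) *\<^sub>R 0)) ` cbox 0 (h *\<^sub>R 1))"
      using h by (intro has_integral_affinity integrable_integral integrable_continuous F) auto
    also have "(\<lambda>z. (1 / h) *\<^sub>R z + - ((1 / h) *\<^sub>R 0)) ` cbox 0 (h *\<^sub>R 1) = cbox 0 (1::real^'n)"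
      using h image_affinity_cbox[of "1 / h" 0 0 "h *\<^sub>R (1::real^'n)"]
      by (auto simp: cbox_interval less_eq_vec_def split: if_splits)
    finally have "integral (cbox 0 1) (\<lambda>z. ?F (h *\<^sub>R z)) = integral (cbox 0 (h *\<^sub>R 1)) ?F / h ^ CARD('n)"
      using h by (simp add: integral_unique)
    also have "\<dots> \<le> integral (cbox 0 1) ?F / h ^ CARD('n)"
      using h by (intro divide_right_mono integral_subset_le integrable_continuous F sub) auto
    also have "integral (cbox 0 1) ?F = (\<integral>y. \<bar>f (y + x)\<bar>)"
      by (subst integral_torus_continuous) (auto simp: add.commute intro!: cont)
    also have "\<dots> = (\<integral>y. \<bar>f y\<bar>)"
      by (intro integral_torus_shift cont f_cont periodic_compose[OF f, of abs])
    finally have 1: "integral (cbox 0 1) (\<lambda>z. ?F (h *\<^sub>R z)) \<le> B" by (simp add: B_def)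
    have "norm (A x) \<le> integral (cbox 0 1) (\<lambda>z. ?F (h *\<^sub>R z))"
      unfolding A_def by (intro integral_norm_bound_integral integrable_continuous cont) auto
    with 1 show ?thesis by simp
  qed
  have "(\<integral>x. (f x)^2) \<le> (\<integral>x. 2 * (f x - A x)^2 + 2 * B^2)"
  proof (rule integral_mono)
    fix x
    have "(A x)^2 \<le> B^2" using A_le[of x] by (metis abs_ge_zero power2_abs power_mono)
    moreover have "(f x)^2 \<le> 2 * (f x - A x)^2 + 2 * (A x)^2"
      using zero_le_power2[of "f x - 2 * A x"] by (simp add: power2_eq_square algebra_simps)
    ultimately show "(f x)^2 \<le> 2 * (f x - A x)^2 + 2 * B^2" by simp
  qed (intro ess_bdd_integrable ess_bdd_continuous continuous_intros f_cont A_cont)+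
  also have "\<dots> = 2 * (\<integral>x. (f x - A x)^2) + 2 * B^2"
  proof -
    have "integrable torus (\<lambda>x. (f x - A x)^2)"
      by (intro ess_bdd_integrable ess_bdd_continuous continuous_intros f_cont A_cont)
    then show ?thesis by (simp add: torus.prob_space)
  qed
  also have "(\<integral>x. (f x - A x)^2) \<le> CARD('n) * h^2 * (\<integral>x. (norm (g x))^2)"
    unfolding A_def by (rule average_estimate[OF fg])
  finally show ?thesis by (simp add: B_def mult_ac)
qed

section \<open>A priori estimates for smooth solutions\<close>

text \<open>
  The weak form of \<open>- \<kappa> \<Delta>v = div G\<close> with \<open>p = Dv\<close>, where the flux \<open>G\<close> is a drift term \<open>v b\<close> with
  \<open>|b| \<le> L\<close> up to an error of size \<open>h\<close>. Only the bound on the flux is recorded: no estimate sees more of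
  the drift.
\<close>

definition drift_diffusion ::
  "real \<Rightarrow> real \<Rightarrow> (real^'n \<Rightarrow> real) \<Rightarrow> (real^'n \<Rightarrow> real^'n) \<Rightarrow> (real^'n \<Rightarrow> real^'n) \<Rightarrow> (real^'n \<Rightarrow> real) \<Rightarrow> bool"
  where
  "drift_diffusion \<kappa> L v p G h \<longleftrightarrow> C1_periodic v p \<and> (\<forall>i. ess_bdd (\<lambda>x. G x $ i)) \<and> ess_bdd h \<and>
     (AE x in torus. norm (G x) \<le> L * \<bar>v x\<bar> + h x) \<and>
     (\<forall>\<phi> q. C1_periodic \<phi> q \<longrightarrow> \<kappa> * (\<integral>x. p x \<bullet> q x) = - (\<integral>x. G x \<bullet> q x))"

lemma C1_periodic_compose:
  assumes v: "C1_periodic v p"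
    and \<Psi>: "\<And>s. (\<Psi> has_real_derivative w s) (at s)" and w: "continuous_on UNIV w"
  shows "C1_periodic (\<lambda>x. \<Psi> (v x)) (\<lambda>x. w (v x) *\<^sub>R p x)"
proof -
  have "((\<lambda>x. \<Psi> (v x)) has_derivative (\<lambda>h. (w (v x) *\<^sub>R p x) \<bullet> h)) (at x)" for x
    using has_derivative_compose[of v "\<lambda>h. p x \<bullet> h" x UNIV \<Psi> "\<lambda>h. w (v x) * h"] v \<Psi>[of "v x"]
    by (simp add: C1_periodic_def has_field_derivative_def)
  moreover have "continuous_on UNIV (\<lambda>x. w (v x) *\<^sub>R p x)"
    using v by (auto simp: C1_periodic_def
        intro!: continuous_intros continuous_on_compose_UNIV[OF w] C1_periodic_continuous[OF v])
  ultimately show ?thesis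
    using v by (simp add: C1_periodic_def periodic_def)
qed

text \<open>
  The equation is tested with \<open>\<Psi> \<circ> v\<close>, whose gradient is \<open>w(v) p\<close>, and the product \<open>G \<cdot> p\<close> is split by
  Young's inequality.
\<close>

lemma weighted_energy_estimate:
  assumes \<kappa>: "\<kappa> > 0" and sol: "drift_diffusion \<kappa> L v p G h"
    and \<Psi>: "\<And>s. (\<Psi> has_real_derivative w s) (at s)" and w: "continuous_on UNIV w" "\<And>s. w s \<ge> 0"
  shows "(\<integral>x. w (v x) * (norm (p x))^2) \<le> (\<integral>x. w (v x) * (L * \<bar>v x\<bar> + h x)^2) / \<kappa>^2"
proof -
  have v: "C1_periodic v p" and G: "\<And>i. ess_bdd (\<lambda>x. G x $ i)" and h: "ess_bdd h"
    and le: "AE x in torus. norm (G x) \<le> L * \<bar>v x\<bar> + h x"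
    and weak: "\<And>\<phi> q. C1_periodic \<phi> q \<Longrightarrow> \<kappa> * (\<integral>x. p x \<bullet> q x) = - (\<integral>x. G x \<bullet> q x)"
    using sol by (auto simp: drift_diffusion_def)
  have p: "continuous_on UNIV p" using v by (simp add: C1_periodic_def)
  have v_cont: "continuous_on UNIV v" by (rule C1_periodic_continuous[OF v])
  note bdd = ess_bdd_intros h ess_bdd_continuous[OF v_cont]
    ess_bdd_continuous[OF continuous_on_compose_UNIV[OF w(1) v_cont]]
  have p2: "ess_bdd (\<lambda>x. (norm (p x))^2)"
    by (intro ess_bdd_continuous continuous_intros p)
  have pi: "ess_bdd (\<lambda>x. p x $ i)" for i
    by (intro ess_bdd_continuous continuous_intros p)
  let ?E = "\<integral>x. w (v x) * (norm (p x))^2"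
  let ?R = "\<integral>x. w (v x) * (L * \<bar>v x\<bar> + h x)^2"
  have "\<kappa> * ?E = \<kappa> * (\<integral>x. p x \<bullet> (w (v x) *\<^sub>R p x))"
    by (simp add: power2_norm_eq_inner)
  also have "\<dots> = (\<integral>x. - (G x \<bullet> (w (v x) *\<^sub>R p x)))"
    by (subst weak[OF C1_periodic_compose[OF v \<Psi> w(1)]]) simp
  also have "\<dots> \<le> (\<integral>x. \<kappa> / 2 * (w (v x) * (norm (p x))^2)
      + 1 / (2 * \<kappa>) * (w (v x) * (L * \<bar>v x\<bar> + h x)^2))"
  proof (rule integral_mono_AE)
    show "AE x in torus. - (G x \<bullet> (w (v x) *\<^sub>R p x)) \<le> \<kappa> / 2 * (w (v x) * (norm (p x))^2)
      + 1 / (2 * \<kappa>) * (w (v x) * (L * \<bar>v x\<bar> + h x)^2)"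
      using le
    proof eventually_elim
      case (elim x)
      define a b where "a = L * \<bar>v x\<bar> + h x" and "b = norm (p x)"
      have "- (G x \<bullet> p x) \<le> norm (G x) * b"
        unfolding b_def using Cauchy_Schwarz_ineq2[of "G x" "p x"] by linarith
      also have "\<dots> \<le> a * b" unfolding a_def b_def by (intro mult_right_mono elim) auto
      also have "a * b \<le> \<kappa> / 2 * b^2 + 1 / (2 * \<kappa>) * a^2"
        using zero_le_power2[of "\<kappa> * b - a"] \<kappa> by (simp add: field_simps power2_eq_square)
      finally have "w (v x) * (- (G x \<bullet> p x)) \<le> w (v x) * (\<kappa> / 2 * b^2 + 1 / (2 * \<kappa>) * a^2)"
        by (intro mult_left_mono w)
      then show ?case by (simp add: a_def b_def algebra_simps)
    qed
    have "ess_bdd (\<lambda>x. - (w (v x) * (G x \<bullet> p x)))"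
      by (intro bdd ess_bdd_inner G pi)
    then have "integrable torus (\<lambda>x. - (w (v x) * (G x \<bullet> p x)))"
      by (rule ess_bdd_integrable)
    then show "integrable torus (\<lambda>x. - (G x \<bullet> (w (v x) *\<^sub>R p x)))" by simp
  qed (intro ess_bdd_integrable bdd p2)
  also have "\<dots> = \<kappa> / 2 * ?E + 1 / (2 * \<kappa>) * ?R"
  proof -
    have "integrable torus (\<lambda>x. w (v x) * (norm (p x))^2)"
      "integrable torus (\<lambda>x. w (v x) * (L * \<bar>v x\<bar> + h x)^2)"
      by (intro ess_bdd_integrable bdd p2)+
    then show ?thesis by simp
  qed
  finally show ?thesis using \<kappa> by (simp add: field_simps power2_eq_square)
qed

text \<open>
  The key estimate. With the weight \<open>w s = 1 / (1 + s\<^sup>2)\<close>, which is the derivative of \<open>arctan\<close> and the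
  square of the derivative of \<open>arsinh\<close>, the drift contributes a bounded amount to the weighted energy
  whatever the size of \<open>v\<close>. The left side of the energy estimate is the Dirichlet integral of
  \<open>arsinh v\<close>, so the Poincare inequality bounds the distance of \<open>arsinh v\<close> to its mean, and that mean
  is invisible when integrated against \<open>q\<close>.
\<close>

lemma arsinh_oscillation:
  fixes v :: "real^'n \<Rightarrow> real"
  assumes \<kappa>: "\<kappa> > 0" and sol: "drift_diffusion \<kappa> L v p G h"
    and q: "ess_bdd q" "integral\<^sup>L torus q = 0"
  shows "(\<integral>x. q x * arsinh (v x))^2
    \<le> CARD('n) * (2 * (L^2 + (\<integral>x. (h x)^2)) / \<kappa>^2) * (\<integral>x. (q x)^2)"
proof -
  have v: "C1_periodic v p" and h: "ess_bdd h"
    using sol by (auto simp: drift_diffusion_def)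
  have v_cont: "continuous_on UNIV v" by (rule C1_periodic_continuous[OF v])
  define f where "f x = arsinh (v x)" for x
  have der: "((arsinh :: real \<Rightarrow> real) has_real_derivative 1 / sqrt (s^2 + 1)) (at s)" for s
    by (rule arsinh_real_has_field_derivative)
  have sq_pos: "s^2 + 1 > 0" for s :: real by (simp add: add_nonneg_pos)
  then have sq_nz: "s^2 + 1 \<noteq> 0" "1 + s^2 \<noteq> 0" for s :: real
    using less_irrefl by (metis add.commute)+
  have f: "C1_periodic f (\<lambda>x. (1 / sqrt ((v x)^2 + 1)) *\<^sub>R p x)"
    unfolding f_def using sq_nz
    by (intro C1_periodic_compose[OF v der]) (auto intro!: continuous_intros)
  have f_bdd: "ess_bdd f" by (rule ess_bdd_continuous[OF C1_periodic_continuous[OF f]])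
  define a where "a = integral\<^sup>L torus f"
  have w_cont: "continuous_on UNIV (\<lambda>s::real. 1 / (1 + s^2))"
    using sq_nz by (auto intro!: continuous_intros)
  have "(\<integral>x. (norm ((1 / sqrt ((v x)^2 + 1)) *\<^sub>R p x))^2)
      = (\<integral>x. 1 / (1 + (v x)^2) * (norm (p x))^2)"
    using sq_pos by (simp add: power_mult_distrib power_divide add.commute less_imp_le)
  also have "\<dots> \<le> (\<integral>x. 1 / (1 + (v x)^2) * (L * \<bar>v x\<bar> + h x)^2) / \<kappa>^2"
  proof (rule weighted_energy_estimate[OF \<kappa> sol _ w_cont])
    show "(arctan has_real_derivative 1 / (1 + s^2)) (at s)" for s
      using DERIV_arctan[of s] by (simp add: inverse_eq_divide)
  qed simp
  also have "\<dots> \<le> (\<integral>x. 2 * (L^2 + (h x)^2)) / \<kappa>^2"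
  proof (intro divide_right_mono integral_mono)
    fix x
    have "(L * \<bar>v x\<bar> + h x)^2 \<le> 2 * (L * \<bar>v x\<bar>)^2 + 2 * (h x)^2"
      using zero_le_power2[of "L * \<bar>v x\<bar> - h x"] by (simp add: power2_eq_square algebra_simps)
    also have "\<dots> \<le> (1 + (v x)^2) * (2 * (L^2 + (h x)^2))"
      by (simp add: algebra_simps power_mult_distrib)
    finally show "1 / (1 + (v x)^2) * (L * \<bar>v x\<bar> + h x)^2 \<le> 2 * (L^2 + (h x)^2)"
      using sq_pos[of "v x"] by (simp add: divide_le_eq mult.commute add.commute)
  qed (intro ess_bdd_rules h ess_bdd_continuous[OF v_cont]
        ess_bdd_continuous[OF continuous_on_compose_UNIV[OF w_cont v_cont]] zero_le_power2)+
  also have "(\<integral>x. 2 * (L^2 + (h x)^2)) = 2 * (L^2 + (\<integral>x. (h x)^2))"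
    using ess_bdd_integrable[OF ess_bdd_power[OF h, of 2]] by (simp add: torus.prob_space)
  finally have grad: "(\<integral>x. (norm ((1 / sqrt ((v x)^2 + 1)) *\<^sub>R p x))^2)
      \<le> 2 * (L^2 + (\<integral>x. (h x)^2)) / \<kappa>^2" .
  have osc: "(\<integral>x. (f x - a)^2) \<le> CARD('n) * (2 * (L^2 + (\<integral>x. (h x)^2)) / \<kappa>^2)"
    using Poincare_torus[OF f] mult_left_mono[OF grad, of "real CARD('n)"] by (simp add: a_def)
  have "integrable torus (\<lambda>x. q x * f x)" "integrable torus q"
    by (intro ess_bdd_rules q f_bdd)+
  then have "(\<integral>x. q x * f x) = (\<integral>x. (f x - a) * q x)"
    by (simp add: algebra_simps q)
  then have "(\<integral>x. q x * f x)^2 \<le> (\<integral>x. (f x - a)^2) * (\<integral>x. (q x)^2)"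
    using Cauchy_Schwarz_torus[of "\<lambda>x. f x - a" q] f_bdd q by (simp add: ess_bdd_intros)
  also have "\<dots> \<le> CARD('n) * (2 * (L^2 + (\<integral>x. (h x)^2)) / \<kappa>^2) * (\<integral>x. (q x)^2)"
    by (intro mult_right_mono osc) simp
  finally show ?thesis by (simp add: f_def)
qed

text \<open>
  A lower bound for \<open>s arsinh s\<close> that is affine in \<open>|s|\<close>; this turns a bound on \<open>\<integral> v arsinh v\<close> into one
  on \<open>\<integral> |v|\<close> without any splitting into level sets.
\<close>

lemma arsinh_chord:
  fixes s t :: real assumes "t \<ge> 0"
  shows "(\<bar>s\<bar> - t) * arsinh t \<le> s * arsinh s"
proof -
  have e: "s * arsinh s = \<bar>s\<bar> * arsinh \<bar>s\<bar>" by (simp add: abs_if)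
  have mono: "arsinh a \<le> arsinh b" if "a \<le> b" for a b :: real
    using that by (cases "a = b") (auto intro: less_imp_le)
  have nn: "arsinh a \<ge> 0" if "a \<ge> 0" for a :: real
    using mono[OF that] by simp
  show ?thesis
  proof (cases "t \<le> \<bar>s\<bar>")
    case True
    then have "(\<bar>s\<bar> - t) * arsinh t \<le> \<bar>s\<bar> * arsinh \<bar>s\<bar>"
      using assms by (intro mult_mono mono nn) auto
    then show ?thesis by (simp add: e)
  next
    case False
    then have "(\<bar>s\<bar> - t) * arsinh t \<le> 0"
      using nn[OF assms] by (simp add: mult_le_0_iff)
    also have "0 \<le> \<bar>s\<bar> * arsinh \<bar>s\<bar>" by (simp add: nn)
    finally show ?thesis by (simp add: e)
  qed
qed

text \<open>
  If the norm \<open>N\<close> of \<open>v\<close> is at least 1, the energy estimate makes the Dirichlet integral of order \<open>N\<^sup>2\<close>,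
  and the Ehrling inequality on a scale \<open>\<epsilon>\<close> small enough to absorb it gives \<open>\<integral> |v| \<ge> c N\<close>. The
  oscillation bound for \<open>q = v\<close> then reads \<open>(c N / 2) arsinh (c N / 2) \<le> sqrt K N\<close>, which bounds
  \<open>N\<close>.
\<close>

lemma unit_source_bound:
  assumes \<kappa>: "\<kappa> > 0"
  shows "\<exists>C>0. \<forall>(v :: real^'n \<Rightarrow> real) p G h. drift_diffusion \<kappa> L v p G h \<longrightarrow> integral\<^sup>L torus v = 0 \<longrightarrow>
    (\<integral>x. (h x)^2) \<le> 1 \<longrightarrow> (\<integral>x. (v x)^2) \<le> C"
proof -
  define A where "A = 2 * L^2 / \<kappa>^2"
  define B where "B = 2 / \<kappa>^2"
  define K where "K = CARD('n) * (2 * (L^2 + 1) / \<kappa>^2)"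
  \<comment> \<open>The scale at which the Ehrling inequality absorbs half of \<open>N\<^sup>2\<close>: \<open>2 d \<epsilon>\<^sup>2 (A + B) \<le> 1/2\<close>.\<close>
  define \<epsilon> where "\<epsilon> = 1 / sqrt (1 + 4 * CARD('n) * (A + B))"
  \<comment> \<open>The ratio between \<open>\<integral> |v|\<close> and \<open>N\<close> that survives.\<close>
  define c where "c = \<epsilon> ^ CARD('n) / 2"
  define N0 where "N0 = 2 / c * sinh (2 * sqrt K / c)"
  have AB: "A \<ge> 0" "B \<ge> 0" by (auto simp: A_def B_def)
  have K: "K \<ge> 0" by (simp add: K_def)
  have D: "1 + 4 * CARD('n) * (A + B) \<ge> 1" using AB by simp
  have \<epsilon>: "0 < \<epsilon>" "\<epsilon> \<le> 1" and \<epsilon>2: "\<epsilon>^2 = 1 / (1 + 4 * CARD('n) * (A + B))"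
  proof -
    have "0 < 1 / sqrt Z \<and> 1 / sqrt Z \<le> 1 \<and> (1 / sqrt Z)^2 = 1 / Z" if "Z \<ge> 1" for Z :: real
      using that by (auto simp: power_divide)
    from this[OF D] show "0 < \<epsilon>" "\<epsilon> \<le> 1" "\<epsilon>^2 = 1 / (1 + 4 * CARD('n) * (A + B))"
      by (auto simp: \<epsilon>_def)
  qed
  have c: "c > 0" using \<epsilon> by (simp add: c_def)
  have "(\<integral>x. (v x)^2) \<le> (max 1 N0)^2"
    if sol: "drift_diffusion \<kappa> L v p G h" and mean: "integral\<^sup>L torus v = 0"
      and h1: "(\<integral>x. (h x)^2) \<le> 1" for v :: "real^'n \<Rightarrow> real" and p G h
  proof -
    have v: "C1_periodic v p" and h: "ess_bdd h"
      using sol by (auto simp: drift_diffusion_def)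
    have v_bdd: "ess_bdd v" by (rule ess_bdd_continuous[OF C1_periodic_continuous[OF v]])
    define N where "N = sqrt (\<integral>x. (v x)^2)"
    have N: "N \<ge> 0" "(\<integral>x. (v x)^2) = N^2" by (auto simp: N_def)
    have int: "integrable torus (\<lambda>x. (v x)^2)" "integrable torus (\<lambda>x. (h x)^2)" "integrable torus (\<lambda>x. \<bar>v x\<bar>)"
      by (intro ess_bdd_rules v_bdd h)+
    define S where "S = (\<integral>x. \<bar>v x\<bar>)"
    have "S \<ge> 0" by (simp add: S_def)
    have "N \<le> max 1 N0"
    proof (cases "N \<le> 1")
      case False
      then have N1: "1 \<le> N" by simp
      have "(\<integral>x. (norm (p x))^2) \<le> (\<integral>x. (L * \<bar>v x\<bar> + h x)^2) / \<kappa>^2"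
        using weighted_energy_estimate[OF \<kappa> sol, of "\<lambda>s. s" "\<lambda>s. 1"] by simp
      also have "\<dots> \<le> (\<integral>x. 2 * L^2 * (v x)^2 + 2 * (h x)^2) / \<kappa>^2"
      proof (intro divide_right_mono integral_mono)
        show "(L * \<bar>v x\<bar> + h x)^2 \<le> 2 * L^2 * (v x)^2 + 2 * (h x)^2" for x
          using zero_le_power2[of "L * \<bar>v x\<bar> - h x"] by (simp add: power2_eq_square algebra_simps)
      qed (auto intro!: ess_bdd_rules h v_bdd)
      also have "\<dots> = (2 * L^2 * N^2 + 2 * (\<integral>x. (h x)^2)) / \<kappa>^2"
        using int N by simp
      also have "\<dots> \<le> (2 * L^2 * N^2 + 2 * N^2) / \<kappa>^2"
        using order_trans[OF h1 one_le_power[OF N1, of 2]] by (intro divide_right_mono) auto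
      also have "\<dots> = (A + B) * N^2" by (simp add: A_def B_def add_divide_distrib algebra_simps)
      finally have grad: "(\<integral>x. (norm (p x))^2) \<le> (A + B) * N^2" .
      have "N^2 \<le> 2 * CARD('n) * \<epsilon>^2 * (\<integral>x. (norm (p x))^2) + 2 * (S / \<epsilon> ^ CARD('n))^2"
        using Ehrling_torus[OF v \<epsilon>] by (simp add: N S_def)
      also have "\<dots> \<le> 2 * CARD('n) * \<epsilon>^2 * ((A + B) * N^2) + 2 * (S / \<epsilon> ^ CARD('n))^2"
        by (intro add_mono mult_left_mono grad) auto
      also have "2 * CARD('n) * \<epsilon>^2 * ((A + B) * N^2) = (2 * CARD('n) * \<epsilon>^2 * (A + B)) * N^2"
        by simp
      also have "2 * CARD('n) * \<epsilon>^2 * (A + B) \<le> 1 / 2"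
        unfolding \<epsilon>2 by (simp add: divide_le_eq) (use D in linarith)
      finally have "N^2 \<le> 1 / 2 * N^2 + 2 * (S / \<epsilon> ^ CARD('n))^2" by (simp add: mult_right_mono)
      moreover have "(2 * (S / \<epsilon> ^ CARD('n)))^2 = 4 * (S / \<epsilon> ^ CARD('n))^2"
        by (subst power_mult_distrib) simp
      ultimately have "N^2 \<le> (2 * (S / \<epsilon> ^ CARD('n)))^2" by linarith
      then have "N \<le> 2 * (S / \<epsilon> ^ CARD('n))"
        using \<open>S \<ge> 0\<close> \<epsilon> by (intro power2_le_imp_le[of N]) auto
      then have Sc: "c * N \<le> S" using \<epsilon> by (simp add: c_def field_simps)
      \<comment> \<open>Half of the lower bound for \<open>\<integral> |v|\<close>, so that the chord at \<open>t\<close> loses at most half of it.\<close>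
      define t where "t = c * N / 2"
      have t: "t > 0" using c N1 by (simp add: t_def)
      then have "arsinh t \<ge> 0" by (simp add: less_imp_le)
      have "t * arsinh t \<le> (S - t) * arsinh t"
        using Sc \<open>arsinh t \<ge> 0\<close> by (intro mult_right_mono) (auto simp: t_def mult.commute)
      also have "\<dots> = (\<integral>x. (\<bar>v x\<bar> - t) * arsinh t)"
        using int by (simp add: S_def torus.prob_space)
      also have "\<dots> \<le> (\<integral>x. v x * arsinh (v x))"
        using t by (intro integral_mono arsinh_chord ess_bdd_rules v_bdd
            ess_bdd_continuous_comp[OF v_bdd, of arsinh] continuous_on_arsinh) auto
      also have "\<dots> \<le> sqrt K * N"
      proof (rule power2_le_imp_le)
        have "(\<integral>x. v x * arsinh (v x))^2
            \<le> CARD('n) * (2 * (L^2 + (\<integral>x. (h x)^2)) / \<kappa>^2) * N^2"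
          using arsinh_oscillation[OF \<kappa> sol v_bdd mean] N by simp
        also have "\<dots> \<le> K * N^2"
          unfolding K_def using h1
          by (intro mult_right_mono mult_left_mono divide_right_mono) auto
        finally show "(\<integral>x. v x * arsinh (v x))^2 \<le> (sqrt K * N)^2"
          using K by (simp add: power_mult_distrib)
      qed (use K N in auto)
      finally have "N * (c / 2 * arsinh t) \<le> N * sqrt K" by (simp add: t_def mult_ac)
      then have "c / 2 * arsinh t \<le> sqrt K" using N1 by (simp add: mult_le_cancel_left)
      then have "arsinh t \<le> 2 * sqrt K / c" using c by (simp add: field_simps)
      then have "t \<le> sinh (2 * sqrt K / c)" by (metis sinh_arsinh_real sinh_real_le_iff)
      then have "N \<le> N0" using c by (simp add: N0_def t_def field_simps)
      then show ?thesis by simp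
    qed auto
    then show ?thesis unfolding N(2) using N(1) by (intro power_mono) auto
  qed
  then show ?thesis
    by (intro exI[of _ "(max 1 N0)^2"]) (auto simp: max_def)
qed

lemma drift_diffusion_scale:
  assumes "drift_diffusion \<kappa> L v p G h" "c \<ge> 0"
  shows "drift_diffusion \<kappa> L (\<lambda>x. c * v x) (\<lambda>x. c *\<^sub>R p x) (\<lambda>x. c *\<^sub>R G x) (\<lambda>x. c * h x)"
proof -
  have "C1_periodic (\<lambda>x. c * v x) (\<lambda>x. c *\<^sub>R p x)"
    using C1_periodic_compose[of v p "\<lambda>s. c * s" "\<lambda>s. c"] assms
    by (auto simp: drift_diffusion_def intro!: derivative_eq_intros)
  moreover have "AE x in torus. norm (c *\<^sub>R G x) \<le> L * \<bar>c * v x\<bar> + c * h x"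
  proof -
    have "AE x in torus. norm (G x) \<le> L * \<bar>v x\<bar> + h x"
      using assms by (simp add: drift_diffusion_def)
    then show ?thesis
    proof eventually_elim
      case (elim x)
      then have "c * norm (G x) \<le> c * (L * \<bar>v x\<bar> + h x)" using assms by (intro mult_left_mono) auto
      then show ?case using assms by (simp add: abs_mult algebra_simps)
    qed
  qed
  ultimately show ?thesis
    using assms by (auto simp: drift_diffusion_def mult.left_commute[of \<kappa> c] intro!: ess_bdd_intros)
qed

text \<open>
  By linearity the source may be normalized. The parameter \<open>\<delta>\<close> is only required to dominate the norm
  of \<open>h\<close>, so that it can stay positive when the source vanishes.
\<close>

lemma drift_diffusion_L2_bound:
  assumes \<kappa>: "\<kappa> > 0"
  shows "\<exists>C>0. \<forall>(v :: real^'n \<Rightarrow> real) p G h \<delta>. drift_diffusion \<kappa> L v p G h \<longrightarrow> integral\<^sup>L torus v = 0 \<longrightarrow>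
    \<delta> > 0 \<longrightarrow> (\<integral>x. (h x)^2) \<le> \<delta>^2 \<longrightarrow> (\<integral>x. (v x)^2) \<le> C * \<delta>^2"
proof -
  obtain C where C: "C > 0" and *: "\<And>(v :: real^'n \<Rightarrow> real) p G h. drift_diffusion \<kappa> L v p G h \<Longrightarrow>
      integral\<^sup>L torus v = 0 \<Longrightarrow> (\<integral>x. (h x)^2) \<le> 1 \<Longrightarrow> (\<integral>x. (v x)^2) \<le> C"
    using unit_source_bound[OF \<kappa>, of L] by blast
  have "(\<integral>x. (v x)^2) \<le> C * \<delta>^2"
    if "drift_diffusion \<kappa> L v p G h" "integral\<^sup>L torus v = 0" "\<delta> > 0" "(\<integral>x. (h x)^2) \<le> \<delta>^2"
    for v :: "real^'n \<Rightarrow> real" and p G h \<delta>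
    using *[OF drift_diffusion_scale[OF that(1), of "1 / \<delta>"]] that
    by (simp add: power_divide field_simps)
  with C show ?thesis by blast
qed

section \<open>Trigonometric polynomials\<close>

text \<open>
  Trigonometric polynomials, generated as an algebra: closure under partial derivatives and the
  tensor decomposition of \<open>f (x - y)\<close> are then plain inductions.
\<close>

inductive_set trig :: "(real^'n \<Rightarrow> real) set" where
  const: "(\<lambda>x. c) \<in> trig"
| cos: "(\<lambda>x. cos (2 * pi * x $ i)) \<in> trig"
| sin: "(\<lambda>x. sin (2 * pi * x $ i)) \<in> trig"
| add: "f \<in> trig \<Longrightarrow> g \<in> trig \<Longrightarrow> (\<lambda>x. f x + g x) \<in> trig"
| mult: "f \<in> trig \<Longrightarrow> g \<in> trig \<Longrightarrow> (\<lambda>x. f x * g x) \<in> trig"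

lemma trig_cmult: "f \<in> trig \<Longrightarrow> (\<lambda>x. c * f x) \<in> trig"
  using trig.mult[OF trig.const] .

lemma trig_uminus: "f \<in> trig \<Longrightarrow> (\<lambda>x. - f x) \<in> trig"
  using trig_cmult[of f "-1"] by simp

lemma trig_prod: "(\<And>i. i \<in> I \<Longrightarrow> f i \<in> trig) \<Longrightarrow> (\<lambda>x. \<Prod>i\<in>I. f i x) \<in> trig"
  by (induction I rule: infinite_finite_induct) (auto intro: trig.intros)

lemma trig_power: "f \<in> trig \<Longrightarrow> (\<lambda>x. f x ^ k) \<in> trig"
  by (induction k) (auto intro: trig.intros)

lemma cos_sin_add_2pi_Ints:
  assumes "k \<in> \<int>"
  shows "cos (2 * pi * (x + k)) = cos (2 * pi * x)" "sin (2 * pi * (x + k)) = sin (2 * pi * x)"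
proof -
  obtain m where k: "k = of_int m" using assms by (auto elim: Ints_cases)
  have "cos (2 * pi * k) = 1" "sin (2 * pi * k) = 0"
    using cos_int_2pin[of m] sin_int_2pin[of m] by (simp_all add: k mult_ac)
  then show "cos (2 * pi * (x + k)) = cos (2 * pi * x)" "sin (2 * pi * (x + k)) = sin (2 * pi * x)"
    by (simp_all add: distrib_left cos_add sin_add)
qed

lemma trig_periodic: "f \<in> trig \<Longrightarrow> periodic f"
  by (induction rule: trig.induct) (simp_all add: periodic_def cos_sin_add_2pi_Ints)

lemma trig_derivative:
  fixes f :: "real^'n \<Rightarrow> real"
  assumes "f \<in> trig"
  shows "\<exists>g. (\<forall>i. (\<lambda>x. g x $ i) \<in> trig) \<and> (\<forall>x. (f has_derivative (\<lambda>h. g x \<bullet> h)) (at x))"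
  using assms
proof (induction rule: trig.induct)
  case (const c)
  then show ?case by (intro exI[of _ "\<lambda>x. 0"]) (auto intro: trig.intros)
next
  case (cos i)
  have "((\<lambda>x. cos (2 * pi * x $ i)) has_derivative
      (\<lambda>h. axis i (- (2 * pi * sin (2 * pi * x $ i))) \<bullet> h)) (at x)" for x :: "real^'n"
    by (auto intro!: derivative_eq_intros bounded_linear.has_derivative[OF bounded_linear_vec_nth]
        simp: inner_axis' fun_eq_iff)
  moreover have "(\<lambda>x. axis i (- (2 * pi * sin (2 * pi * x $ i))) $ j) \<in> trig" for j :: 'n
    by (cases "j = i") (auto simp: axis_def intro!: trig_uminus trig_cmult trig.intros)
  ultimately show ?case
    by (intro exI[of _ "\<lambda>x. axis i (- (2 * pi * sin (2 * pi * x $ i)))"]) blast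
next
  case (sin i)
  have "((\<lambda>x. sin (2 * pi * x $ i)) has_derivative
      (\<lambda>h. axis i (2 * pi * cos (2 * pi * x $ i)) \<bullet> h)) (at x)" for x :: "real^'n"
    by (auto intro!: derivative_eq_intros bounded_linear.has_derivative[OF bounded_linear_vec_nth]
        simp: inner_axis' fun_eq_iff)
  moreover have "(\<lambda>x. axis i (2 * pi * cos (2 * pi * x $ i)) $ j) \<in> trig" for j :: 'n
    by (cases "j = i") (auto simp: axis_def intro!: trig_cmult trig.intros)
  ultimately show ?case
    by (intro exI[of _ "\<lambda>x. axis i (2 * pi * cos (2 * pi * x $ i))"]) blast
next
  case (add f g)
  then obtain F G where
    F: "\<And>i. (\<lambda>x. F x $ i) \<in> trig" "\<And>x. (f has_derivative (\<lambda>h. F x \<bullet> h)) (at x)" and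
    G: "\<And>i. (\<lambda>x. G x $ i) \<in> trig" "\<And>x. (g has_derivative (\<lambda>h. G x \<bullet> h)) (at x)" by blast
  have "((\<lambda>x. f x + g x) has_derivative (\<lambda>h. (F x + G x) \<bullet> h)) (at x)" for x
    using has_derivative_add[OF F(2) G(2)] by (simp add: inner_add_left)
  then show ?case
    by (intro exI[of _ "\<lambda>x. F x + G x"]) (auto intro: trig.intros F(1) G(1))
next
  case (mult f g)
  then obtain F G where
    F: "\<And>i. (\<lambda>x. F x $ i) \<in> trig" "\<And>x. (f has_derivative (\<lambda>h. F x \<bullet> h)) (at x)" and
    G: "\<And>i. (\<lambda>x. G x $ i) \<in> trig" "\<And>x. (g has_derivative (\<lambda>h. G x \<bullet> h)) (at x)" by blast
  have "((\<lambda>x. f x * g x) has_derivative (\<lambda>h. (f x *\<^sub>R G x + g x *\<^sub>R F x) \<bullet> h)) (at x)" for x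
    using has_derivative_mult[OF F(2) G(2)] by (simp add: inner_add_left algebra_simps)
  then show ?case
    by (intro exI[of _ "\<lambda>x. f x *\<^sub>R G x + g x *\<^sub>R F x"]) (auto intro!: trig.intros F(1) G(1) mult.hyps)
qed

lemma partial_deriv_eq:
  "(f has_derivative (\<lambda>h. g \<bullet> h)) (at x) \<Longrightarrow> partial_deriv i f x = g $ i"
  using frechet_derivative_at[of f "\<lambda>h. g \<bullet> h" x] unfolding partial_deriv_def
  by (metis inner_axis mult.right_neutral inner_real_def)

lemma
  assumes "f \<in> trig"
  shows trig_has_derivative_grad: "(f has_derivative (\<lambda>h. grad f x \<bullet> h)) (at x)"
    and partial_deriv_trig: "partial_deriv i f \<in> trig"
proof -
  obtain g where g: "\<And>i. (\<lambda>x. g x $ i) \<in> trig" "\<And>x. (f has_derivative (\<lambda>h. g x \<bullet> h)) (at x)"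
    using trig_derivative[OF assms] by blast
  have p: "partial_deriv j f y = g y $ j" for j y
    by (rule partial_deriv_eq[OF g(2)])
  then have "grad f x = g x" by (simp add: grad_def vec_eq_iff)
  then show "(f has_derivative (\<lambda>h. grad f x \<bullet> h)) (at x)" using g(2) by simp
  have "partial_deriv i f = (\<lambda>x. g x $ i)" by (rule ext) (rule p)
  then show "partial_deriv i f \<in> trig" using g(1) by simp
qed

lemma trig_continuous: "f \<in> trig \<Longrightarrow> continuous_on UNIV f"
  by (intro continuous_at_imp_continuous_on ballI has_derivative_continuous[OF trig_has_derivative_grad])

lemma trig_ess_bdd: "f \<in> trig \<Longrightarrow> ess_bdd f"
  by (intro ess_bdd_continuous trig_continuous)

lemma trig_test_function:
  assumes "f \<in> trig" shows "test_function f"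
proof -
  have "foldr partial_deriv is f \<in> trig" for "is"
    by (induction "is") (auto intro: assms partial_deriv_trig)
  then show ?thesis
    using assms trig_has_derivative_grad unfolding test_function_def Ck_def
    by (blast intro: trig_periodic trig_continuous differentiableI)
qed

lemma trig_C1_periodic:
  assumes "f \<in> trig" shows "C1_periodic f (grad f)"
proof -
  have "(\<lambda>x. grad f x $ i) \<in> trig" for i
    using partial_deriv_trig[OF assms, of i] by (simp add: grad_def)
  then have g: "periodic (\<lambda>x. grad f x $ i)" "continuous_on UNIV (\<lambda>x. grad f x $ i)" for i
    by (auto intro: trig_periodic trig_continuous)
  have "periodic (grad f)"
    using g(1) unfolding periodic_def vec_eq_iff by metis
  moreover have "continuous_on UNIV (\<lambda>x. \<chi> i. grad f x $ i)"
    by (intro continuous_on_vec_lambda g)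
  ultimately show ?thesis
    using trig_periodic[OF assms] trig_has_derivative_grad[OF assms] by (simp add: C1_periodic_def)
qed

text \<open>
  Finite sums of products \<open>f(x) g(y)\<close>. For such kernels, differentiation under the integral and
  Fubini's theorem are finite linear algebra, whatever function the kernel is integrated against.
\<close>

inductive separable :: "(real^'n \<Rightarrow> real^'n \<Rightarrow> real) \<Rightarrow> bool" where
  tensor: "f \<in> trig \<Longrightarrow> g \<in> trig \<Longrightarrow> separable (\<lambda>x y. f x * g y)"
| add: "separable \<Phi> \<Longrightarrow> separable \<Psi> \<Longrightarrow> separable (\<lambda>x y. \<Phi> x y + \<Psi> x y)"

lemma separable_mult_tensor:
  assumes "separable \<Phi>" "f \<in> trig" "g \<in> trig"
  shows "separable (\<lambda>x y. \<Phi> x y * (f x * g y))"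
  using assms(1)
proof induction
  case (tensor f' g')
  then show ?case
    using separable.tensor[OF trig.mult[OF tensor(1) assms(2)] trig.mult[OF tensor(2) assms(3)]]
    by (simp add: mult_ac)
next
  case (add \<Phi> \<Psi>)
  then show ?case using separable.add by (simp add: distrib_right)
qed

lemma separable_mult:
  assumes "separable \<Phi>" "separable \<Psi>"
  shows "separable (\<lambda>x y. \<Phi> x y * \<Psi> x y)"
  using assms(2)
proof induction
  case (tensor f g)
  then show ?case by (intro separable_mult_tensor assms)
next
  case (add \<Psi> \<Psi>')
  then show ?case using separable.add by (simp add: distrib_left)
qed

text \<open>
  The addition theorems for sine and cosine.
\<close>

lemma separable_translate:
  assumes "f \<in> trig" shows "separable (\<lambda>x y. f (x - y))"
  using assms
proof induction
  case (const c)
  show ?case using separable.tensor[OF trig.const trig.const, of c 1] by simp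
next
  case (cos i)
  show ?case
    using separable.add[OF separable.tensor[OF trig.cos[of i] trig.cos[of i]]
        separable.tensor[OF trig.sin[of i] trig.sin[of i]]]
    by (simp add: right_diff_distrib cos_diff)
next
  case (sin i)
  show ?case
    using separable.add[OF separable.tensor[OF trig.sin[of i] trig.cos[of i]]
        separable.tensor[OF trig_uminus[OF trig.cos[of i]] trig.sin[of i]]]
    by (simp add: right_diff_distrib sin_diff)
qed (auto intro: separable.add separable_mult)

lemma separable_trig:
  assumes "separable \<Phi>"
  shows "(\<lambda>x. \<Phi> x y) \<in> trig" "\<Phi> x \<in> trig"
  using assms
  by (induction) (auto intro: trig.add trig_cmult trig.mult trig.const)

lemma separable_integral:
  assumes "separable \<Phi>" "ess_bdd f"
  shows "(\<lambda>x. \<integral>y. \<Phi> x y * f y) \<in> trig"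
    and "(\<integral>x. \<integral>y. \<Phi> x y * f y) = (\<integral>y. (\<integral>x. \<Phi> x y) * f y)"
    and "ess_bdd (\<lambda>y. partial_deriv i (\<lambda>x. \<Phi> x y) x * f y)"
    and "partial_deriv i (\<lambda>x. \<integral>y. \<Phi> x y * f y) x = (\<integral>y. partial_deriv i (\<lambda>x. \<Phi> x y) x * f y)"
  using assms(1)
proof (induction)
  case (tensor g h)
  have e: "(\<integral>y. g x * h y * f y) = (\<integral>y. h y * f y) * g x" for x
    by (simp add: mult.assoc mult.commute[of _ "g x"])
  have pd: "partial_deriv i (\<lambda>x. g x * c) x = partial_deriv i g x * c" for c x
    using has_derivative_mult_left[OF trig_has_derivative_grad[OF tensor(1)], of c]
      partial_deriv_eq[of "\<lambda>x. g x * c" "c *\<^sub>R grad g x" x i]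
    by (simp add: grad_def mult.commute)
  have pd': "partial_deriv i (\<lambda>x. c * g x) x = c * partial_deriv i g x" for c x
    using pd[of c x] by (simp only: mult.commute)
  { case 1 show ?case unfolding e by (intro trig_cmult tensor) }
  { case 2 show ?case unfolding e by (simp add: mult.assoc) }
  { case 3 show ?case unfolding pd
      by (rule ess_bdd_mult[OF trig_ess_bdd[OF trig_cmult[OF tensor(2)]] assms(2)]) }
  { case 4
    have "(\<integral>y. partial_deriv i g x * h y * f y) = (\<integral>y. h y * f y) * partial_deriv i g x"
      by (simp add: mult.assoc mult.commute[of _ "partial_deriv i g x"])
    then show ?case unfolding e pd pd' by simp }
next
  case (add \<Phi> \<Psi>)
  have bdd: "ess_bdd (\<lambda>y. \<Phi> x y * f y)" "ess_bdd (\<lambda>y. \<Psi> x y * f y)" for x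
    by (intro ess_bdd_mult assms trig_ess_bdd separable_trig(2) add.hyps)+
  have e: "(\<integral>y. (\<Phi> x y + \<Psi> x y) * f y) = (\<integral>y. \<Phi> x y * f y) + (\<integral>y. \<Psi> x y * f y)" for x
    by (simp add: distrib_right ess_bdd_integrable bdd)
  have pd: "partial_deriv i (\<lambda>x. g x + h x) x = partial_deriv i g x + partial_deriv i h x"
    if "g \<in> trig" "h \<in> trig" for g h x
    using has_derivative_add[OF trig_has_derivative_grad[OF that(1)] trig_has_derivative_grad[OF that(2)]]
      partial_deriv_eq[of "\<lambda>x. g x + h x" "grad g x + grad h x" x i]
    by (simp add: grad_def inner_add_left)
  have pd': "partial_deriv i (\<lambda>x. \<Phi> x y + \<Psi> x y) x = partial_deriv i (\<lambda>x. \<Phi> x y) x + partial_deriv i (\<lambda>x. \<Psi> x y) x" for x y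
    by (intro pd separable_trig add.hyps)
  { case 1 show ?case unfolding e by (intro trig.add add.IH) }
  { case 2
    have i1: "integrable torus (\<lambda>x. \<integral>y. \<Phi> x y * f y)" "integrable torus (\<lambda>x. \<integral>y. \<Psi> x y * f y)"
      by (intro ess_bdd_integrable trig_ess_bdd add.IH)+
    have i2: "integrable torus (\<lambda>x. \<Phi> x y)" "integrable torus (\<lambda>x. \<Psi> x y)" for y
      by (intro ess_bdd_integrable trig_ess_bdd separable_trig add.hyps)+
    have t: "(\<lambda>y. \<integral>x. \<Phi> x y) \<in> trig" if "separable \<Phi>" for \<Phi> :: "real^'n \<Rightarrow> real^'n \<Rightarrow> real"
      using that
    proof induction
      case (add \<Phi> \<Psi>)
      have "(\<integral>x. \<Phi> x y + \<Psi> x y) = (\<integral>x. \<Phi> x y) + (\<integral>x. \<Psi> x y)" for y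
        by (intro Bochner_Integration.integral_add ess_bdd_integrable trig_ess_bdd separable_trig add.hyps)
      then show ?case using add.IH by (simp add: trig.add)
    qed (simp add: trig_cmult)
    have i3: "integrable torus (\<lambda>y. (\<integral>x. \<Phi> x y) * f y)" "integrable torus (\<lambda>y. (\<integral>x. \<Psi> x y) * f y)"
      by (intro ess_bdd_integrable ess_bdd_mult trig_ess_bdd t add.hyps assms)+
    show ?case unfolding e using i1 i2 i3 add.IH(2,6) by (simp add: distrib_right) }
  { case 3 show ?case unfolding pd' distrib_right by (intro ess_bdd_add add.IH) }
  { case 4
    show ?case unfolding e pd' pd[OF add.IH(1) add.IH(5)]
      using add.IH(3,4,7,8) by (simp add: distrib_right ess_bdd_integrable) }
qed

section \<open>Convolution with a trigonometric polynomial\<close>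

definition conv :: "(real^'n \<Rightarrow> real) \<Rightarrow> (real^'n \<Rightarrow> real) \<Rightarrow> real^'n \<Rightarrow> real" where
  "conv K f x = (\<integral>y. K (x - y) * f y)"

lemma partial_deriv_shift:
  assumes "K \<in> trig"
  shows "partial_deriv i (\<lambda>x. K (x - y)) x = partial_deriv i K (x - y)"
    and "partial_deriv i (\<lambda>y. K (x - y)) y = - partial_deriv i K (x - y)"
proof -
  have "((\<lambda>x. K (x - y)) has_derivative (\<lambda>h. grad K (x - y) \<bullet> h)) (at x)"
    by (rule has_derivative_compose[OF _ trig_has_derivative_grad[OF assms]])
       (auto intro!: derivative_eq_intros)
  from partial_deriv_eq[OF this] show "partial_deriv i (\<lambda>x. K (x - y)) x = partial_deriv i K (x - y)"
    by (simp add: grad_def)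
  have "((\<lambda>y. x - y) has_derivative (\<lambda>h. - h)) (at y)"
    by (auto intro!: derivative_eq_intros)
  from has_derivative_compose[OF this trig_has_derivative_grad[OF assms]]
  have "((\<lambda>y. K (x - y)) has_derivative (\<lambda>h. (- grad K (x - y)) \<bullet> h)) (at y)"
    by simp
  from partial_deriv_eq[OF this] show "partial_deriv i (\<lambda>y. K (x - y)) y = - partial_deriv i K (x - y)"
    by (simp add: grad_def)
qed

lemma reflect_trig: "K \<in> trig \<Longrightarrow> (\<lambda>y. K (x - y)) \<in> trig"
  by (rule separable_trig(2)[OF separable_translate])

lemma conv_trig: "K \<in> trig \<Longrightarrow> ess_bdd f \<Longrightarrow> conv K f \<in> trig"
  unfolding conv_def[abs_def] by (intro separable_integral(1) separable_translate)

lemma conv_integrand_bounded: "K \<in> trig \<Longrightarrow> ess_bdd f \<Longrightarrow> ess_bdd (\<lambda>y. K (x - y) * f y)"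
  by (rule ess_bdd_mult[OF trig_ess_bdd[OF reflect_trig]])

lemma partial_deriv_conv:
  assumes "K \<in> trig" "ess_bdd f"
  shows "partial_deriv i (conv K f) = conv (partial_deriv i K) f"
  using separable_integral(4)[OF separable_translate[OF assms(1)] assms(2), of i]
  by (simp add: fun_eq_iff conv_def[abs_def] partial_deriv_shift[OF assms(1)])

lemma grad_reflect:
  "K \<in> trig \<Longrightarrow> grad (\<lambda>y. K (x - y)) y = - grad K (x - y)"
  by (simp add: grad_def vec_eq_iff partial_deriv_shift)

lemma laplacian_reflect:
  assumes "K \<in> trig" shows "laplacian (\<lambda>y. K (x - y)) y = laplacian K (x - y)"
proof -
  have "partial_deriv i (\<lambda>y. - L (x - y)) y = partial_deriv i L (x - y)" if L: "L \<in> trig" for L i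
  proof -
    have "((\<lambda>z. - L z) has_derivative (\<lambda>h. (- grad L (x - y)) \<bullet> h)) (at (x - y))"
      using has_derivative_minus[OF trig_has_derivative_grad[OF L]] by simp
    from partial_deriv_eq[OF this, of i] partial_deriv_shift(2)[OF trig_uminus[OF L], of i x y]
    show ?thesis by (simp add: grad_def)
  qed
  moreover have "partial_deriv i (\<lambda>y. K (x - y)) = (\<lambda>y. - partial_deriv i K (x - y))" for i
    by (rule ext) (rule partial_deriv_shift(2)[OF assms])
  ultimately show ?thesis
    by (simp add: laplacian_def partial_deriv_trig assms)
qed

lemma conv_diff:
  "K \<in> trig \<Longrightarrow> ess_bdd f \<Longrightarrow> ess_bdd g \<Longrightarrow> conv K (\<lambda>x. f x - g x) x = conv K f x - conv K g x"
  using conv_integrand_bounded[of K] by (simp add: conv_def right_diff_distrib ess_bdd_integrable)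

section \<open>An approximate identity\<close>

text \<open>
  Takes its maximal value 1 exactly at the integer points; its powers, suitably normalized, concentrate
  there.
\<close>

definition bump :: "real^'n \<Rightarrow> real" where
  "bump x = (\<Prod>i\<in>UNIV. (1 + cos (2 * pi * x $ i)) / 2)"

definition mollifier :: "nat \<Rightarrow> real^'n \<Rightarrow> real" where
  "mollifier N x = bump x ^ N / (\<integral>y. bump (y::real^'n) ^ N)"

lemma bump_trig: "(bump :: real^'n \<Rightarrow> real) \<in> trig"
proof -
  have "(\<lambda>x. 1/2 * (1 + cos (2 * pi * x $ i))) \<in> trig" for i :: 'n
    by (intro trig_cmult trig.intros)
  then show ?thesis
    unfolding bump_def[abs_def] by (intro trig_prod) simp
qed

lemma half_one_plus_cos: "0 \<le> (1 + cos t) / 2 \<and> (1 + cos t) / 2 \<le> 1" for t :: real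
  using cos_ge_minus_one[of t] cos_le_one[of t] by (auto simp del: cos_ge_minus_one cos_le_one)

lemma bump_bounds: "0 \<le> bump x" "bump x \<le> 1" "bump 0 = 1" "bump (- x) = bump x"
proof -
  have *: "0 \<le> (1 + cos (2 * pi * x $ i)) / 2 \<and> (1 + cos (2 * pi * x $ i)) / 2 \<le> 1" for i
    by (rule half_one_plus_cos)
  show "0 \<le> bump x" "bump x \<le> 1" unfolding bump_def using * by (auto intro!: prod_nonneg prod_le_1)
qed (simp_all add: bump_def)

lemma bump_eq_1D:
  assumes "bump x = 1" shows "x $ i \<in> \<int>"
proof -
  let ?f = "\<lambda>i. (1 + cos (2 * pi * x $ i)) / 2"
  have *: "0 \<le> ?f i" "?f i \<le> 1" for i
    using half_one_plus_cos by blast+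
  have "bump x = ?f i * prod ?f (UNIV - {i})"
    unfolding bump_def by (rule prod.remove) auto
  also have "\<dots> \<le> ?f i * 1"
    using * by (intro mult_left_mono prod_le_1) auto
  finally have "cos (2 * pi * x $ i) = 1" using assms cos_le_one[of "2 * pi * x $ i"] by auto
  then obtain n :: int where "2 * pi * x $ i = n * 2 * pi" by (auto simp: cos_one_2pi_int)
  then show ?thesis by simp
qed

text \<open>
  The power is bounded below by \<open>r\<^sup>N\<close> on the set where \<open>bump > r\<close>; the continuous function
  \<open>max 0 (bump - r)\<close>, which is at most 1 and has positive integral, stands in for the indicator of this
  set.
\<close>

lemma bump_power_integral_ge:
  assumes "0 < r" "r < 1"
  shows "\<exists>c>0. \<forall>N. r ^ N * c \<le> (\<integral>y. bump (y::real^'n) ^ N)"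
proof -
  let ?g = "\<lambda>y::real^'n. max 0 (bump y - r)"
  have cont: "continuous_on UNIV ?g"
    by (intro continuous_intros trig_continuous bump_trig)
  have int: "integrable torus ?g" "integrable torus (\<lambda>y::real^'n. bump y ^ N)" for N
    by (intro ess_bdd_integrable ess_bdd_continuous continuous_intros cont
        trig_continuous bump_trig)+
  have "integral\<^sup>L torus ?g \<noteq> 0"
  proof
    assume "integral\<^sup>L torus ?g = 0"
    then have "integral (cbox 0 1) ?g = 0" by (simp add: integral_torus_continuous[OF cont])
    moreover have "box 0 (1::real^'n) \<noteq> {}" by (simp add: box_ne_empty Basis_vec_def inner_axis)
    ultimately have "\<forall>x\<in>cbox 0 1. ?g x = 0"
      using integral_cbox_eq_0_iff[of 0 1 ?g] continuous_on_subset[OF cont] by auto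
    then have "?g 0 = 0" by (simp add: mem_box_cart)
    then show False using assms by (simp add: bump_bounds)
  qed
  moreover have "integral\<^sup>L torus ?g \<ge> 0" by (simp add: integral_nonneg_AE)
  ultimately have pos: "integral\<^sup>L torus ?g > 0" by linarith
  have "r ^ N * integral\<^sup>L torus ?g \<le> (\<integral>y. bump (y::real^'n) ^ N)" for N
  proof -
    have "r ^ N * ?g y \<le> bump y ^ N" for y :: "real^'n"
    proof (cases "bump y \<le> r")
      case True
      then show ?thesis using bump_bounds(1)[of y] by simp
    next
      case False
      then have "r ^ N * ?g y \<le> r ^ N * 1"
        using bump_bounds(2)[of y] assms by (intro mult_left_mono) auto
      also have "\<dots> \<le> bump y ^ N" using False assms by (simp add: power_mono)
      finally show ?thesis .
    qed
    then have "(\<integral>y. r ^ N * ?g y) \<le> (\<integral>y. bump (y::real^'n) ^ N)"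
      using int by (intro integral_mono integrable_mult_right)
    then show ?thesis by simp
  qed
  with pos show ?thesis by blast
qed

lemma bump_power_integral_pos: "0 < (\<integral>y. bump (y::real^'n) ^ N)"
proof -
  obtain c where "c > 0" "(1/2) ^ N * c \<le> (\<integral>y. bump (y::real^'n) ^ N)"
    using bump_power_integral_ge[of "1/2", where 'n = 'n] by auto
  then show ?thesis by (meson less_le_trans mult_pos_pos zero_less_power half_gt_zero zero_less_one)
qed

lemma mollifier_trig: "(mollifier N :: real^'n \<Rightarrow> real) \<in> trig"
proof -
  have "(\<lambda>x::real^'n. 1 / (\<integral>y. bump (y::real^'n) ^ N) * bump x ^ N) \<in> trig"
    by (intro trig_cmult trig_power bump_trig)
  then show ?thesis by (simp add: mollifier_def[abs_def])
qed

lemma mollifier_nonneg: "0 \<le> mollifier N (x::real^'n)"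
  using bump_bounds(1)[of x] less_imp_le[OF bump_power_integral_pos[of N, where 'n = 'n]]
  by (simp add: mollifier_def)

lemma integral_mollifier: "(\<integral>x. mollifier N (x - (z::real^'n))) = 1" "(\<integral>y. mollifier N (z - y)) = 1"
proof -
  have "integral\<^sup>L torus (mollifier N :: real^'n \<Rightarrow> real) = 1"
    using bump_power_integral_pos[of N, where 'n = 'n] by (simp add: mollifier_def[abs_def])
  then show 1: "(\<integral>x. mollifier N (x - z)) = 1" for z :: "real^'n"
    using integral_torus_shift[OF trig_continuous[OF mollifier_trig] trig_periodic[OF mollifier_trig], of N "- z"]
    by simp
  have "mollifier N (z - y) = mollifier N (y - z)" for y :: "real^'n"
    using bump_bounds(4)[of "z - y"] by (simp add: mollifier_def)
  then show "(\<integral>y. mollifier N (z - y)) = 1" using 1 by simp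
qed

text \<open>
  Off its peak the numerator is at most \<open>r\<^sup>N\<close>, while the normalizing integral is at least a constant
  times \<open>s\<^sup>N\<close> for some \<open>s > r\<close>.
\<close>

lemma mollifier_uniformly_small:
  assumes r: "0 \<le> r" "r < 1" and e: "e > 0"
  shows "\<exists>N0. \<forall>N\<ge>N0. \<forall>x::real^'n. bump x \<le> r \<longrightarrow> mollifier N x \<le> e"
proof -
  \<comment> \<open>Any number strictly between \<open>r\<close> and 1 would do.\<close>
  define s where "s = (r + 1) / 2"
  have s: "0 < s" "s < 1" "r < s" using r by (auto simp: s_def)
  obtain c where c: "c > 0" "\<And>N. s ^ N * c \<le> (\<integral>y. bump (y::real^'n) ^ N)"
    using bump_power_integral_ge[OF s(1,2), where 'n = 'n] by auto
  have "(\<lambda>N. (r / s) ^ N / c) \<longlonglongrightarrow> 0 / c"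
    using r s c by (intro tendsto_divide LIMSEQ_realpow_zero tendsto_const) auto
  then have "eventually (\<lambda>N. (r / s) ^ N / c < e) sequentially"
    using e by (auto dest: order_tendstoD)
  then obtain N0 where N0: "\<And>N. N \<ge> N0 \<Longrightarrow> (r / s) ^ N / c < e"
    by (auto simp: eventually_sequentially)
  have "mollifier N x \<le> e" if "N \<ge> N0" "bump x \<le> r" for N and x :: "real^'n"
  proof -
    have "mollifier N x \<le> r ^ N / (s ^ N * c)"
      unfolding mollifier_def using bump_bounds(1)[of x] that(2) c s
      by (intro frac_le power_mono) auto
    also have "\<dots> = (r / s) ^ N / c" by (simp add: power_divide)
    finally show ?thesis using N0[OF that(1)] by simp
  qed
  then show ?thesis by blast
qed

text \<open>
  The function \<open>g\<close> need not be periodic, so the point has to lie in the interior of the cube: then no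
  other point of the closed cube differs from it by an integer vector, and the mollifier is uniformly
  small on the compact set where \<open>g\<close> is far from its value at the point.
\<close>

lemma conv_mollifier_pointwise:
  fixes g :: "real^'n \<Rightarrow> real"
  assumes g: "continuous_on UNIV g" and B: "\<And>y. \<bar>g y\<bar> \<le> B" and x: "x \<in> box 0 1"
  shows "(\<lambda>N. conv (mollifier N) g x) \<longlonglongrightarrow> g x"
proof (rule LIMSEQ_I)
  fix e :: real assume e: "e > 0"
  have B0: "0 \<le> B" using B[of 0] abs_ge_zero order_trans by blast
  define S where "S = {y \<in> cbox 0 1. e / 2 \<le> \<bar>g y - g x\<bar>}"
  have "closed {y. e / 2 \<le> \<bar>g y - g x\<bar>}"
    by (intro closed_Collect_le continuous_intros g)
  then have S: "compact S"
    unfolding S_def Collect_conj_eq using compact_Int_closed[OF compact_cbox] by simp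
  have cont: "continuous_on S (\<lambda>y. bump (x - y))"
    by (intro continuous_on_compose_UNIV[OF trig_continuous[OF bump_trig]] continuous_intros)
  have lt1: "bump (x - y) < 1" if "y \<in> S" for y
  proof (rule ccontr)
    assume "\<not> bump (x - y) < 1"
    then have "bump (x - y) = 1" using bump_bounds(2)[of "x - y"] by simp
    then have int: "x $ i - y $ i \<in> \<int>" for i using bump_eq_1D[of "x - y" i] by simp
    have "x $ i = y $ i" for i
    proof -
      have "\<bar>x $ i - y $ i\<bar> < 1"
        using x that by (auto simp: S_def mem_box_cart abs_less_iff algebra_simps add_strict_increasing dest!: spec[of _ i])
      then show ?thesis using int[of i] by (metis Ints_nonzero_abs_less1 eq_iff_diff_eq_0)
    qed
    then have "x = y" by (simp add: vec_eq_iff)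
    then show False using that e by (simp add: S_def)
  qed
  obtain r where r: "0 \<le> r" "r < 1" "\<And>y. y \<in> S \<Longrightarrow> bump (x - y) \<le> r"
  proof (cases "S = {}")
    case False
    obtain y where "y \<in> S" "\<forall>z\<in>S. bump (x - z) \<le> bump (x - y)"
      using continuous_attains_sup[OF S False cont] by blast
    then show ?thesis using that[of "bump (x - y)"] lt1 bump_bounds(1) by blast
  qed (use that[of 0] in auto)
  define \<eta> where "\<eta> = e / (8 * (B + 1))"
  have \<eta>: "\<eta> > 0" "2 * B * \<eta> < e / 2" using e B0 by (auto simp: \<eta>_def field_simps intro: add_pos_nonneg)
  obtain N0 where N0: "\<And>N z. N \<ge> N0 \<Longrightarrow> bump z \<le> r \<Longrightarrow> mollifier N (z :: real^'n) \<le> \<eta>"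
    using mollifier_uniformly_small[OF r(1,2) \<eta>(1), where 'n = 'n] by blast
  have "norm (conv (mollifier N) g x - g x) < e" if N: "N \<ge> N0" for N
  proof -
    let ?K = "\<lambda>y. mollifier N (x - y)"
    have K: "continuous_on UNIV ?K" by (intro trig_continuous reflect_trig mollifier_trig)
    note int = ess_bdd_integrable[OF ess_bdd_continuous]
    have "conv (mollifier N) g x - g x = (\<integral>y. ?K y * g y) - (\<integral>y. ?K y * g x)"
      by (simp add: conv_def integral_mollifier)
    also have "\<dots> = (\<integral>y. ?K y * g y - ?K y * g x)"
      by (intro Bochner_Integration.integral_diff[symmetric] int continuous_intros K g)
    also have "\<bar>\<dots>\<bar> \<le> (\<integral>y. \<bar>?K y * g y - ?K y * g x\<bar>)"
      by (rule integral_abs_bound)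
    also have "\<dots> \<le> (\<integral>y. ?K y * (e / 2) + 2 * B * \<eta>)"
    proof (intro integral_mono int continuous_intros K g)
      fix y :: "real^'n" assume "y \<in> space torus"
      then have y: "y \<in> cbox 0 1" by (simp add: space_torus)
      have eq: "\<bar>?K y * g y - ?K y * g x\<bar> = ?K y * \<bar>g y - g x\<bar>"
        using mollifier_nonneg[of N "x - y"] by (simp add: abs_mult flip: right_diff_distrib)
      show "\<bar>?K y * g y - ?K y * g x\<bar> \<le> ?K y * (e / 2) + 2 * B * \<eta>"
      proof (cases "y \<in> S")
        case False
        then have "\<bar>g y - g x\<bar> \<le> e / 2" using y by (auto simp: S_def)
        then have "?K y * \<bar>g y - g x\<bar> \<le> ?K y * (e / 2)" by (intro mult_left_mono mollifier_nonneg)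
        moreover have "0 \<le> 2 * B * \<eta>" using B0 \<eta> by simp
        ultimately show ?thesis unfolding eq by linarith
      next
        case True
        have "?K y * \<bar>g y - g x\<bar> \<le> \<eta> * (2 * B)"
          using N0[OF N r(3)[OF True]] B[of y] B[of x] B0 \<eta> by (intro mult_mono) auto
        moreover have "0 \<le> ?K y * (e / 2)" using mollifier_nonneg[of N "x - y"] e by simp
        ultimately show ?thesis unfolding eq by (simp add: mult.commute)
      qed
    qed
    also have "\<dots> = (\<integral>y. ?K y * (e / 2)) + 2 * B * \<eta>"
      by (subst Bochner_Integration.integral_add)
         (auto intro!: int continuous_intros K simp: torus.prob_space)
    also have "(\<integral>y. ?K y * (e / 2)) = e / 2" by (simp add: integral_mollifier)
    finally show ?thesis using \<eta> by simp
  qed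
  then show "\<exists>N0. \<forall>N\<ge>N0. norm (conv (mollifier N) g x - g x) < e" by blast
qed

lemma integral_conv:
  assumes "ess_bdd f"
  shows "integral\<^sup>L torus (conv (mollifier N) f) = integral\<^sup>L torus f"
  unfolding conv_def[abs_def]
  using separable_integral(2)[OF separable_translate[OF mollifier_trig] assms, of N]
  by (simp add: integral_mollifier)

text \<open>
  Jensen's inequality for the probability density \<open>mollifier N (x - \<cdot>)\<close>.
\<close>

lemma conv_square_le:
  assumes f: "ess_bdd f"
  shows "(conv (mollifier N) f x)^2 \<le> conv (mollifier N) (\<lambda>y. (f y)^2) x"
proof -
  let ?K = "\<lambda>y. mollifier N (x - y)"
  define c where "c = conv (mollifier N) f x"
  have K: "ess_bdd ?K" by (intro trig_ess_bdd reflect_trig mollifier_trig)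
  have int: "integrable torus (\<lambda>y. ?K y * (f y)^2)" "integrable torus (\<lambda>y. ?K y * f y)" "integrable torus ?K"
    by (intro ess_bdd_rules K f)+
  have "0 \<le> (\<integral>y. ?K y * (f y - c)^2)"
    by (intro integral_nonneg_AE) (simp add: mollifier_nonneg)
  also have "\<dots> = (\<integral>y. ?K y * (f y)^2 - 2 * c * (?K y * f y) + c^2 * ?K y)"
    by (simp add: power2_eq_square algebra_simps)
  also have "\<dots> = conv (mollifier N) (\<lambda>y. (f y)^2) x - 2 * c * c + c^2"
    using int by (simp add: conv_def c_def integral_mollifier)
  finally show ?thesis by (simp add: c_def power2_eq_square)
qed

lemma conv_contraction:
  assumes f: "ess_bdd f"
  shows "(\<integral>x. (conv (mollifier N) f x)^2) \<le> (\<integral>x. (f x)^2)"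
proof -
  have "(\<integral>x. (conv (mollifier N) f x)^2) \<le> (\<integral>x. conv (mollifier N) (\<lambda>y. (f y)^2) x)"
    by (intro integral_mono conv_square_le f ess_bdd_integrable ess_bdd_power
        trig_ess_bdd conv_trig mollifier_trig)
  also have "\<dots> = (\<integral>x. (f x)^2)"
    by (intro integral_conv ess_bdd_power f)
  finally show ?thesis .
qed

lemma AE_torus_not_negligible:
  assumes "negligible N" shows "AE x in torus. x \<notin> N"
proof -
  have "AE x in lebesgue. x \<notin> N"
    using assms by (intro AE_not_in) (simp add: negligible_iff_null_sets)
  then show ?thesis unfolding torus_def by (subst AE_restrict_space_iff) auto
qed

text \<open>
  Measurable functions are almost everywhere limits of continuous ones, and these can be truncated at
  the bound of \<open>f\<close>.
\<close>

lemma L2_dense_continuous: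
  fixes f :: "real^'n \<Rightarrow> real"
  assumes f: "ess_bdd f" and e: "e > 0"
  shows "\<exists>g B. continuous_on UNIV g \<and> (\<forall>x. \<bar>g x\<bar> \<le> B) \<and> (\<integral>x. (f x - g x)^2) < e"
proof -
  obtain B where B: "B \<ge> 0" "AE x in torus. \<bar>f x\<bar> \<le> B" and m: "f \<in> borel_measurable torus"
    using ess_bddE[OF f] .
  have "f measurable_on (cbox 0 1)"
    using m unfolding torus_def by (subst measurable_on_iff_borel_measurable) auto
  then obtain N g where N: "negligible N" and g: "\<And>n. continuous_on UNIV (g n)"
    and lim: "\<And>x. x \<notin> N \<Longrightarrow> (\<lambda>n. g n x) \<longlonglongrightarrow> (if x \<in> cbox 0 1 then f x else 0)"
    unfolding measurable_on_def by blast
  define h where "h n x = max (- B) (min B (g n x))" for n :: nat and x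
  have h: "continuous_on UNIV (h n)" "\<bar>h n x\<bar> \<le> B" for n x
    unfolding h_def using B(1) by (auto intro!: continuous_intros g)
  have "(\<lambda>n. \<integral>x. (f x - h n x)^2) \<longlonglongrightarrow> (\<integral>x. 0 \<partial>(torus :: (real^'n) measure))"
  proof (rule integral_dominated_convergence[where w = "\<lambda>x. (2 * B)^2"])
    show "(\<lambda>x. (f x - h n x)^2) \<in> borel_measurable torus" for n
      using m borel_measurable_torus_continuous[OF h(1)[of n]] by measurable
    show "AE x in torus. (\<lambda>n. (f x - h n x)^2) \<longlonglongrightarrow> 0"
      using B(2) AE_torus_not_negligible[OF N] AE_space
    proof eventually_elim
      case (elim x)
      then have "(\<lambda>n. g n x) \<longlonglongrightarrow> f x" using lim[of x] by (simp add: space_torus)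
      then have "(\<lambda>n. (f x - h n x)^2) \<longlonglongrightarrow> (f x - max (- B) (min B (f x)))^2"
        unfolding h_def by (intro tendsto_intros)
      moreover have "max (- B) (min B (f x)) = f x" using elim(1) by auto
      ultimately show ?case by simp
    qed
    show "AE x in torus. norm ((f x - h n x)^2) \<le> (2 * B)^2" for n
      using B(2)
    proof eventually_elim
      case (elim x)
      have "\<bar>f x - h n x\<bar> \<le> \<bar>2 * B\<bar>" using elim h(2)[of n x] B(1) by linarith
      then have "(f x - h n x)^2 \<le> (2 * B)^2" by (simp only: abs_le_square_iff)
      then show ?case by simp
    qed
  qed auto
  then have "eventually (\<lambda>n. (\<integral>x. (f x - h n x)^2) < e) sequentially"
    using e by (auto dest: order_tendstoD)
  then obtain n where "(\<integral>x. (f x - h n x)^2) < e"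
    by (auto simp: eventually_sequentially)
  then show ?thesis using h by blast
qed

lemma square_sum3_le: "(a + b + c)^2 \<le> 3 * (a^2 + b^2 + c^2)" for a b c :: real
proof -
  have "0 \<le> (a - b)^2 + (b - c)^2 + (a - c)^2" by simp
  then show ?thesis by (simp add: power2_eq_square algebra_simps)
qed

text \<open>
  Approximate \<open>f\<close> in mean square by a bounded continuous \<open>g\<close>; the convolutions of \<open>f - g\<close> are no larger
  than \<open>f - g\<close>, and those of \<open>g\<close> converge pointwise in the interior of the cube.
\<close>

lemma conv_L2_tendsto:
  fixes f :: "real^'n \<Rightarrow> real"
  assumes f: "ess_bdd f"
  shows "(\<lambda>N. \<integral>x. (conv (mollifier N) f x - f x)^2) \<longlonglongrightarrow> 0"
proof (rule LIMSEQ_I)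
  fix e :: real assume e: "e > 0"
  obtain g B where g: "continuous_on UNIV g" and B: "\<And>x. \<bar>g x\<bar> \<le> B"
    and fg: "(\<integral>x. (f x - g x)^2) < e / 9"
    using L2_dense_continuous[OF f, of "e / 9"] e by auto
  have B0: "0 \<le> B" using B[of 0] abs_ge_zero order_trans by blast
  have g_bdd: "ess_bdd g" by (rule ess_bdd_continuous[OF g])
  have "(\<lambda>N. \<integral>x. (conv (mollifier N) g x - g x)^2) \<longlonglongrightarrow> (\<integral>x. 0 \<partial>(torus :: (real^'n) measure))"
  proof (rule integral_dominated_convergence[where w = "\<lambda>x. (2 * B)^2"])
    show "(\<lambda>x. (conv (mollifier N) g x - g x)^2) \<in> borel_measurable torus" for N
      by (intro ess_bdd_measurable ess_bdd_intros trig_ess_bdd conv_trig mollifier_trig g_bdd)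
    have "negligible (cbox 0 1 - box 0 (1::real^'n))"
      using negligible_frontier_interval[of 0 "1::real^'n"] by simp
    from AE_torus_not_negligible[OF this] AE_space
    show "AE x in torus. (\<lambda>N. (conv (mollifier N) g x - g x)^2) \<longlonglongrightarrow> 0"
    proof eventually_elim
      case (elim x)
      then have "(\<lambda>N. conv (mollifier N) g x) \<longlonglongrightarrow> g x"
        by (intro conv_mollifier_pointwise[OF g B]) (simp add: space_torus)
      then have "(\<lambda>N. (conv (mollifier N) g x - g x)^2) \<longlonglongrightarrow> (g x - g x)^2"
        by (intro tendsto_intros)
      then show ?case by simp
    qed
    show "AE x in torus. norm ((conv (mollifier N) g x - g x)^2) \<le> (2 * B)^2" for N
    proof (rule AE_I2)
      fix x :: "real^'n"
      have "\<bar>conv (mollifier N) g x\<bar> \<le> (\<integral>y. \<bar>mollifier N (x - y) * g y\<bar>)"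
        unfolding conv_def by (rule integral_abs_bound)
      also have "\<dots> \<le> (\<integral>y. mollifier N (x - y) * B)"
        using B mollifier_nonneg[where 'n = 'n]
        by (intro integral_mono ess_bdd_rules conv_integrand_bounded
            mollifier_trig g_bdd) (auto simp: abs_mult intro!: mult_mono)
      also have "\<dots> = B" by (simp add: integral_mollifier)
      finally have "\<bar>conv (mollifier N) g x - g x\<bar> \<le> \<bar>2 * B\<bar>" using B[of x] B0 by linarith
      then have "(conv (mollifier N) g x - g x)^2 \<le> (2 * B)^2" by (simp only: abs_le_square_iff)
      then show "norm ((conv (mollifier N) g x - g x)^2) \<le> (2 * B)^2" by simp
    qed
  qed auto
  then have "eventually (\<lambda>N. (\<integral>x. (conv (mollifier N) g x - g x)^2) < e / 9) sequentially"
    using e by (intro order_tendstoD(2)[where y = 0]) auto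
  then obtain N0 where N0: "\<And>N. N \<ge> N0 \<Longrightarrow> (\<integral>x. (conv (mollifier N) g x - g x)^2) < e / 9"
    by (auto simp: eventually_sequentially)
  have "norm ((\<integral>x. (conv (mollifier N) f x - f x)^2) - 0) < e" if N: "N \<ge> N0" for N
  proof -
    let ?C = "conv (mollifier N)"
    note bdd = ess_bdd_intros trig_ess_bdd conv_trig mollifier_trig f g_bdd
    have fg_bdd: "ess_bdd (\<lambda>x. f x - g x)" by (intro bdd)
    have "(\<integral>x. (?C f x - f x)^2)
        \<le> (\<integral>x. 3 * ((?C (\<lambda>x. f x - g x) x)^2 + (?C g x - g x)^2 + (f x - g x)^2))"
    proof (rule integral_mono)
      fix x :: "real^'n"
      have "?C f x - f x = ?C (\<lambda>x. f x - g x) x + (?C g x - g x) + (g x - f x)"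
        by (simp add: conv_diff mollifier_trig f g_bdd)
      then show "(?C f x - f x)^2 \<le> 3 * ((?C (\<lambda>x. f x - g x) x)^2 + (?C g x - g x)^2 + (f x - g x)^2)"
        unfolding power2_commute[of "f x" "g x"] by (metis square_sum3_le)
    qed (intro ess_bdd_integrable ess_bdd_const ess_bdd_add ess_bdd_mult ess_bdd_diff
        ess_bdd_power trig_ess_bdd[OF conv_trig] mollifier_trig f g_bdd)+
    also have "\<dots> = 3 * ((\<integral>x. (?C (\<lambda>x. f x - g x) x)^2) + (\<integral>x. (?C g x - g x)^2)
        + (\<integral>x. (f x - g x)^2))"
    proof -
      have "integrable torus (\<lambda>x. (?C (\<lambda>x. f x - g x) x)^2)" "integrable torus (\<lambda>x. (?C g x - g x)^2)"
        "integrable torus (\<lambda>x. (f x - g x)^2)"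
        by (intro ess_bdd_integrable ess_bdd_diff
        ess_bdd_power trig_ess_bdd[OF conv_trig] mollifier_trig f g_bdd)+
      then show ?thesis by simp
    qed
    also have "\<dots> < 3 * (e / 9 + e / 9 + e / 9)"
      using conv_contraction[OF fg_bdd, of N] N0[OF N] fg by simp
    finally show ?thesis by simp
  qed
  then show "\<exists>N0. \<forall>N\<ge>N0. norm ((\<integral>x. (conv (mollifier N) f x - f x)^2) - 0) < e" by blast
qed

section \<open>Convergence in mean square\<close>

definition L2_tendsto :: "(nat \<Rightarrow> real^'n \<Rightarrow> real) \<Rightarrow> (real^'n \<Rightarrow> real) \<Rightarrow> bool" where
  "L2_tendsto a f \<longleftrightarrow> (\<forall>N. ess_bdd (a N)) \<and> ess_bdd f \<and>
     (\<lambda>N. \<integral>x. (a N x - f x)^2) \<longlonglongrightarrow> 0"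

lemma L2_tendsto_conv: "ess_bdd f \<Longrightarrow> L2_tendsto (\<lambda>N. conv (mollifier N) f) f"
  by (simp add: L2_tendsto_def trig_ess_bdd[OF conv_trig] mollifier_trig conv_L2_tendsto)

lemma L2_tendsto_dominated:
  assumes a: "L2_tendsto a f" and b: "L2_tendsto b g"
    and c: "\<And>N. ess_bdd (c N)" "ess_bdd h"
    and le: "\<And>N. AE x in torus. (c N x - h x)^2 \<le> B * ((a N x - f x)^2 + (b N x - g x)^2)"
  shows "L2_tendsto c h"
proof -
  have bdd: "ess_bdd (a N)" "ess_bdd (b N)" "ess_bdd f" "ess_bdd g" for N
    using a b by (auto simp: L2_tendsto_def)
  have int: "integrable torus (\<lambda>x. (a N x - f x)^2)" "integrable torus (\<lambda>x. (b N x - g x)^2)" for N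
    by (intro ess_bdd_rules bdd)+
  have "(\<integral>x. (c N x - h x)^2) \<le> (\<integral>x. B * ((a N x - f x)^2 + (b N x - g x)^2))" for N
    by (intro integral_mono_AE le ess_bdd_rules bdd c)
  then have le': "(\<integral>x. (c N x - h x)^2) \<le> B * ((\<integral>x. (a N x - f x)^2) + (\<integral>x. (b N x - g x)^2))" for N
    using int by simp
  have "(\<lambda>N. B * ((\<integral>x. (a N x - f x)^2) + (\<integral>x. (b N x - g x)^2))) \<longlonglongrightarrow> B * (0 + 0)"
    using a b unfolding L2_tendsto_def by (intro tendsto_intros) auto
  then have lim: "(\<lambda>N. B * ((\<integral>x. (a N x - f x)^2) + (\<integral>x. (b N x - g x)^2))) \<longlonglongrightarrow> 0"
    by simp
  have "(\<lambda>N. \<integral>x. (c N x - h x)^2) \<longlonglongrightarrow> 0"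
    by (rule real_tendsto_sandwich[OF _ _ tendsto_const lim]) (simp_all add: le')
  then show ?thesis using c by (simp add: L2_tendsto_def)
qed

lemma L2_tendsto_diff:
  assumes a: "L2_tendsto a f" and b: "L2_tendsto b g"
  shows "L2_tendsto (\<lambda>N x. a N x - b N x) (\<lambda>x. f x - g x)"
proof (rule L2_tendsto_dominated[OF a b])
  show "AE x in torus. (a N x - b N x - (f x - g x))^2 \<le> 2 * ((a N x - f x)^2 + (b N x - g x)^2)" for N
  proof (rule AE_I2)
    show "(a N x - b N x - (f x - g x))^2 \<le> 2 * ((a N x - f x)^2 + (b N x - g x)^2)" for x
      using zero_le_power2[of "(a N x - f x) + (b N x - g x)"]
      by (simp add: power2_eq_square algebra_simps)
  qed
qed (use a b in \<open>auto simp: L2_tendsto_def intro: ess_bdd_diff\<close>)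

lemma L2_tendsto_mult:
  assumes a: "L2_tendsto a f" and g: "ess_bdd g"
  shows "L2_tendsto (\<lambda>N x. a N x * g x) (\<lambda>x. f x * g x)"
proof -
  obtain B where B: "B \<ge> 0" "AE x in torus. \<bar>g x\<bar> \<le> B" using ess_bddE[OF g] .
  show ?thesis
  proof (rule L2_tendsto_dominated[OF a a])
    show "AE x in torus. (a N x * g x - f x * g x)^2 \<le> B^2 * ((a N x - f x)^2 + (a N x - f x)^2)" for N
      using B(2)
    proof eventually_elim
      case (elim x)
      then have "(g x)^2 \<le> B^2" using B(1) by (simp flip: abs_le_square_iff)
      then have "(g x)^2 * (a N x - f x)^2 \<le> B^2 * ((a N x - f x)^2 + (a N x - f x)^2)"
        by (intro mult_mono) auto
      moreover have "(a N x * g x - f x * g x)^2 = (g x)^2 * (a N x - f x)^2"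
        by (simp add: power2_eq_square algebra_simps)
      ultimately show ?case by simp
    qed
  qed (use a g in \<open>auto simp: L2_tendsto_def intro: ess_bdd_mult\<close>)
qed

lemma L2_tendsto_nonexpansive:
  assumes a: "L2_tendsto a f" and \<phi>: "\<And>s t. \<bar>\<phi> s - \<phi> t\<bar> \<le> \<bar>s - t\<bar>" "continuous_on UNIV \<phi>"
  shows "L2_tendsto (\<lambda>N x. \<phi> (a N x)) (\<lambda>x. \<phi> (f x))"
proof (rule L2_tendsto_dominated[OF a a])
  show "AE x in torus. (\<phi> (a N x) - \<phi> (f x))^2 \<le> 1 * ((a N x - f x)^2 + (a N x - f x)^2)" for N
  proof (rule AE_I2)
    fix x
    have "(\<phi> (a N x) - \<phi> (f x))^2 \<le> (a N x - f x)^2"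
      using \<phi>(1) by (simp flip: abs_le_square_iff)
    also have "\<dots> \<le> 1 * ((a N x - f x)^2 + (a N x - f x)^2)" by simp
    finally show "(\<phi> (a N x) - \<phi> (f x))^2 \<le> 1 * ((a N x - f x)^2 + (a N x - f x)^2)" .
  qed
qed (use a ess_bdd_continuous_comp[OF _ \<phi>(2)] in \<open>auto simp: L2_tendsto_def\<close>)

lemma L2_tendsto_integral_mult:
  assumes a: "L2_tendsto a f" and g: "ess_bdd g"
  shows "(\<lambda>N. \<integral>x. a N x * g x) \<longlonglongrightarrow> (\<integral>x. f x * g x)"
proof -
  have bdd: "ess_bdd (a N)" "ess_bdd f" for N
    using a by (auto simp: L2_tendsto_def)
  have "(\<lambda>N. (\<integral>x. (a N x - f x)^2) * (\<integral>x. (g x)^2)) \<longlonglongrightarrow> 0 * (\<integral>x. (g x)^2)"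
    using a unfolding L2_tendsto_def by (intro tendsto_intros) auto
  then have 1: "(\<lambda>N. (\<integral>x. (a N x - f x)^2) * (\<integral>x. (g x)^2)) \<longlonglongrightarrow> 0" by simp
  have "(\<lambda>N. (\<integral>x. (a N x - f x) * g x)^2) \<longlonglongrightarrow> 0"
    by (rule real_tendsto_sandwich[OF _ _ tendsto_const 1])
       (auto intro!: always_eventually Cauchy_Schwarz_torus ess_bdd_intros bdd g)
  then have "(\<lambda>N. sqrt ((\<integral>x. (a N x - f x) * g x)^2)) \<longlonglongrightarrow> sqrt 0"
    by (rule tendsto_real_sqrt)
  then have 2: "(\<lambda>N. \<integral>x. (a N x - f x) * g x) \<longlonglongrightarrow> 0"
    by (simp add: tendsto_rabs_zero_iff)
  have "(\<integral>x. a N x * g x) = (\<integral>x. (a N x - f x) * g x) + (\<integral>x. f x * g x)" for N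
    by (subst Bochner_Integration.integral_add[symmetric])
       (auto intro!: ess_bdd_rules bdd g simp: algebra_simps)
  then show ?thesis using tendsto_add[OF 2 tendsto_const[of "\<integral>x. f x * g x"]] by simp
qed

lemma L2_tendsto_integral_square:
  assumes a: "L2_tendsto a f"
  shows "(\<lambda>N. \<integral>x. (a N x)^2) \<longlonglongrightarrow> (\<integral>x. (f x)^2)"
proof -
  have bdd: "ess_bdd (a N)" "ess_bdd f" for N
    using a by (auto simp: L2_tendsto_def)
  have int: "integrable torus (\<lambda>x. (a N x - f x)^2)" "integrable torus (\<lambda>x. a N x * f x)" "integrable torus (\<lambda>x. (f x)^2)" for N
    by (intro ess_bdd_rules bdd)+
  have "(\<integral>x. (a N x)^2) = (\<integral>x. (a N x - f x)^2 + 2 * (a N x * f x) - (f x)^2)" for N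
    by (simp add: power2_eq_square algebra_simps)
  also have "\<dots> N = (\<integral>x. (a N x - f x)^2) + 2 * (\<integral>x. a N x * f x) - (\<integral>x. (f x)^2)" for N
    using int by simp
  finally have "(\<lambda>N. \<integral>x. (a N x)^2)
      = (\<lambda>N. (\<integral>x. (a N x - f x)^2) + 2 * (\<integral>x. a N x * f x) - (\<integral>x. (f x)^2))" by blast
  moreover have "(\<lambda>N. (\<integral>x. (a N x - f x)^2) + 2 * (\<integral>x. a N x * f x) - (\<integral>x. (f x)^2))
      \<longlonglongrightarrow> 0 + 2 * (\<integral>x. f x * f x) - (\<integral>x. (f x)^2)"
    using a L2_tendsto_integral_mult[OF a bdd(2)] unfolding L2_tendsto_def by (intro tendsto_intros) auto
  ultimately show ?thesis by (simp add: power2_eq_square)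
qed

section \<open>Very weak solutions of the drift-diffusion equation\<close>

text \<open>
  The distributional form of \<open>- \<kappa> \<Delta>\<mu> = div G\<close> for a merely bounded \<open>\<mu>\<close>, tested with trigonometric
  polynomials.
\<close>

definition weak_drift :: "real \<Rightarrow> (real^'n \<Rightarrow> real) \<Rightarrow> (real^'n \<Rightarrow> real^'n) \<Rightarrow> bool" where
  "weak_drift \<kappa> \<mu> G \<longleftrightarrow> ess_bdd \<mu> \<and> (\<forall>i. ess_bdd (\<lambda>x. G x $ i)) \<and>
     (\<forall>\<phi>\<in>trig. (\<integral>x. - \<kappa> * \<mu> x * laplacian \<phi> x + G x \<bullet> grad \<phi> x) = 0)"

lemma C1_periodic_mult:
  assumes f: "C1_periodic f p" and g: "C1_periodic g q"
  shows "C1_periodic (\<lambda>x. f x * g x) (\<lambda>x. f x *\<^sub>R q x + g x *\<^sub>R p x)"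
proof -
  have "((\<lambda>x. f x * g x) has_derivative (\<lambda>h. (f x *\<^sub>R q x + g x *\<^sub>R p x) \<bullet> h)) (at x)" for x
  proof -
    have "(f has_derivative (\<lambda>h. p x \<bullet> h)) (at x)" "(g has_derivative (\<lambda>h. q x \<bullet> h)) (at x)"
      using f g by (simp_all add: C1_periodic_def)
    from has_derivative_mult[OF this] show ?thesis
      by (simp add: inner_add_left mult.commute)
  qed
  moreover have "continuous_on UNIV (\<lambda>x. f x *\<^sub>R q x + g x *\<^sub>R p x)"
    using f g C1_periodic_continuous[OF f] C1_periodic_continuous[OF g]
    by (auto simp: C1_periodic_def intro!: continuous_intros)
  ultimately show ?thesis using f g by (simp add: C1_periodic_def periodic_def)
qed

text \<open>
  A divergence-free field is orthogonal to gradients: integrate the divergence of \<open>\<phi> F\<close>.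
\<close>

lemma integrate_divergence_free:
  assumes F: "\<And>i. F i \<in> trig" and div: "\<And>x. (\<Sum>i\<in>UNIV. partial_deriv i (F i) x) = 0"
    and \<phi>: "C1_periodic \<phi> q"
  shows "(\<integral>x. (\<Sum>i\<in>UNIV. F i x * q x $ i)) = 0"
proof -
  have q: "ess_bdd (\<lambda>x. q x $ i)" for i
    using \<phi> by (intro ess_bdd_continuous continuous_intros) (simp add: C1_periodic_def)
  have \<phi>b: "ess_bdd \<phi>" by (intro ess_bdd_continuous C1_periodic_continuous[OF \<phi>])
  have bdd: "ess_bdd (\<lambda>x. \<phi> x * partial_deriv i (F i) x)" "ess_bdd (\<lambda>x. F i x * q x $ i)" for i
    by (intro ess_bdd_mult \<phi>b q trig_ess_bdd partial_deriv_trig F)+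
  have int: "integrable torus (\<lambda>x. \<phi> x * partial_deriv i (F i) x)" "integrable torus (\<lambda>x. F i x * q x $ i)" for i
    by (intro ess_bdd_integrable bdd)+
  have "(\<integral>x. \<phi> x * partial_deriv i (F i) x) + (\<integral>x. F i x * q x $ i) = 0" for i
  proof -
    have "(\<integral>x. (\<phi> x *\<^sub>R grad (F i) x + F i x *\<^sub>R q x) \<bullet> axis i 1) = 0"
      by (rule integral_directional_derivative[OF C1_periodic_mult[OF \<phi> trig_C1_periodic[OF F]]])
    then show ?thesis using int[of i] by (simp add: inner_add_left inner_axis grad_def)
  qed
  then have "0 = (\<Sum>i\<in>UNIV. (\<integral>x. \<phi> x * partial_deriv i (F i) x) + (\<integral>x. F i x * q x $ i))"
    by simp
  also have "\<dots> = (\<integral>x. \<phi> x * (\<Sum>i\<in>UNIV. partial_deriv i (F i) x)) + (\<integral>x. (\<Sum>i\<in>UNIV. F i x * q x $ i))"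
    using int by (simp add: sum.distrib sum_distrib_left)
  finally show ?thesis using div by simp
qed

definition conv_vec :: "(real^'n \<Rightarrow> real) \<Rightarrow> (real^'n \<Rightarrow> real^'n) \<Rightarrow> real^'n \<Rightarrow> real^'n" where
  "conv_vec K G x = (\<chi> i. conv K (\<lambda>y. G y $ i) x)"

text \<open>
  Inserting the test function \<open>y \<mapsto> K (x - y)\<close> shows that the convolved equation holds in the classical
  sense at every point \<open>x\<close>.
\<close>

lemma conv_weak_drift:
  assumes K: "K \<in> trig" and weak: "weak_drift \<kappa> \<mu> G"
  shows "\<kappa> * laplacian (conv K \<mu>) x + (\<Sum>i\<in>UNIV. partial_deriv i (conv K (\<lambda>y. G y $ i)) x) = 0"
proof -
  have \<mu>: "ess_bdd \<mu>" and G: "\<And>i. ess_bdd (\<lambda>x. G x $ i)"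
    and eq: "\<And>\<phi>. \<phi> \<in> trig \<Longrightarrow> (\<integral>x. - \<kappa> * \<mu> x * laplacian \<phi> x + G x \<bullet> grad \<phi> x) = 0"
    using weak by (auto simp: weak_drift_def)
  have dK: "partial_deriv i K \<in> trig" "partial_deriv i (partial_deriv i K) \<in> trig" for i
    by (intro partial_deriv_trig K)+
  let ?\<Delta> = "\<lambda>i y. partial_deriv i (partial_deriv i K) (x - y) * \<mu> y"
  let ?D = "\<lambda>i y. partial_deriv i K (x - y) * G y $ i"
  have int: "integrable torus (?\<Delta> i)" "integrable torus (?D i)" for i
    by (intro ess_bdd_integrable conv_integrand_bounded dK \<mu> G)+
  have "(\<integral>y. - \<kappa> * \<mu> y * laplacian K (x - y) - G y \<bullet> grad K (x - y)) = 0"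
    using eq[OF reflect_trig[OF K, of x]]
    by (simp add: laplacian_reflect grad_reflect K)
  also have "(\<lambda>y. - \<kappa> * \<mu> y * laplacian K (x - y) - G y \<bullet> grad K (x - y))
      = (\<lambda>y. - (\<kappa> * (\<Sum>i\<in>UNIV. ?\<Delta> i y) + (\<Sum>i\<in>UNIV. ?D i y)))"
    by (rule ext) (simp add: laplacian_def inner_vec_def grad_def sum_distrib_left mult_ac sum_negf)
  also have "(\<integral>y. - (\<kappa> * (\<Sum>i\<in>UNIV. ?\<Delta> i y) + (\<Sum>i\<in>UNIV. ?D i y)))
      = - (\<kappa> * (\<Sum>i\<in>UNIV. \<integral>y. ?\<Delta> i y) + (\<Sum>i\<in>UNIV. \<integral>y. ?D i y))"
    using int by simp
  finally have "\<kappa> * (\<Sum>i\<in>UNIV. \<integral>y. ?\<Delta> i y) + (\<Sum>i\<in>UNIV. \<integral>y. ?D i y) = 0" by simp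
  then show ?thesis
    by (simp add: laplacian_def partial_deriv_conv K dK \<mu> G) (simp add: conv_def)
qed

lemma ess_bdd_norm:
  fixes G :: "real^'n \<Rightarrow> real^'n"
  assumes "\<And>i. ess_bdd (\<lambda>x. G x $ i)" shows "ess_bdd (\<lambda>x. norm (G x))"
  unfolding norm_eq_sqrt_inner
  by (intro ess_bdd_continuous_comp[where \<phi> = sqrt] ess_bdd_inner assms continuous_on_real_sqrt
      continuous_on_id)

text \<open>
  The field \<open>\<kappa> D(K * \<mu>) + K * G\<close> is divergence free, which is the weak form required. The error term is
  the commutator between the convolution and the multiplication by \<open>b\<close>, together with the convolved
  source.
\<close>

lemma drift_diffusion_conv:
  fixes \<mu> :: "real^'n \<Rightarrow> real"
  assumes K: "K \<in> trig" and weak: "weak_drift \<kappa> \<mu> G"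
    and b: "\<And>i. ess_bdd (\<lambda>x. b x $ i)" "AE x in torus. norm (b x) \<le> L"
  shows "drift_diffusion \<kappa> L (conv K \<mu>) (grad (conv K \<mu>)) (conv_vec K G)
    (\<lambda>x. norm (conv_vec K G x - conv K \<mu> x *\<^sub>R b x))"
proof -
  have \<mu>: "ess_bdd \<mu>" and G: "\<And>i. ess_bdd (\<lambda>x. G x $ i)"
    using weak by (auto simp: weak_drift_def)
  let ?v = "conv K \<mu>" and ?G = "\<lambda>i. conv K (\<lambda>y. G y $ i)"
  have trig: "?v \<in> trig" "?G i \<in> trig" for i by (intro conv_trig K \<mu> G)+
  have "\<kappa> * (\<integral>x. grad ?v x \<bullet> q x) = - (\<integral>x. conv_vec K G x \<bullet> q x)"
    if \<phi>: "C1_periodic \<phi> q" for \<phi> q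
  proof -
    define F where "F i x = \<kappa> * partial_deriv i ?v x + ?G i x" for i x
    have F: "F i \<in> trig" for i
      unfolding F_def[abs_def] by (intro trig.add trig_cmult partial_deriv_trig trig)
    have dF: "partial_deriv i (F i) x = \<kappa> * partial_deriv i (partial_deriv i ?v) x + partial_deriv i (?G i) x" for i x
    proof -
      have "(F i has_derivative (\<lambda>h. (\<kappa> *\<^sub>R grad (partial_deriv i ?v) x + grad (?G i) x) \<bullet> h)) (at x)"
        unfolding F_def[abs_def] inner_add_left inner_scaleR_left
        by (intro has_derivative_add has_derivative_mult_right trig_has_derivative_grad partial_deriv_trig trig)
      from partial_deriv_eq[OF this, of i] show ?thesis by (simp add: grad_def)
    qed
    have "(\<Sum>i\<in>UNIV. partial_deriv i (F i) x) = 0" for x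
      using conv_weak_drift[OF K weak, of x]
      by (simp add: dF sum.distrib laplacian_def sum_distrib_left)
    from integrate_divergence_free[OF F this \<phi>]
    have "0 = (\<integral>x. (\<Sum>i\<in>UNIV. F i x * q x $ i))" by simp
    also have "(\<lambda>x. \<Sum>i\<in>UNIV. F i x * q x $ i) = (\<lambda>x. \<kappa> * (grad ?v x \<bullet> q x) + conv_vec K G x \<bullet> q x)"
      by (rule ext) (simp add: F_def inner_vec_def grad_def conv_vec_def sum_distrib_left sum.distrib algebra_simps)
    also have "(\<integral>x. \<kappa> * (grad ?v x \<bullet> q x) + conv_vec K G x \<bullet> q x)
        = \<kappa> * (\<integral>x. grad ?v x \<bullet> q x) + (\<integral>x. conv_vec K G x \<bullet> q x)"
    proof -
      have q: "ess_bdd (\<lambda>x. q x $ i)" for i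
        using \<phi> by (intro ess_bdd_continuous continuous_intros) (simp add: C1_periodic_def)
      have "integrable torus (\<lambda>x. grad ?v x \<bullet> q x)" "integrable torus (\<lambda>x. conv_vec K G x \<bullet> q x)"
        by (auto intro!: ess_bdd_integrable ess_bdd_inner q trig_ess_bdd[OF trig(2)]
            trig_ess_bdd[OF partial_deriv_trig[OF trig(1)]] simp: grad_def conv_vec_def)
      then show ?thesis by simp
    qed
    finally show ?thesis by simp
  qed
  moreover have "ess_bdd (\<lambda>x. norm (conv_vec K G x - ?v x *\<^sub>R b x))"
  proof (rule ess_bdd_norm)
    show "ess_bdd (\<lambda>x. (conv_vec K G x - ?v x *\<^sub>R b x) $ i)" for i
      using ess_bdd_diff[OF trig_ess_bdd[OF trig(2)] ess_bdd_mult[OF trig_ess_bdd[OF trig(1)] b(1)], of i i]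
      by (simp add: conv_vec_def)
  qed
  moreover have "AE x in torus. norm (conv_vec K G x) \<le> L * \<bar>?v x\<bar> + norm (conv_vec K G x - ?v x *\<^sub>R b x)"
    using b(2)
  proof eventually_elim
    case (elim x)
    have "norm (conv_vec K G x) \<le> norm (?v x *\<^sub>R b x) + norm (conv_vec K G x - ?v x *\<^sub>R b x)"
      by (rule norm_triangle_sub)
    also have "norm (?v x *\<^sub>R b x) \<le> \<bar>?v x\<bar> * L" using elim by (simp add: mult_left_mono)
    finally show ?case by (simp add: mult.commute)
  qed
  ultimately show ?thesis
    unfolding drift_diffusion_def
    by (auto simp: conv_vec_def intro!: trig_ess_bdd trig trig_C1_periodic)
qed

text \<open>
  The convolution converges in mean square in each component, and multiplication by the bounded \<open>b\<close>
  preserves this; in the limit the commutator disappears and the source remains.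
\<close>

lemma conv_source_tendsto:
  fixes \<mu> :: "real^'n \<Rightarrow> real"
  assumes weak: "weak_drift \<kappa> \<mu> G" and b: "\<And>i. ess_bdd (\<lambda>x. b x $ i)"
  shows "(\<lambda>N. \<integral>x. (norm (conv_vec (mollifier N) G x - conv (mollifier N) \<mu> x *\<^sub>R b x))^2)
    \<longlonglongrightarrow> (\<integral>x. (norm (G x - \<mu> x *\<^sub>R b x))^2)"
proof -
  have \<mu>: "ess_bdd \<mu>" and G: "\<And>i. ess_bdd (\<lambda>x. G x $ i)"
    using weak by (auto simp: weak_drift_def)
  let ?a = "\<lambda>i N x. conv (mollifier N) (\<lambda>y. G y $ i) x - conv (mollifier N) \<mu> x * b x $ i"
  let ?f = "\<lambda>i x. G x $ i - \<mu> x * b x $ i"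
  have lim: "L2_tendsto (?a i) (?f i)" for i
    by (intro L2_tendsto_diff L2_tendsto_mult L2_tendsto_conv G \<mu> b)
  have sq: "(norm x)^2 = (\<Sum>i\<in>UNIV. (x $ i)^2)" for x :: "real^'n"
    unfolding power2_norm_eq_inner inner_vec_def by (simp add: power2_eq_square)
  have int: "integrable torus (\<lambda>x. (?a i N x)^2)" "integrable torus (\<lambda>x. (?f i x)^2)" for i N
    using lim[of i] by (auto simp: L2_tendsto_def intro!: ess_bdd_integrable ess_bdd_power)
  have "(\<lambda>N. \<Sum>i\<in>UNIV. \<integral>x. (?a i N x)^2) \<longlonglongrightarrow> (\<Sum>i\<in>UNIV. \<integral>x. (?f i x)^2)"
    by (intro tendsto_sum L2_tendsto_integral_square lim)
  then show ?thesis using int by (simp add: sq conv_vec_def)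
qed

text \<open>
  The bound for smooth solutions passes to the limit. It is applied with a \<open>\<delta>\<close> slightly larger than the
  norm of the source, so that it covers all mollified sources from some index on.
\<close>

lemma weak_L2_bound:
  assumes \<kappa>: "\<kappa> > 0"
  shows "\<exists>C>0. \<forall>(\<mu> :: real^'n \<Rightarrow> real) G b. weak_drift \<kappa> \<mu> G \<longrightarrow> (\<forall>i. ess_bdd (\<lambda>x. b x $ i)) \<longrightarrow>
    (AE x in torus. norm (b x) \<le> L) \<longrightarrow> integral\<^sup>L torus \<mu> = 0 \<longrightarrow>
    (\<integral>x. (\<mu> x)^2) \<le> C * (\<integral>x. (norm (G x - \<mu> x *\<^sub>R b x))^2)"
proof -
  obtain C where C: "C > 0" and *: "\<And>(v :: real^'n \<Rightarrow> real) p G h \<delta>. drift_diffusion \<kappa> L v p G h \<Longrightarrow>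
      integral\<^sup>L torus v = 0 \<Longrightarrow> \<delta> > 0 \<Longrightarrow> (\<integral>x. (h x)^2) \<le> \<delta>^2 \<Longrightarrow> (\<integral>x. (v x)^2) \<le> C * \<delta>^2"
    using drift_diffusion_L2_bound[OF \<kappa>, of L] by blast
  have "(\<integral>x. (\<mu> x)^2) \<le> C * (\<integral>x. (norm (G x - \<mu> x *\<^sub>R b x))^2)"
    if weak: "weak_drift \<kappa> \<mu> G" and b: "\<And>i. ess_bdd (\<lambda>x. b x $ i)"
      and bL: "AE x in torus. norm (b x) \<le> L" and mean: "integral\<^sup>L torus \<mu> = 0"
    for \<mu> :: "real^'n \<Rightarrow> real" and G b
  proof -
    have \<mu>: "ess_bdd \<mu>" using weak by (simp add: weak_drift_def)
    define S where "S = (\<integral>x. (norm (G x - \<mu> x *\<^sub>R b x))^2)"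
    have "S \<ge> 0" by (simp add: S_def)
    have "(\<integral>x. (\<mu> x)^2) \<le> C * S + e" if e: "e > 0" for e
    proof -
      \<comment> \<open>Strictly larger than the norm of the limit source, even if that vanishes.\<close>
      define \<delta> where "\<delta> = sqrt (S + e / C)"
      have \<delta>: "\<delta> > 0" "\<delta>^2 = S + e / C" using \<open>S \<ge> 0\<close> e C by (auto simp: \<delta>_def add_nonneg_pos less_imp_le)
      have "eventually (\<lambda>N. (\<integral>x. (norm (conv_vec (mollifier N) G x - conv (mollifier N) \<mu> x *\<^sub>R b x))^2) < \<delta>^2) sequentially"
        using e C by (intro order_tendstoD(2)[OF conv_source_tendsto[OF weak b]]) (simp add: \<delta> flip: S_def)
      then have "eventually (\<lambda>N. (\<integral>x. (conv (mollifier N) \<mu> x)^2) \<le> C * \<delta>^2) sequentially"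
      proof eventually_elim
        case (elim N)
        show ?case
          by (rule *[OF drift_diffusion_conv[OF mollifier_trig weak b bL]])
             (use elim mean \<mu> \<delta> in \<open>auto simp: integral_conv\<close>)
      qed
      then have "(\<integral>x. (\<mu> x)^2) \<le> C * \<delta>^2"
        by (intro tendsto_upperbound[OF L2_tendsto_integral_square[OF L2_tendsto_conv[OF \<mu>]]]) auto
      then show ?thesis using C by (simp add: \<delta> distrib_left)
    qed
    then show ?thesis unfolding S_def[symmetric] by (rule field_le_epsilon)
  qed
  with C show ?thesis by blast
qed

lemma arsinh_nonexpansive: "\<bar>arsinh s - arsinh t\<bar> \<le> \<bar>s - t\<bar>" for s t :: real
proof -
  have "norm (arsinh s - arsinh t) \<le> 1 * norm (s - t)"
  proof (rule field_differentiable_bound)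
    show "(arsinh has_field_derivative 1 / sqrt (x^2 + 1)) (at x within UNIV)" for x :: real
      by (rule arsinh_real_has_field_derivative)
    show "norm (1 / sqrt (x^2 + 1)) \<le> 1" for x :: real
    proof -
      have *: "norm (1 / s) \<le> 1" if "1 \<le> s" for s :: real
        using that by (simp add: divide_le_eq)
      show ?thesis by (rule *) simp
    qed
  qed auto
  then show ?thesis by simp
qed

text \<open>
  The factor \<open>c\<close> is arbitrary because without a source the equation is homogeneous: for a given \<open>c\<close>, the
  commutator error multiplied by \<open>c\<close> has norm at most 1 from some index on.
\<close>

lemma weak_arsinh_oscillation:
  fixes \<mu> :: "real^'n \<Rightarrow> real"
  assumes \<kappa>: "\<kappa> > 0" and weak: "weak_drift \<kappa> \<mu> (\<lambda>x. \<mu> x *\<^sub>R b x)"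
    and b: "\<And>i. ess_bdd (\<lambda>x. b x $ i)" "AE x in torus. norm (b x) \<le> L"
    and c: "c > 0" and q: "ess_bdd q" "integral\<^sup>L torus q = 0"
  shows "(\<integral>x. arsinh (c * \<mu> x) * q x)^2 \<le> CARD('n) * (2 * (L^2 + 1) / \<kappa>^2) * (\<integral>x. (q x)^2)"
proof -
  have \<mu>: "ess_bdd \<mu>" using weak by (simp add: weak_drift_def)
  let ?v = "\<lambda>N. conv (mollifier N) \<mu>"
  let ?h = "\<lambda>N x. norm (conv_vec (mollifier N) (\<lambda>x. \<mu> x *\<^sub>R b x) x - ?v N x *\<^sub>R b x)"
  have "(\<lambda>N. \<integral>x. (?h N x)^2) \<longlonglongrightarrow> 0"
    using conv_source_tendsto[OF weak b(1)] by simp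
  then have "eventually (\<lambda>N. (\<integral>x. (?h N x)^2) < 1 / c^2) sequentially"
    using c by (intro order_tendstoD(2)) auto
  then have ev: "eventually (\<lambda>N. (\<integral>x. arsinh (c * ?v N x) * q x)^2
      \<le> CARD('n) * (2 * (L^2 + 1) / \<kappa>^2) * (\<integral>x. (q x)^2)) sequentially"
  proof eventually_elim
    case (elim N)
    have "(\<integral>x. (c * ?h N x)^2) = c^2 * (\<integral>x. (?h N x)^2)"
      by (simp add: power_mult_distrib)
    also have "\<dots> \<le> 1" using elim c by (simp add: field_simps)
    finally have h: "(\<integral>x. (c * ?h N x)^2) \<le> 1" .
    have "(\<integral>x. q x * arsinh (c * ?v N x))^2
        \<le> CARD('n) * (2 * (L^2 + (\<integral>x. (c * ?h N x)^2)) / \<kappa>^2) * (\<integral>x. (q x)^2)"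
      by (rule arsinh_oscillation[OF \<kappa> drift_diffusion_scale[OF drift_diffusion_conv[OF mollifier_trig weak b]] q])
         (use c in simp)
    also have "\<dots> \<le> CARD('n) * (2 * (L^2 + 1) / \<kappa>^2) * (\<integral>x. (q x)^2)"
      by (intro mult_right_mono mult_left_mono divide_right_mono add_left_mono h) auto
    finally show ?case by (simp only: mult.commute)
  qed
  have "L2_tendsto (\<lambda>N x. ?v N x * c) (\<lambda>x. \<mu> x * c)"
    by (intro L2_tendsto_mult L2_tendsto_conv \<mu> ess_bdd_const)
  then have "L2_tendsto (\<lambda>N x. arsinh (c * ?v N x)) (\<lambda>x. arsinh (c * \<mu> x))"
    unfolding mult.commute[of _ c]
    by (rule L2_tendsto_nonexpansive) (auto intro: arsinh_nonexpansive continuous_on_arsinh)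
  then have "(\<lambda>N. (\<integral>x. arsinh (c * ?v N x) * q x)^2) \<longlonglongrightarrow> (\<integral>x. arsinh (c * \<mu> x) * q x)^2"
    by (intro tendsto_power L2_tendsto_integral_mult q)
  then show ?thesis using ev by (rule tendsto_upperbound) simp
qed

text \<open>
  Suppose that the zero set \<open>Z\<close> has measure \<open>z > 0\<close>. The function \<open>q = z m - 1\<^sub>Z\<close> has mean zero, and
  \<open>\<integral> q arsinh (c m) = z \<integral> m arsinh (c m)\<close>, since \<open>arsinh (c m)\<close> vanishes on \<open>Z\<close>. As \<open>m\<close> has mass 1, this
  grows without bound with \<open>c\<close>, contradicting an oscillation bound that does not depend on \<open>c\<close>.
\<close>

lemma density_positive:
  fixes m :: "real^'n \<Rightarrow> real"
  assumes \<kappa>: "\<kappa> > 0" and weak: "weak_drift \<kappa> m (\<lambda>x. m x *\<^sub>R b x)"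
    and b: "\<And>i. ess_bdd (\<lambda>x. b x $ i)" "AE x in torus. norm (b x) \<le> L"
    and nn: "AE x in torus. 0 \<le> m x" and mass: "integral\<^sup>L torus m = 1"
  shows "AE x in torus. 0 < m x"
proof -
  have m: "ess_bdd m" using weak by (simp add: weak_drift_def)
  have [measurable]: "m \<in> borel_measurable torus" by (rule ess_bdd_measurable[OF m])
  define Z where "Z = {x \<in> space torus. m x \<le> 0}"
  have Z[measurable]: "Z \<in> sets torus" unfolding Z_def by measurable
  define z where "z = measure torus Z"
  \<comment> \<open>Mean zero, since \<open>m\<close> has mass 1 and \<open>Z\<close> has measure \<open>z\<close>.\<close>
  define q where "q x = z * m x - indicator Z x" for x
  have ind: "ess_bdd (indicator Z)"
    by (rule ess_bddI[of _ 1]) (auto simp: indicator_def)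
  have q: "ess_bdd q" unfolding q_def[abs_def] by (intro ess_bdd_intros m ind)
  have q0: "integral\<^sup>L torus q = 0"
    unfolding q_def[abs_def] using ess_bdd_integrable[OF m] ess_bdd_integrable[OF ind]
    by (simp add: mass z_def)
  define R where "R = sqrt (CARD('n) * (2 * (L^2 + 1) / \<kappa>^2) * (\<integral>x. (q x)^2))"
  have R: "R \<ge> 0" by (simp add: R_def)
  have bound: "z * (t / 2) \<le> R" if t: "t > 0" for t
  proof -
    \<comment> \<open>Chosen so that the chord of \<open>s arsinh s\<close> at \<open>c / 2\<close> has slope \<open>t\<close>.\<close>
    define c where "c = 2 * sinh t"
    have c: "c > 0" using t by (simp add: c_def)
    have as: "arsinh (c / 2) = t" by (simp add: c_def arsinh_sinh_real)
    have bdd: "ess_bdd (\<lambda>x. arsinh (c * m x))"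
      by (intro ess_bdd_continuous_comp[where \<phi> = arsinh] ess_bdd_intros m continuous_on_arsinh)
    have "z * (t / 2) = (\<integral>x. z * ((m x - 1 / 2) * t))"
      using ess_bdd_integrable[OF m] by (simp add: mass torus.prob_space)
    also have "\<dots> \<le> (\<integral>x. arsinh (c * m x) * q x)"
    proof (rule integral_mono_AE)
      show "AE x in torus. z * ((m x - 1 / 2) * t) \<le> arsinh (c * m x) * q x"
        using nn AE_space
      proof eventually_elim
        case (elim x)
        have "c * ((m x - 1 / 2) * t) = (\<bar>c * m x\<bar> - c / 2) * arsinh (c / 2)"
          unfolding as using c elim by (simp add: algebra_simps abs_mult)
        also have "\<dots> \<le> c * m x * arsinh (c * m x)"
          using c by (intro arsinh_chord) simp
        finally have "(m x - 1 / 2) * t \<le> m x * arsinh (c * m x)"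
          using c by (simp add: mult.assoc)
        then have "z * ((m x - 1 / 2) * t) \<le> z * (m x * arsinh (c * m x))"
          by (intro mult_left_mono) (auto simp: z_def)
        also have "\<dots> = arsinh (c * m x) * q x"
          using elim by (cases "x \<in> Z") (auto simp: q_def Z_def)
        finally show ?case .
      qed
    qed (intro ess_bdd_rules m bdd q)+
    also have "\<dots> \<le> \<bar>\<integral>x. arsinh (c * m x) * q x\<bar>" by simp
    also have "\<dots> \<le> R"
      unfolding R_def using weak_arsinh_oscillation[OF \<kappa> weak b c q q0]
      by (intro real_le_rsqrt) simp
    finally show ?thesis .
  qed
  have "z = 0"
  proof (rule ccontr)
    assume "z \<noteq> 0"
    then have z: "z > 0" by (simp add: z_def zero_less_measure_iff)
    then show False using bound[of "2 * (R + 1) / z"] R by simp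
  qed
  then have "emeasure torus Z = 0" by (simp add: z_def torus.emeasure_eq_measure)
  then have "AE x in torus. x \<notin> Z" using Z by (intro AE_not_in null_setsI)
  then show ?thesis using AE_space by eventually_elim (auto simp: Z_def)
qed

section \<open>Uniformly convex Hamiltonians\<close>

lemma grad_has_derivative:
  assumes "f differentiable (at x)"
  shows "(f has_derivative (\<lambda>h. grad f x \<bullet> h)) (at x)"
proof -
  let ?D = "frechet_derivative f (at x)"
  have D: "(f has_derivative ?D) (at x)" using assms frechet_derivative_works by blast
  then interpret D: bounded_linear ?D by (rule has_derivative_bounded_linear)
  have "?D h = grad f x \<bullet> h" for h
  proof -
    have "h = (\<Sum>i\<in>UNIV. h $ i *\<^sub>R axis i 1)"
      by (simp add: vec_eq_iff axis_def if_distrib cong: if_cong)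
    then have "?D h = ?D (\<Sum>i\<in>UNIV. h $ i *\<^sub>R axis i 1)" by simp
    also have "\<dots> = (\<Sum>i\<in>UNIV. h $ i * ?D (axis i 1))" by (simp add: D.sum D.scaleR)
    finally show ?thesis by (simp add: inner_vec_def grad_def partial_deriv_def mult.commute)
  qed
  then have "?D = (\<lambda>h. grad f x \<bullet> h)" by (rule ext)
  with D show ?thesis by simp
qed

lemma Ck_2D:
  assumes "Ck 2 f"
  shows "f differentiable (at x)" "partial_deriv i f differentiable (at x)"
    "continuous_on UNIV (partial_deriv j (partial_deriv i f))"
proof -
  have d: "length is < 2 \<Longrightarrow> foldr partial_deriv is f differentiable (at x)"
    and c: "length is = 2 \<Longrightarrow> continuous_on UNIV (foldr partial_deriv is f)" for "is" x
    using assms by (auto simp: Ck_def)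
  show "f differentiable (at x)" "partial_deriv i f differentiable (at x)"
    "continuous_on UNIV (partial_deriv j (partial_deriv i f))"
    using d[of "[]" x] d[of "[i]" x] c[of "[j, i]"] by simp_all
qed

lemma line_derivative:
  assumes "\<And>x. f differentiable (at x)"
  shows "((\<lambda>t. f (x + t *\<^sub>R v)) has_real_derivative (grad f (x + t *\<^sub>R v) \<bullet> v)) (at t)"
proof -
  have "((\<lambda>t. x + t *\<^sub>R v) has_derivative (\<lambda>s. s *\<^sub>R v)) (at t)"
    by (auto intro!: derivative_eq_intros)
  from has_derivative_compose[OF this grad_has_derivative[OF assms]]
  show ?thesis
    unfolding has_field_derivative_def by (rule has_derivative_eq_rhs) (simp add: fun_eq_iff)
qed

text \<open>
  Two applications of the mean value theorem, first in direction \<open>i\<close> and then in direction \<open>j\<close>. The left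
  side is symmetric in \<open>i\<close> and \<open>j\<close>, which is the reason for the symmetry of second derivatives.
\<close>

lemma second_difference:
  assumes f: "Ck 2 f" and s: "s > 0"
  shows "\<exists>t r. 0 < t \<and> t < s \<and> 0 < r \<and> r < s \<and>
    f (x + axis i s + axis j s) - f (x + axis i s) - f (x + axis j s) + f x
      = s^2 * partial_deriv j (partial_deriv i f) (x + axis i t + axis j r)"
proof -
  have ax: "axis k t = t *\<^sub>R axis k 1" for k and t :: real
    by (simp add: vec_eq_iff axis_def)
  let ?g = "\<lambda>t. f (x + axis j s + t *\<^sub>R axis i 1) - f (x + t *\<^sub>R axis i 1)"
  let ?g' = "\<lambda>t. partial_deriv i f (x + axis j s + t *\<^sub>R axis i 1) - partial_deriv i f (x + t *\<^sub>R axis i 1)"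
  have pd: "grad h y \<bullet> axis k 1 = partial_deriv k h y" for h k and y :: "real^'n"
    by (simp add: inner_axis grad_def)
  have "(?g has_real_derivative ?g' t) (at t)" for t
    unfolding pd[symmetric] by (intro DERIV_diff line_derivative Ck_2D(1)[OF f])
  then obtain t where t: "0 < t" "t < s" "?g s - ?g 0 = (s - 0) * ?g' t"
    using MVT2[of 0 s ?g ?g'] s by blast
  let ?h = "\<lambda>r. partial_deriv i f (x + axis i t + r *\<^sub>R axis j 1)"
  let ?h' = "\<lambda>r. partial_deriv j (partial_deriv i f) (x + axis i t + r *\<^sub>R axis j 1)"
  have "(?h has_real_derivative ?h' r) (at r)" for r
    unfolding pd[of "partial_deriv i f", symmetric] by (intro line_derivative Ck_2D(2)[OF f])
  then obtain r where r: "0 < r" "r < s" "?h s - ?h 0 = (s - 0) * ?h' r"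
    using MVT2[of 0 s ?h ?h'] s by blast
  have "?g' t = ?h s - ?h 0" unfolding ax[of j s] ax[of i t] by (simp add: add_ac)
  then have "s^2 * ?h' r = ?g s - ?g 0" using t r by (simp add: power2_eq_square)
  also have "?g s - ?g 0 = f (x + axis i s + axis j s) - f (x + axis i s) - f (x + axis j s) + f x"
    unfolding ax[of i s] by (simp add: add_ac)
  finally show ?thesis using t r unfolding ax[of j r, symmetric] by metis
qed

lemma mixed_partials_commute:
  assumes f: "Ck 2 f"
  shows "partial_deriv i (partial_deriv j f) x = partial_deriv j (partial_deriv i f) x"
proof -
  define \<Delta> where "\<Delta> s = f (x + axis i s + axis j s) - f (x + axis i s) - f (x + axis j s) + f x" for s
  let ?s = "\<lambda>n. 1 / real (Suc n)"
  have s0: "?s \<longlonglongrightarrow> 0" by (rule LIMSEQ_Suc[OF lim_1_over_n])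
  have lim: "(\<lambda>n. \<Delta> (?s n) / (?s n)^2) \<longlonglongrightarrow> partial_deriv k (partial_deriv l f) x"
    if ex: "\<And>s. s > 0 \<Longrightarrow> \<exists>t r. 0 < t \<and> t < s \<and> 0 < r \<and> r < s \<and>
      \<Delta> s = s^2 * partial_deriv k (partial_deriv l f) (x + axis l t + axis k r)" for k l
  proof -
    have "\<forall>n. \<exists>t r. 0 < t \<and> t < ?s n \<and> 0 < r \<and> r < ?s n \<and>
      \<Delta> (?s n) = (?s n)^2 * partial_deriv k (partial_deriv l f) (x + axis l t + axis k r)"
      using ex by (intro allI) simp
    then obtain t r where tr: "\<And>n. 0 < t n \<and> t n < ?s n \<and> 0 < r n \<and> r n < ?s n \<and>
      \<Delta> (?s n) = (?s n)^2 * partial_deriv k (partial_deriv l f) (x + axis l (t n) + axis k (r n))"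
      by metis
    have "t \<longlonglongrightarrow> 0" "r \<longlonglongrightarrow> 0"
      by (rule real_tendsto_sandwich[OF _ _ tendsto_const s0];
          intro always_eventually allI less_imp_le; use tr in blast)+
    then have "(\<lambda>n. x + t n *\<^sub>R axis l 1 + r n *\<^sub>R axis k 1) \<longlonglongrightarrow> x + 0 *\<^sub>R axis l 1 + 0 *\<^sub>R axis k 1"
      by (intro tendsto_intros)
    moreover have "t n *\<^sub>R axis l 1 = axis l (t n)" "r n *\<^sub>R axis k 1 = axis k (r n)" for n
      by (simp_all add: vec_eq_iff axis_def)
    ultimately have "(\<lambda>n. x + axis l (t n) + axis k (r n)) \<longlonglongrightarrow> x" by simp
    then have "(\<lambda>n. partial_deriv k (partial_deriv l f) (x + axis l (t n) + axis k (r n)))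
        \<longlonglongrightarrow> partial_deriv k (partial_deriv l f) x"
      using continuous_on_tendsto_compose[OF Ck_2D(3)[OF f]] by (metis UNIV_I always_eventually)
    moreover have "\<Delta> (?s n) / (?s n)^2
        = partial_deriv k (partial_deriv l f) (x + axis l (t n) + axis k (r n))" for n
    proof -
      have *: "a / b = c" if "a = b * c" "b \<noteq> 0" for a b c :: real using that by simp
      show ?thesis by (rule *) (use tr in \<open>blast, simp\<close>)
    qed
    ultimately show ?thesis by presburger
  qed
  have "\<Delta> s = f (x + axis j s + axis i s) - f (x + axis j s) - f (x + axis i s) + f x" for s
    by (simp add: \<Delta>_def add_ac)
  then have "\<exists>t r. 0 < t \<and> t < s \<and> 0 < r \<and> r < s \<and>
      \<Delta> s = s^2 * partial_deriv i (partial_deriv j f) (x + axis j t + axis i r)" if "s > 0" for s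
    using second_difference[OF f that, of x j i] by simp
  from lim[OF this] lim[OF second_difference[OF f, of _ x i j, folded \<Delta>_def]] show ?thesis
    by (rule LIMSEQ_unique)
qed

lemma inner_hessian:
  "v \<bullet> (hessian f x *v w) = (\<Sum>i\<in>UNIV. \<Sum>j\<in>UNIV. v $ i * (partial_deriv i (partial_deriv j f) x * w $ j))"
  by (simp add: inner_vec_def matrix_vector_mult_def hessian_def sum_distrib_left)

lemma hessian_symmetric:
  assumes "Ck 2 f" shows "v \<bullet> (hessian f x *v w) = w \<bullet> (hessian f x *v v)"
  unfolding inner_hessian
  by (subst sum.swap) (simp add: mixed_partials_commute[OF assms] mult_ac cong: sum.cong)

text \<open>
  Polarization. The bounds on the quadratic form control the bilinear form only because the Hessian is
  symmetric.
\<close>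

lemma hessian_bound:
  fixes v w :: "real^'n"
  assumes f: "Ck 2 f" and pos: "\<And>v. 0 \<le> v \<bullet> (hessian f x *v v)"
    and le: "\<And>v. v \<bullet> (hessian f x *v v) \<le> \<beta> * (v \<bullet> v)"
  shows "v \<bullet> (hessian f x *v w) \<le> \<beta> * (norm v * norm w)"
proof -
  let ?A = "hessian f x"
  have unit: "v \<bullet> (?A *v w) \<le> \<beta>" if "norm v = 1" "norm w = 1" for v w :: "real^'n"
  proof -
    have "4 * (v \<bullet> (?A *v w)) = (v + w) \<bullet> (?A *v (v + w)) - (v - w) \<bullet> (?A *v (v - w))"
      using hessian_symmetric[OF f, of v x w]
      by (simp add: inner_diff_left inner_diff_right inner_add_left inner_add_right
          matrix_vector_right_distrib matrix_vector_mult_diff_distrib)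
    also have "\<dots> \<le> \<beta> * ((v + w) \<bullet> (v + w))" using le[of "v + w"] pos[of "v - w"] by linarith
    also have "\<dots> \<le> \<beta> * 4"
    proof (rule mult_left_mono)
      have "norm (v + w) \<le> 2" using norm_triangle_ineq[of v w] that by simp
      then have "(norm (v + w))^2 \<le> 2^2" by (intro power_mono) auto
      then show "(v + w) \<bullet> (v + w) \<le> 4" by (simp add: power2_norm_eq_inner)
      show "0 \<le> \<beta>" using order_trans[OF pos le, of v] that by (simp flip: power2_norm_eq_inner)
    qed
    finally show ?thesis by simp
  qed
  show ?thesis
  proof (cases "v = 0 \<or> w = 0")
    case False
    then have "sgn v \<bullet> (?A *v sgn w) \<le> \<beta>" by (intro unit) (auto simp: norm_sgn)
    moreover have "v \<bullet> (?A *v w) = (norm v * norm w) * (sgn v \<bullet> (?A *v sgn w))"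
    proof -
      have "v = norm v *\<^sub>R sgn v" "w = norm w *\<^sub>R sgn w" using False by (auto simp: sgn_div_norm)
      then have "v \<bullet> (?A *v w) = (norm v *\<^sub>R sgn v) \<bullet> (?A *v (norm w *\<^sub>R sgn w))" by simp
      then show ?thesis by (simp add: matrix_vector_mult_scaleR)
    qed
    ultimately show ?thesis
      using mult_left_mono[of "sgn v \<bullet> (?A *v sgn w)" \<beta> "norm v * norm w"] by (simp add: mult.commute)
  qed auto
qed

lemma line_derivative_grad:
  assumes h: "Ck 2 h"
  shows "((\<lambda>t. grad h (p + t *\<^sub>R v) \<bullet> e) has_real_derivative v \<bullet> (hessian h (p + t *\<^sub>R v) *v e)) (at t)"
proof -
  have "((\<lambda>t. \<Sum>j\<in>UNIV. partial_deriv j h (p + t *\<^sub>R v) * e $ j) has_real_derivative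
      (\<Sum>j\<in>UNIV. (grad (partial_deriv j h) (p + t *\<^sub>R v) \<bullet> v) * e $ j)) (at t)"
    by (intro DERIV_sum DERIV_cmult_right line_derivative Ck_2D[OF h])
  moreover have "(\<Sum>j\<in>UNIV. (grad (partial_deriv j h) (p + t *\<^sub>R v) \<bullet> v) * e $ j)
      = v \<bullet> (hessian h (p + t *\<^sub>R v) *v e)"
    unfolding inner_hessian
    by (subst sum.swap) (simp add: inner_vec_def grad_def sum_distrib_left sum_distrib_right mult_ac)
  ultimately show ?thesis by (simp add: inner_vec_def grad_def)
qed

lemma segment_in_cball:
  assumes "norm p \<le> U" "norm q \<le> U" "0 \<le> t" "t \<le> (1::real)"
  shows "norm (p + t *\<^sub>R (q - p)) \<le> U"
proof -
  have "p + t *\<^sub>R (q - p) = (1 - t) *\<^sub>R p + t *\<^sub>R q" by (simp add: algebra_simps)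
  moreover have "convex (cball (0 :: 'a::real_normed_vector) U)" by simp
  ultimately show ?thesis
    using convexD[of "cball 0 U" p q "1 - t" t] assms by simp
qed

lemma Hamiltonian_Lipschitz:
  assumes h: "Ck 2 h" and L: "\<And>p. norm p \<le> U \<Longrightarrow> norm (grad h p) \<le> L"
    and p: "norm p \<le> U" "norm q \<le> U"
  shows "\<bar>h q - h p\<bar> \<le> L * norm (q - p)"
proof -
  obtain t where t: "0 < t" "t < 1"
    "h (p + 1 *\<^sub>R (q - p)) - h (p + 0 *\<^sub>R (q - p)) = (1 - 0) * (grad h (p + t *\<^sub>R (q - p)) \<bullet> (q - p))"
    using MVT2[of 0 1, OF _ line_derivative[OF Ck_2D(1)[OF h]]] by (metis zero_less_one)
  then have "\<bar>h q - h p\<bar> = \<bar>grad h (p + t *\<^sub>R (q - p)) \<bullet> (q - p)\<bar>" by simp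
  also have "\<dots> \<le> norm (grad h (p + t *\<^sub>R (q - p))) * norm (q - p)" by (rule Cauchy_Schwarz_ineq2)
  also have "\<dots> \<le> L * norm (q - p)"
    using t by (intro mult_right_mono L segment_in_cball p) auto
  finally show ?thesis .
qed

text \<open>
  Taylor's formula of order two along the segment, which stays in the ball where the Hessian is bounded
  below.
\<close>

lemma Hamiltonian_convexity:
  assumes h: "Ck 2 h" and \<alpha>: "\<And>p v. norm p \<le> U \<Longrightarrow> \<alpha> * (v \<bullet> v) \<le> v \<bullet> (hessian h p *v v)"
    and p: "norm p \<le> U" "norm q \<le> U"
  shows "h q - h p - grad h p \<bullet> (q - p) \<ge> \<alpha> / 2 * (norm (q - p))^2"
proof -
  let ?v = "q - p"
  let ?d = "\<lambda>k t. if k = 0 then h (p + t *\<^sub>R ?v) else if k = (1::nat) then grad h (p + t *\<^sub>R ?v) \<bullet> ?v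
    else ?v \<bullet> (hessian h (p + t *\<^sub>R ?v) *v ?v)"
  have "\<exists>t. 0 < t \<and> t < 1 \<and> h (p + 1 *\<^sub>R ?v)
      = (\<Sum>m<2. ?d m 0 / fact m * 1 ^ m) + ?d 2 t / fact 2 * 1 ^ 2"
  proof (rule Maclaurin)
    show "\<forall>m t. m < 2 \<and> 0 \<le> t \<and> t \<le> 1 \<longrightarrow> (?d m has_real_derivative ?d (Suc m) t) (at t)"
      using line_derivative_grad[OF h] line_derivative[OF Ck_2D(1)[OF h]] by (auto simp: less_Suc_eq numeral_2_eq_2)
  qed auto
  then obtain t where t: "0 < t" "t < 1" and eq: "h (p + 1 *\<^sub>R ?v)
      = (\<Sum>m<2. ?d m 0 / fact m * 1 ^ m) + ?d 2 t / fact 2 * 1 ^ 2" by blast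
  have "h q = h p + grad h p \<bullet> ?v + ?v \<bullet> (hessian h (p + t *\<^sub>R ?v) *v ?v) / 2"
    using eq by (simp add: numeral_2_eq_2)
  moreover have "\<alpha> * (?v \<bullet> ?v) \<le> ?v \<bullet> (hessian h (p + t *\<^sub>R ?v) *v ?v)"
    using t by (intro \<alpha> segment_in_cball p) auto
  ultimately show ?thesis by (simp add: power2_norm_eq_inner)
qed

text \<open>
  Mean value theorem for the component of the gradient in the direction \<open>e\<close> of its own increment.
\<close>

lemma Hamiltonian_grad_Lipschitz:
  assumes h: "Ck 2 h" and pos: "\<And>p v. norm p \<le> U \<Longrightarrow> 0 \<le> v \<bullet> (hessian h p *v v)"
    and \<beta>: "\<And>p v. norm p \<le> U \<Longrightarrow> v \<bullet> (hessian h p *v v) \<le> \<beta> * (v \<bullet> v)"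
    and p: "norm p \<le> U" "norm q \<le> U"
  shows "norm (grad h q - grad h p) \<le> \<beta> * norm (q - p)"
proof -
  let ?v = "q - p"
  define e where "e = grad h q - grad h p"
  obtain t where t: "0 < t" "t < 1"
    "grad h (p + 1 *\<^sub>R ?v) \<bullet> e - grad h (p + 0 *\<^sub>R ?v) \<bullet> e = (1 - 0) * (?v \<bullet> (hessian h (p + t *\<^sub>R ?v) *v e))"
    using MVT2[of 0 1, OF _ line_derivative_grad[OF h]] by (metis zero_less_one)
  have U: "norm (p + t *\<^sub>R ?v) \<le> U" using t by (intro segment_in_cball p) auto
  have "norm e * norm e = e \<bullet> e" by (simp flip: power2_norm_eq_inner add: power2_eq_square)
  also have "\<dots> = ?v \<bullet> (hessian h (p + t *\<^sub>R ?v) *v e)"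
    using t(3) by (simp add: e_def inner_diff_left)
  also have "\<dots> \<le> \<beta> * (norm ?v * norm e)" by (intro hessian_bound h pos \<beta> U)
  finally have "norm e * norm e \<le> (\<beta> * norm ?v) * norm e" by (simp add: mult_ac)
  then have "norm e \<le> \<beta> * norm ?v" if "e \<noteq> 0" using that by (simp add: mult_le_cancel_right)
  moreover have "0 \<le> \<beta> * norm ?v"
  proof (cases "?v = 0")
    case False
    have "0 \<le> \<beta> * (?v \<bullet> ?v)" using order_trans[OF pos[OF U] \<beta>[OF U]] .
    moreover have "0 < ?v \<bullet> ?v" using False by simp
    ultimately have "0 \<le> \<beta>" by (metis leD mult_neg_pos not_le_imp_less)
    then show ?thesis by simp
  qed simp
  ultimately show ?thesis unfolding e_def[symmetric] by (cases "e = 0") auto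
qed

lemma loewner_le_mat:
  fixes A :: "real^'n^'n"
  shows
  "loewner_le (mat a) A \<longleftrightarrow> (\<forall>v. a * (v \<bullet> v) \<le> v \<bullet> (A *v v))"
  "loewner_le A (mat a) \<longleftrightarrow> (\<forall>v. v \<bullet> (A *v v) \<le> a * (v \<bullet> v))"
proof -
  have "mat a *v v = a *\<^sub>R v" for v :: "real^'n"
    by (simp add: vec_eq_iff matrix_vector_mult_def mat_def if_distrib[where f = "\<lambda>c. c * _"] cong: if_cong)
  then show "loewner_le (mat a) A \<longleftrightarrow> (\<forall>v. a * (v \<bullet> v) \<le> v \<bullet> (A *v v))"
    "loewner_le A (mat a) \<longleftrightarrow> (\<forall>v. v \<bullet> (A *v v) \<le> a * (v \<bullet> v))"
    by (simp_all add: loewner_le_def)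
qed

section \<open>Superposition of Caratheodory functions\<close>

lemma borel_measurable_torus_AE:
  fixes f g :: "real^'n \<Rightarrow> real"
  assumes "f \<in> borel_measurable torus" "AE x in torus. f x = g x"
  shows "g \<in> borel_measurable torus"
proof -
  let ?r = "\<lambda>h x. if x \<in> cbox 0 1 then h x else 0 :: real"
  have "?r f \<in> borel_measurable lebesgue"
    using assms(1) unfolding torus_def by (rule borel_measurable_if_I) auto
  moreover have "AE x in lebesgue. ?r f x = ?r g x"
    using assms(2) unfolding torus_def by (subst (asm) AE_restrict_space_iff) (auto elim: eventually_mono)
  ultimately have "?r g \<in> borel_measurable lebesgue" by (rule borel_measurable_AE)
  then show ?thesis unfolding torus_def by (rule borel_measurable_if_D)
qed

text \<open>
  Approximate \<open>P\<close> by simple functions, for which measurability is clear, and pass to the limit by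
  continuity; the exceptional null set is harmless because Lebesgue measure is complete.
\<close>

lemma Caratheodory_superposition:
  fixes g :: "real^'n \<Rightarrow> 'b::{metric_space, second_countable_topology} \<Rightarrow> real"
  assumes g: "\<And>p. (\<lambda>x. g x p) \<in> borel_measurable torus"
    and cont: "AE x in torus. continuous_on UNIV (g x)"
    and P: "P \<in> borel_measurable torus"
  shows "(\<lambda>x. g x (P x)) \<in> borel_measurable torus"
proof -
  obtain s where s: "\<And>i. simple_function torus (s i)"
    and lim: "\<And>x. x \<in> space torus \<Longrightarrow> (\<lambda>i. s i x) \<longlonglongrightarrow> P x"
    using borel_measurable_implies_sequence_metric[OF P] by metis
  have step: "(\<lambda>x. g x (s i x)) \<in> borel_measurable torus" for i
  proof (rule measurable_compose_countable'[where f = "\<lambda>p x. g x p" and I = "s i ` space torus"])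
    show "s i \<in> torus \<rightarrow>\<^sub>M count_space (s i ` space torus)"
      using s[of i] by (rule measurable_simple_function[THEN measurable_count_space_extend[rotated 2]]) auto
    show "countable (s i ` space torus)"
      using s[of i] by (simp add: simple_function_def countable_finite)
  qed (rule g)
  define f where "f x = lim (\<lambda>i. g x (s i x))" for x
  have "f \<in> borel_measurable torus"
    unfolding f_def[abs_def] using step by (rule borel_measurable_lim_metric)
  moreover have "AE x in torus. f x = g x (P x)"
    using cont AE_space
  proof eventually_elim
    case (elim x)
    have "(\<lambda>i. g x (s i x)) \<longlonglongrightarrow> g x (P x)"
      by (rule continuous_on_tendsto_compose[OF elim(1) lim[OF elim(2)]]) auto
    then show ?case by (simp add: f_def limI)
  qed
  ultimately show ?thesis by (rule borel_measurable_torus_AE)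
qed

text \<open>
  The partial derivatives in \<open>p\<close> are limits of difference quotients, hence again Caratheodory functions.
\<close>

lemma measurable_grad_superposition:
  assumes meas: "\<And>p. (\<lambda>x. H x p) \<in> borel_measurable torus" and C2: "\<And>x. Ck 2 (H x)"
    and P: "P \<in> borel_measurable torus"
  shows "(\<lambda>x. grad (H x) (P x) $ i) \<in> borel_measurable torus"
proof -
  have "(\<lambda>x. partial_deriv i (H x) p) \<in> borel_measurable torus" for p
  proof (rule borel_measurable_LIMSEQ_real)
    let ?s = "\<lambda>n. inverse (real (Suc n))"
    show "(\<lambda>x. (H x (p + ?s n *\<^sub>R axis i 1) - H x p) / ?s n) \<in> borel_measurable torus" for n
      by (intro borel_measurable_divide borel_measurable_diff meas borel_measurable_const)
    show "(\<lambda>n. (H x (p + ?s n *\<^sub>R axis i 1) - H x p) / ?s n) \<longlonglongrightarrow> partial_deriv i (H x) p" for x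
    proof -
      have "((\<lambda>t. H x (p + t *\<^sub>R axis i 1)) has_real_derivative partial_deriv i (H x) p) (at 0)"
        using line_derivative[OF Ck_2D(1)[OF C2], of x p "axis i 1" 0]
        by (simp add: inner_axis grad_def)
      then have "((\<lambda>t. (H x (p + t *\<^sub>R axis i 1) - H x p) / t) \<longlongrightarrow> partial_deriv i (H x) p) (at 0)"
        by (simp add: DERIV_def)
      then show ?thesis
        by (rule filterlim_compose)
           (auto simp: filterlim_at simp del: of_nat_Suc intro: LIMSEQ_inverse_real_of_nat)
    qed
  qed
  moreover have "AE x in torus. continuous_on UNIV (partial_deriv i (H x))"
    using Ck_2D(2)[OF C2] by (simp add: continuous_at_imp_continuous_on differentiable_imp_continuous_within)
  ultimately have "(\<lambda>x. partial_deriv i (H x) (P x)) \<in> borel_measurable torus"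
    by (rule Caratheodory_superposition[where g = "\<lambda>x. partial_deriv i (H x)", OF _ _ P])
  then show ?thesis by (simp add: grad_def)
qed

text \<open>
  The coupling is controlled on \<open>[0, \<infinity>)\<close> only, hence the truncation \<open>max 0\<close>. Its Lipschitz constants are
  available for almost every \<open>x\<close> on each bounded interval, and integer bounds suffice for continuity.
\<close>

lemma measurable_coupling_superposition:
  assumes F: "admissible_F F" and m: "m \<in> borel_measurable torus" "AE x in torus. 0 \<le> m x"
  shows "(\<lambda>x. F x (m x)) \<in> borel_measurable torus"
proof -
  have "AE x in torus. \<forall>k::nat. \<exists>l. \<forall>r\<in>{0..real (Suc k)}. \<forall>r'\<in>{0..real (Suc k)}. \<bar>F x r - F x r'\<bar> \<le> l * \<bar>r - r'\<bar>"
    unfolding AE_all_countable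
  proof
    fix k :: nat
    have "0 < real (Suc k)" by simp
    then obtain c l where "AE x in torus. (\<forall>r\<in>{0..real (Suc k)}. \<bar>F x r\<bar> \<le> c) \<and>
        (\<forall>r\<in>{0..real (Suc k)}. \<forall>r'\<in>{0..real (Suc k)}. \<bar>F x r - F x r'\<bar> \<le> l * \<bar>r - r'\<bar>)"
      using F unfolding admissible_F_def by blast
    then show "AE x in torus. \<exists>l. \<forall>r\<in>{0..real (Suc k)}. \<forall>r'\<in>{0..real (Suc k)}. \<bar>F x r - F x r'\<bar> \<le> l * \<bar>r - r'\<bar>"
      by eventually_elim blast
  qed
  then have "AE x in torus. continuous_on UNIV (\<lambda>r. F x (max 0 r))"
  proof eventually_elim
    case (elim x)
    have "isCont (\<lambda>r. F x (max 0 r)) r" for r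
    proof -
      obtain k :: nat where k: "\<bar>r\<bar> + 1 \<le> real k" using real_arch_simple by blast
      obtain l where l: "\<And>s s'. s \<in> {0..real (Suc k)} \<Longrightarrow> s' \<in> {0..real (Suc k)} \<Longrightarrow> \<bar>F x s - F x s'\<bar> \<le> l * \<bar>s - s'\<bar>"
        using elim by blast
      have c: "continuous_on {0..real (Suc k)} (F x)"
      proof (rule continuous_on_subset[OF lipschitz_on_continuous_on])
        show "(max l 0)-lipschitz_on {0..real (Suc k)} (F x)"
        proof (rule lipschitz_onI)
          fix s s' assume "s \<in> {0..real (Suc k)}" "s' \<in> {0..real (Suc k)}"
          then have "\<bar>F x s - F x s'\<bar> \<le> l * \<bar>s - s'\<bar>" by (rule l)
          also have "\<dots> \<le> max l 0 * \<bar>s - s'\<bar>" by (intro mult_right_mono) auto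
          finally show "dist (F x s) (F x s') \<le> max l 0 * dist s s'" by (simp add: dist_real_def)
        qed simp
      qed auto
      have "continuous_on {r - 1<..<r + 1} (\<lambda>r. F x (max 0 r))"
        using k by (intro continuous_on_compose2[OF c] continuous_intros) auto
      then show ?thesis by (simp add: continuous_on_eq_continuous_at)
    qed
    then show ?case by (simp add: continuous_at_imp_continuous_on)
  qed
  then have "(\<lambda>x. F x (max 0 (m x))) \<in> borel_measurable torus"
    using F by (intro Caratheodory_superposition[where g = "\<lambda>x r. F x (max 0 r)", OF _ _ m(1)])
      (auto simp: admissible_F_def)
  moreover have "AE x in torus. F x (max 0 (m x)) = F x (m x)"
    using m(2) by eventually_elim (simp add: max_def)
  ultimately show ?thesis by (rule borel_measurable_torus_AE)
qed

section \<open>Uniqueness for the ergodic system\<close>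

lemma measurable_vec_nth:
  "P \<in> borel_measurable M \<Longrightarrow> (\<lambda>x. (P x :: real^'n) $ i) \<in> borel_measurable M"
  by (rule measurable_compose[OF _ borel_measurable_continuous_onI]) (auto intro: continuous_intros)

lemma Linf_norm_leD:
  assumes "Linf_norm f \<le> ennreal B" "B \<ge> 0" shows "AE x in torus. norm (f x) \<le> B"
proof -
  have "AE x in torus. ennreal (norm (f x)) \<le> Linf_norm f"
    unfolding Linf_norm_def by (rule esssup_AE)
  then show ?thesis
  proof eventually_elim
    case (elim x)
    then have "ennreal (norm (f x)) \<le> ennreal B" using assms by (meson order_trans)
    then show ?case using assms by simp
  qed
qed

lemma Linf_ess_bdd:
  fixes f :: "real^'n \<Rightarrow> real"
  assumes "f \<in> Linf" shows "ess_bdd f"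
proof -
  have "Linf_norm f \<le> ennreal (enn2real (Linf_norm f))" using assms by (simp add: Linf_def)
  from Linf_norm_leD[OF this] have "AE x in torus. \<bar>f x\<bar> \<le> enn2real (Linf_norm f)" by simp
  then show ?thesis using assms by (intro ess_bddI) (auto simp: Linf_def)
qed

lemma weak_gradient_component:
  assumes wg: "weak_gradient u P" and u: "ess_bdd u"
    and P: "P \<in> borel_measurable torus" "\<And>i. ess_bdd (\<lambda>x. P x $ i)" and \<phi>: "\<phi> \<in> trig"
  shows "(\<integral>x. u x * partial_deriv i \<phi> x) = - (\<integral>x. \<phi> x * P x $ i)"
proof -
  have g: "continuous_on UNIV (grad \<phi>)"
    using trig_C1_periodic[OF \<phi>] by (simp add: C1_periodic_def)
  have bdd: "ess_bdd (\<lambda>x. norm (u x *\<^sub>R grad \<phi> x))" "ess_bdd (\<lambda>x. norm (\<phi> x *\<^sub>R P x))"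
    unfolding norm_scaleR
    by (intro ess_bdd_mult ess_bdd_abs u trig_ess_bdd[OF \<phi>] ess_bdd_norm P
        ess_bdd_continuous continuous_intros g)+
  have "(\<lambda>x. u x *\<^sub>R grad \<phi> x) \<in> borel_measurable torus" "(\<lambda>x. \<phi> x *\<^sub>R P x) \<in> borel_measurable torus"
    by (intro borel_measurable_scaleR ess_bdd_measurable u trig_ess_bdd[OF \<phi>] P
        borel_measurable_torus_continuous g)+
  then have int: "integrable torus (\<lambda>x. u x *\<^sub>R grad \<phi> x)" "integrable torus (\<lambda>x. \<phi> x *\<^sub>R P x)"
    using bdd[THEN ess_bdd_integrable] by (simp_all only: integrable_norm_iff)
  have "(\<integral>x. u x *\<^sub>R grad \<phi> x) $ i = (- (\<integral>x. \<phi> x *\<^sub>R P x)) $ i"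
    using wg trig_test_function[OF \<phi>] by (simp add: weak_gradient_def)
  then show ?thesis
    using integral_bounded_linear[OF bounded_linear_vec_nth int(1), of i]
      integral_bounded_linear[OF bounded_linear_vec_nth int(2), of i]
    by (simp add: grad_def)
qed

lemma conv_weak_gradient:
  fixes w :: "real^'n \<Rightarrow> real"
  assumes w: "ess_bdd w"
    and wg: "\<And>\<phi> i. \<phi> \<in> trig \<Longrightarrow> (\<integral>x. w x * partial_deriv i \<phi> x) = - (\<integral>x. \<phi> x * P x $ i)"
    and K: "K \<in> trig"
  shows "partial_deriv i (conv K w) = conv K (\<lambda>y. P y $ i)"
proof -
  have "conv (partial_deriv i K) w x = conv K (\<lambda>y. P y $ i) x" for x
    using wg[OF reflect_trig[OF K, of x], of i] by (simp add: partial_deriv_shift[OF K] conv_def mult.commute)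
  then show ?thesis by (simp add: partial_deriv_conv[OF K w] fun_eq_iff)
qed

text \<open>
  Two equations, \<open>- \<kappa> \<Delta>\<mu> = div G\<close> and \<open>- \<kappa> \<Delta>w = f\<close> with \<open>P = Dw\<close>, are tested with each other's
  solution. Neither solution is a test function, but \<open>K * w\<close> is one, and its Laplacian is
  \<open>- (K * f) / \<kappa>\<close>; the mean square convergence of \<open>K * f\<close> and \<open>K * P\<close> concludes.
\<close>

lemma duality_pairing:
  fixes \<mu> :: "real^'n \<Rightarrow> real"
  assumes weak: "weak_drift \<kappa> \<mu> G"
    and w: "ess_bdd w" and P: "\<And>i. ess_bdd (\<lambda>x. P x $ i)" and f: "ess_bdd f"
    and wg: "\<And>\<phi> i. \<phi> \<in> trig \<Longrightarrow> (\<integral>x. w x * partial_deriv i \<phi> x) = - (\<integral>x. \<phi> x * P x $ i)"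
    and eq: "\<And>\<phi>. \<phi> \<in> trig \<Longrightarrow> \<kappa> * (\<integral>x. P x \<bullet> grad \<phi> x) = (\<integral>x. f x * \<phi> x)"
  shows "(\<integral>x. \<mu> x * f x + G x \<bullet> P x) = 0"
proof -
  have \<mu>: "ess_bdd \<mu>" and G: "\<And>i. ess_bdd (\<lambda>x. G x $ i)"
    and FP: "\<And>\<phi>. \<phi> \<in> trig \<Longrightarrow> (\<integral>x. - \<kappa> * \<mu> x * laplacian \<phi> x + G x \<bullet> grad \<phi> x) = 0"
    using weak by (auto simp: weak_drift_def)
  have step: "(\<integral>x. conv K f x * \<mu> x) + (\<Sum>i\<in>UNIV. \<integral>x. conv K (\<lambda>y. P y $ i) x * G x $ i) = 0"
    if K: "K \<in> trig" for K :: "real^'n \<Rightarrow> real"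
  proof -
    have dK: "partial_deriv i K \<in> trig" for i by (intro partial_deriv_trig K)
    have pd: "partial_deriv i (conv K w) = conv K (\<lambda>y. P y $ i)" for i
      by (rule conv_weak_gradient[OF w wg K])
    have lap: "- \<kappa> * laplacian (conv K w) x = conv K f x" for x
    proof -
      have int: "integrable torus (\<lambda>y. partial_deriv i K (x - y) * P y $ i)" for i
        by (intro ess_bdd_integrable conv_integrand_bounded dK P)
      have "- \<kappa> * laplacian (conv K w) x = - \<kappa> * (\<Sum>i\<in>UNIV. \<integral>y. partial_deriv i K (x - y) * P y $ i)"
        by (simp add: laplacian_def pd partial_deriv_conv K P) (simp add: conv_def)
      also have "\<dots> = \<kappa> * (\<integral>y. P y \<bullet> (- grad K (x - y)))"
        using int by (simp add: inner_vec_def grad_def mult.commute sum_negf)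
      also have "\<dots> = (\<integral>y. f y * K (x - y))"
        using eq[OF reflect_trig[OF K, of x]] by (simp add: grad_reflect[OF K])
      finally show ?thesis by (simp add: conv_def mult.commute)
    qed
    have bdd: "ess_bdd (\<lambda>x. conv K f x * \<mu> x)" "ess_bdd (\<lambda>x. conv K (\<lambda>y. P y $ i) x * G x $ i)" for i
      by (intro ess_bdd_mult trig_ess_bdd[OF conv_trig] K f P \<mu> G)+
    have "0 = (\<integral>x. - \<kappa> * \<mu> x * laplacian (conv K w) x + G x \<bullet> grad (conv K w) x)"
      using FP[OF conv_trig[OF K w]] by simp
    also have "\<dots> = (\<integral>x. conv K f x * \<mu> x + (\<Sum>i\<in>UNIV. conv K (\<lambda>y. P y $ i) x * G x $ i))"
    proof (rule Bochner_Integration.integral_cong[OF refl])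
      show "- \<kappa> * \<mu> x * laplacian (conv K w) x + G x \<bullet> grad (conv K w) x
          = conv K f x * \<mu> x + (\<Sum>i\<in>UNIV. conv K (\<lambda>y. P y $ i) x * G x $ i)" for x
        unfolding lap[symmetric] by (simp add: inner_vec_def grad_def pd mult_ac)
    qed
    also have "\<dots> = (\<integral>x. conv K f x * \<mu> x) + (\<Sum>i\<in>UNIV. \<integral>x. conv K (\<lambda>y. P y $ i) x * G x $ i)"
      using bdd[THEN ess_bdd_integrable] by simp
    finally show ?thesis by simp
  qed
  have "(\<lambda>N. (\<integral>x. conv (mollifier N) f x * \<mu> x) + (\<Sum>i\<in>UNIV. \<integral>x. conv (mollifier N) (\<lambda>y. P y $ i) x * G x $ i))
      \<longlonglongrightarrow> (\<integral>x. f x * \<mu> x) + (\<Sum>i\<in>UNIV. \<integral>x. P x $ i * G x $ i)"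
    by (intro tendsto_intros L2_tendsto_integral_mult L2_tendsto_conv f P G \<mu>)
  then have "(\<integral>x. f x * \<mu> x) + (\<Sum>i\<in>UNIV. \<integral>x. P x $ i * G x $ i) = 0"
    by (simp add: step[OF mollifier_trig] LIMSEQ_const_iff)
  moreover have "(\<integral>x. \<mu> x * f x + G x \<bullet> P x)
      = (\<integral>x. f x * \<mu> x) + (\<Sum>i\<in>UNIV. \<integral>x. P x $ i * G x $ i)"
  proof -
    have "integrable torus (\<lambda>x. f x * \<mu> x)" "integrable torus (\<lambda>x. P x $ i * G x $ i)" for i
      by (intro ess_bdd_integrable ess_bdd_mult f \<mu> P G)+
    then show ?thesis by (simp add: inner_vec_def mult.commute)
  qed
  ultimately show ?thesis by simp
qed

text \<open>
  The convolutions have vanishing classical gradient and mean zero, hence vanish by the Poincare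
  inequality.
\<close>

lemma weak_gradient_zero:
  fixes w :: "real^'n \<Rightarrow> real"
  assumes w: "ess_bdd w" and mean: "integral\<^sup>L torus w = 0"
    and wg: "\<And>\<phi> i. \<phi> \<in> trig \<Longrightarrow> (\<integral>x. w x * partial_deriv i \<phi> x) = - (\<integral>x. \<phi> x * P x $ i)"
    and P: "AE x in torus. P x = 0"
  shows "AE x in torus. w x = 0"
proof -
  have "(\<integral>x. (conv (mollifier N) w x)^2) = 0" for N
  proof -
    let ?v = "conv (mollifier N) w"
    have v: "?v \<in> trig" by (intro conv_trig mollifier_trig w)
    have "conv (mollifier N) (\<lambda>y. P y $ i) x = 0" for i x
    proof -
      have "(\<integral>y. mollifier N (x - y) * P y $ i) = 0"
        by (rule integral_eq_zero_AE) (use P in \<open>auto elim: eventually_mono\<close>)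
      then show ?thesis by (simp add: conv_def)
    qed
    then have "grad ?v x = 0" for x
      by (simp add: grad_def vec_eq_iff conv_weak_gradient[OF w wg mollifier_trig])
    then have "(\<integral>x. (?v x - integral\<^sup>L torus ?v)^2) \<le> 0"
      using Poincare_torus[OF trig_C1_periodic[OF v]] by simp
    then have "(\<integral>x. (?v x)^2) \<le> 0" by (simp add: integral_conv[OF w] mean)
    moreover have "0 \<le> (\<integral>x. (?v x)^2)" by simp
    ultimately show ?thesis by linarith
  qed
  then have "(\<integral>x. (w x)^2) = 0"
    using L2_tendsto_integral_square[OF L2_tendsto_conv[OF w]] by (simp add: LIMSEQ_const_iff)
  then have "AE x in torus. (w x)^2 = 0"
    by (subst (asm) integral_nonneg_eq_0_iff_AE) (auto intro: ess_bdd_integrable ess_bdd_power w)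
  then show ?thesis by simp
qed

text \<open>
  The a priori information carried by membership in \<open>X\<close>. Besides the bounds, this is the measurability
  of the composed terms \<open>H\<^sub>p(x, Du)\<close> and \<open>F(x, m)\<close>, without which the integrals in the equations could
  not be split.
\<close>

lemma solution_regularity:
  fixes u m :: "real^'n \<Rightarrow> real"
  assumes X: "(u, m) \<in> X U M" and sol: "ergodic_solution \<kappa> H F lam u m"
    and H: "admissible_H H" "H_bounds H U L \<alpha> \<beta>" and F: "admissible_F F" and UM: "U > 0" "M > 0"
  defines "p \<equiv> D u"
  shows "ess_bdd u" "ess_bdd m" "AE x in torus. 0 \<le> m x \<and> m x \<le> M"
    "AE x in torus. norm (p x) \<le> U" "\<And>i. ess_bdd (\<lambda>x. p x $ i)"
    "\<And>\<phi> i. \<phi> \<in> trig \<Longrightarrow> (\<integral>x. u x * partial_deriv i \<phi> x) = - (\<integral>x. \<phi> x * p x $ i)"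
    "\<And>i. ess_bdd (\<lambda>x. grad (H x) (p x) $ i)" "AE x in torus. norm (grad (H x) (p x)) \<le> L"
    "weak_drift \<kappa> m (\<lambda>x. m x *\<^sub>R grad (H x) (p x))"
    "ess_bdd (\<lambda>x. F x (m x))"
proof -
  have uX: "u \<in> W1inf" and mX: "m \<in> Linf" and pU: "Linf_norm (D u) \<le> ennreal U"
    and mM: "Linf_norm m \<le> ennreal M"
    using X by (auto simp: X_def)
  have "\<exists>G. weak_gradient u G" using uX by (auto simp: W1inf_def)
  then have wg: "weak_gradient u p" unfolding p_def D_def by (rule someI_ex)
  then have pm: "p \<in> borel_measurable torus" by (auto simp: weak_gradient_def)
  show u: "ess_bdd u" using uX by (auto simp: W1inf_def intro: Linf_ess_bdd)
  show m: "ess_bdd m" using mX by (rule Linf_ess_bdd)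
  have m0: "AE x in torus. 0 \<le> m x" using sol by (simp add: ergodic_solution_def)
  have "AE x in torus. norm (m x) \<le> M" using mM UM by (intro Linf_norm_leD) auto
  with m0 show mb: "AE x in torus. 0 \<le> m x \<and> m x \<le> M" by eventually_elim auto
  show pb: "AE x in torus. norm (p x) \<le> U" unfolding p_def using pU UM by (intro Linf_norm_leD) auto
  show p: "ess_bdd (\<lambda>x. p x $ i)" for i
  proof (rule ess_bddI)
    show "AE x in torus. \<bar>p x $ i\<bar> \<le> U"
      using pb by eventually_elim (metis component_le_norm_cart order_trans)
  qed (rule measurable_vec_nth[OF pm])
  show "(\<integral>x. u x * partial_deriv i \<phi> x) = - (\<integral>x. \<phi> x * p x $ i)" if "\<phi> \<in> trig" for \<phi> i
    by (rule weak_gradient_component[OF wg u pm p that])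
  show bL: "AE x in torus. norm (grad (H x) (p x)) \<le> L"
    using H(2) pb unfolding H_bounds_def by eventually_elim auto
  show b: "ess_bdd (\<lambda>x. grad (H x) (p x) $ i)" for i
  proof (rule ess_bddI)
    show "AE x in torus. \<bar>grad (H x) (p x) $ i\<bar> \<le> L"
      using bL by eventually_elim (metis component_le_norm_cart order_trans)
    show "(\<lambda>x. grad (H x) (p x) $ i) \<in> borel_measurable torus"
      using H(1) by (intro measurable_grad_superposition pm) (auto simp: admissible_H_def)
  qed
  show "weak_drift \<kappa> m (\<lambda>x. m x *\<^sub>R grad (H x) (p x))"
    using sol m b
    by (auto simp: weak_drift_def ergodic_solution_def weak_FP_def p_def
        intro: ess_bdd_mult trig_test_function)
  obtain c l where "AE x in torus. (\<forall>r\<in>{0..M}. \<bar>F x r\<bar> \<le> c) \<and>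
      (\<forall>r\<in>{0..M}. \<forall>r'\<in>{0..M}. \<bar>F x r - F x r'\<bar> \<le> l * \<bar>r - r'\<bar>)"
    using F UM unfolding admissible_F_def by blast
  then have "AE x in torus. \<bar>F x (m x)\<bar> \<le> c" using mb by eventually_elim auto
  then show "ess_bdd (\<lambda>x. F x (m x))"
    by (rule ess_bddI[OF measurable_coupling_superposition[OF F ess_bdd_measurable[OF m] m0]])
qed

theorem theorem3p4:
  fixes \<kappa> M U L \<alpha> \<beta> :: real
  assumes "\<kappa> > 0" and "M > 0" and "U > 0" and "L > 0" and "\<alpha> > 0" and "\<beta> > 0"
  shows "\<exists>\<gamma>\<^sub>0>0. \<forall>(H :: real ^ 'n \<Rightarrow> real ^ 'n \<Rightarrow> real) (F :: real ^ 'n \<Rightarrow> real \<Rightarrow> real).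
    admissible_H H \<and> H_bounds H U L \<alpha> \<beta> \<and> admissible_F F \<and>
    (\<forall>x. mono_on {0..M} (\<lambda>m. F x m + \<gamma>\<^sub>0 * m)) \<longrightarrow>
    (\<forall>lam\<^sub>1 u\<^sub>1 m\<^sub>1 lam\<^sub>2 u\<^sub>2 m\<^sub>2.
       (u\<^sub>1, m\<^sub>1) \<in> X U M \<and> ergodic_solution \<kappa> H F lam\<^sub>1 u\<^sub>1 m\<^sub>1 \<and>
       (u\<^sub>2, m\<^sub>2) \<in> X U M \<and> ergodic_solution \<kappa> H F lam\<^sub>2 u\<^sub>2 m\<^sub>2 \<longrightarrow>
       lam\<^sub>1 = lam\<^sub>2 \<and> (AE x in torus. u\<^sub>1 x = u\<^sub>2 x) \<and> (AE x in torus. m\<^sub>1 x = m\<^sub>2 x))"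
proof -
  obtain C where C: "C > 0" and L2_bound: "\<And>(\<mu> :: real^'n \<Rightarrow> real) G b. weak_drift \<kappa> \<mu> G \<Longrightarrow>
      (\<And>i. ess_bdd (\<lambda>x. b x $ i)) \<Longrightarrow> (AE x in torus. norm (b x) \<le> L) \<Longrightarrow> integral\<^sup>L torus \<mu> = 0 \<Longrightarrow>
      (\<integral>x. (\<mu> x)^2) \<le> C * (\<integral>x. (norm (G x - \<mu> x *\<^sub>R b x))^2)"
    using weak_L2_bound[OF \<open>\<kappa> > 0\<close>, of L] by blast
  \<comment> \<open>With this choice \<open>\<gamma> C M \<beta>\<^sup>2\<close> is half of the convexity constant \<open>\<alpha> / 2\<close>.\<close>
  define \<gamma> where "\<gamma> = \<alpha> / (4 * C * M * \<beta>^2)"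
  have \<gamma>: "\<gamma> > 0" using assms C by (simp add: \<gamma>_def)
  show ?thesis
  proof (intro exI[of _ \<gamma>] conjI \<gamma> allI impI; elim conjE)
    fix H :: "real^'n \<Rightarrow> real^'n \<Rightarrow> real" and F :: "real^'n \<Rightarrow> real \<Rightarrow> real"
      and lam\<^sub>1 lam\<^sub>2 :: real and u\<^sub>1 m\<^sub>1 u\<^sub>2 m\<^sub>2 :: "real^'n \<Rightarrow> real"
    assume H: "admissible_H H" "H_bounds H U L \<alpha> \<beta>" and F: "admissible_F F"
      and mono: "\<forall>x. mono_on {0..M} (\<lambda>m. F x m + \<gamma> * m)"
      and X1: "(u\<^sub>1, m\<^sub>1) \<in> X U M" and X2: "(u\<^sub>2, m\<^sub>2) \<in> X U M"
      and sol1: "ergodic_solution \<kappa> H F lam\<^sub>1 u\<^sub>1 m\<^sub>1" and sol2: "ergodic_solution \<kappa> H F lam\<^sub>2 u\<^sub>2 m\<^sub>2"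
    let ?p1 = "D u\<^sub>1" and ?p2 = "D u\<^sub>2"
    let ?b1 = "\<lambda>x. grad (H x) (?p1 x)" and ?b2 = "\<lambda>x. grad (H x) (?p2 x)"
    note r1 = solution_regularity[OF X1 sol1 H F \<open>U > 0\<close> \<open>M > 0\<close>]
    note r2 = solution_regularity[OF X2 sol2 H F \<open>U > 0\<close> \<open>M > 0\<close>]
    define w where "w x = u\<^sub>1 x - u\<^sub>2 x" for x
    define \<mu> where "\<mu> x = m\<^sub>1 x - m\<^sub>2 x" for x
    define P where "P x = ?p1 x - ?p2 x" for x
    define G where "G x = m\<^sub>1 x *\<^sub>R ?b1 x - m\<^sub>2 x *\<^sub>R ?b2 x" for x
    define dH where "dH x = H x (?p1 x) - H x (?p2 x)" for x
    define dF where "dF x = F x (m\<^sub>1 x) - F x (m\<^sub>2 x)" for x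
    define f where "f x = dF x - dH x - (lam\<^sub>1 - lam\<^sub>2)" for x
    have C2: "Ck 2 (H x)" for x using H(1) by (simp add: admissible_H_def)
    have Hint: "integrable torus (\<lambda>x. H x (?p1 x))" "integrable torus (\<lambda>x. H x (?p2 x))"
      using sol1 sol2 by (auto simp: ergodic_solution_def weak_HJB_def)

    \<comment> \<open>Properties of \<open>H x\<close> on the ball of radius \<open>U\<close>, which contains both gradients almost everywhere.\<close>
    have pointwise: "AE x in torus. \<bar>dH x\<bar> \<le> L * norm (P x) \<and>
        \<alpha> / 2 * (norm (P x))^2 \<le> ?b1 x \<bullet> P x - dH x \<and> \<alpha> / 2 * (norm (P x))^2 \<le> dH x - ?b2 x \<bullet> P x \<and>
        norm (?b1 x - ?b2 x) \<le> \<beta> * norm (P x)"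
      using H(2) r1(4) r2(4) unfolding H_bounds_def
    proof eventually_elim
      case (elim x)
      have L: "\<And>p. norm p \<le> U \<Longrightarrow> norm (grad (H x) p) \<le> L"
        and \<alpha>: "\<And>p v. norm p \<le> U \<Longrightarrow> \<alpha> * (v \<bullet> v) \<le> v \<bullet> (hessian (H x) p *v v)"
        and \<beta>: "\<And>p v. norm p \<le> U \<Longrightarrow> v \<bullet> (hessian (H x) p *v v) \<le> \<beta> * (v \<bullet> v)"
        using elim(1) by (auto simp: loewner_le_mat)
      have pos: "0 \<le> v \<bullet> (hessian (H x) p *v v)" if "norm p \<le> U" for p v
        using order_trans[OF _ \<alpha>[OF that]] \<open>\<alpha> > 0\<close> by simp
      have "\<bar>dH x\<bar> \<le> L * norm (P x)"
        unfolding dH_def P_def by (rule Hamiltonian_Lipschitz[OF C2 L elim(3,2)])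
      moreover have "\<alpha> / 2 * (norm (P x))^2 \<le> ?b1 x \<bullet> P x - dH x"
        using Hamiltonian_convexity[OF C2 \<alpha> elim(2,3)]
        by (simp add: dH_def P_def norm_minus_commute inner_diff_right)
      moreover have "\<alpha> / 2 * (norm (P x))^2 \<le> dH x - ?b2 x \<bullet> P x"
        using Hamiltonian_convexity[OF C2 \<alpha> elim(3,2)] by (simp add: dH_def P_def)
      moreover have "norm (?b1 x - ?b2 x) \<le> \<beta> * norm (P x)"
        unfolding P_def by (rule Hamiltonian_grad_Lipschitz[OF C2 pos \<beta> elim(3,2)])
      ultimately show ?case by blast
    qed

    have P: "ess_bdd (\<lambda>x. P x $ i)" for i
      using ess_bdd_diff[OF r1(5) r2(5)] by (simp add: P_def)
    have Pn: "ess_bdd (\<lambda>x. norm (P x))" by (intro ess_bdd_norm P)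
    have w: "ess_bdd w" unfolding w_def[abs_def] by (intro ess_bdd_diff r1 r2)
    have \<mu>: "ess_bdd \<mu>" unfolding \<mu>_def[abs_def] by (intro ess_bdd_diff r1 r2)
    have dF: "ess_bdd dF" unfolding dF_def[abs_def] by (intro ess_bdd_diff r1 r2)
    have dH: "ess_bdd dH"
    proof -
      obtain B where B: "AE x in torus. \<bar>norm (P x)\<bar> \<le> B" using ess_bddE[OF Pn] by blast
      have "AE x in torus. \<bar>dH x\<bar> \<le> L * B"
        using pointwise B
      proof eventually_elim
        case (elim x)
        then have "L * norm (P x) \<le> L * B" using \<open>L > 0\<close> by (intro mult_left_mono) auto
        then show ?case using elim by linarith
      qed
      then show ?thesis
        unfolding dH_def[abs_def]
        by (intro ess_bddI borel_measurable_diff borel_measurable_integrable Hint)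
    qed
    have f: "ess_bdd f" unfolding f_def[abs_def] by (intro ess_bdd_diff dF dH ess_bdd_const)

    have wg: "(\<integral>x. w x * partial_deriv i \<phi> x) = - (\<integral>x. \<phi> x * P x $ i)"
      if \<phi>: "\<phi> \<in> trig" for \<phi> i
    proof -
      have "integrable torus (\<lambda>x. u\<^sub>1 x * partial_deriv i \<phi> x)" "integrable torus (\<lambda>x. u\<^sub>2 x * partial_deriv i \<phi> x)"
        "integrable torus (\<lambda>x. \<phi> x * ?p1 x $ i)" "integrable torus (\<lambda>x. \<phi> x * ?p2 x $ i)"
        by (intro ess_bdd_integrable ess_bdd_mult r1(1,5) r2(1,5)
            trig_ess_bdd[OF \<phi>] trig_ess_bdd[OF partial_deriv_trig[OF \<phi>]])+
      then show ?thesis using r1(6)[OF \<phi>, of i] r2(6)[OF \<phi>, of i]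
        by (simp add: w_def P_def left_diff_distrib right_diff_distrib)
    qed

    \<comment> \<open>The terms \<open>H x (Du\<^sub>i x)\<close> are integrable but possibly unbounded; only their difference is bounded.\<close>
    have HJB: "\<kappa> * (\<integral>x. P x \<bullet> grad \<phi> x) = (\<integral>x. f x * \<phi> x)" if \<phi>: "\<phi> \<in> trig" for \<phi>
    proof -
      have \<phi>b: "ess_bdd \<phi>" by (rule trig_ess_bdd[OF \<phi>])
      have g: "ess_bdd (\<lambda>x. grad \<phi> x $ i)" for i
        using trig_ess_bdd[OF partial_deriv_trig[OF \<phi>]] by (simp add: grad_def)
      have e: "lam * integral\<^sup>L torus \<phi> + \<kappa> * (\<integral>x. D u x \<bullet> grad \<phi> x) + (\<integral>x. H x (D u x) * \<phi> x)
          = (\<integral>x. F x (m x) * \<phi> x)" "integrable torus (\<lambda>x. D u x \<bullet> grad \<phi> x)"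
          "integrable torus (\<lambda>x. H x (D u x) * \<phi> x)"
        if X: "(u, m) \<in> X U M" and s: "ergodic_solution \<kappa> H F lam u m" for u m lam
      proof -
        note r = solution_regularity[OF X s H F \<open>U > 0\<close> \<open>M > 0\<close>]
        show i1: "integrable torus (\<lambda>x. D u x \<bullet> grad \<phi> x)"
          by (intro ess_bdd_integrable ess_bdd_inner r g)
        obtain B where B: "AE x in torus. \<bar>\<phi> x\<bar> \<le> B" "\<phi> \<in> borel_measurable torus" using ess_bddE[OF \<phi>b] by blast
        show i2: "integrable torus (\<lambda>x. H x (D u x) * \<phi> x)"
        proof (rule Bochner_Integration.integrable_bound)
          have Hi: "integrable torus (\<lambda>x. H x (D u x))"
            using s by (auto simp: ergodic_solution_def weak_HJB_def)
          then show "integrable torus (\<lambda>x. B * H x (D u x))" by simp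
          show "(\<lambda>x. H x (D u x) * \<phi> x) \<in> borel_measurable torus"
            using Hi B(2) by (intro borel_measurable_times) auto
          show "AE x in torus. norm (H x (D u x) * \<phi> x) \<le> norm (B * H x (D u x))"
            using B(1)
          proof eventually_elim
            case (elim x)
            then have "\<bar>\<phi> x\<bar> \<le> \<bar>B\<bar>" by linarith
            then have "\<bar>H x (D u x)\<bar> * \<bar>\<phi> x\<bar> \<le> \<bar>H x (D u x)\<bar> * \<bar>B\<bar>" by (intro mult_left_mono) auto
            then show ?case by (simp add: abs_mult mult.commute)
          qed
        qed
        have "(\<integral>x. lam * \<phi> x + \<kappa> * (D u x \<bullet> grad \<phi> x) + H x (D u x) * \<phi> x)
            = (\<integral>x. F x (m x) * \<phi> x)"
          using s trig_test_function[OF \<phi>] by (simp add: ergodic_solution_def weak_HJB_def)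
        then show "lam * integral\<^sup>L torus \<phi> + \<kappa> * (\<integral>x. D u x \<bullet> grad \<phi> x) + (\<integral>x. H x (D u x) * \<phi> x)
          = (\<integral>x. F x (m x) * \<phi> x)"
          using i1 i2 ess_bdd_integrable[OF \<phi>b] by simp
      qed
      have iF: "integrable torus (\<lambda>x. F x (m\<^sub>1 x) * \<phi> x)" "integrable torus (\<lambda>x. F x (m\<^sub>2 x) * \<phi> x)"
        by (intro ess_bdd_integrable ess_bdd_mult r1(10) r2(10) \<phi>b)+
      have "(\<integral>x. f x * \<phi> x) = (\<integral>x. F x (m\<^sub>1 x) * \<phi> x - F x (m\<^sub>2 x) * \<phi> x
          - (H x (?p1 x) * \<phi> x - H x (?p2 x) * \<phi> x) - (lam\<^sub>1 - lam\<^sub>2) * \<phi> x)"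
        by (simp add: f_def dF_def dH_def algebra_simps)
      also have "\<dots> = (\<integral>x. F x (m\<^sub>1 x) * \<phi> x) - (\<integral>x. F x (m\<^sub>2 x) * \<phi> x)
          - ((\<integral>x. H x (?p1 x) * \<phi> x) - (\<integral>x. H x (?p2 x) * \<phi> x)) - (lam\<^sub>1 - lam\<^sub>2) * integral\<^sup>L torus \<phi>"
        using iF e(3)[OF X1 sol1] e(3)[OF X2 sol2] ess_bdd_integrable[OF \<phi>b] by simp
      also have "\<dots> = \<kappa> * ((\<integral>x. ?p1 x \<bullet> grad \<phi> x) - (\<integral>x. ?p2 x \<bullet> grad \<phi> x))"
        using e(1)[OF X1 sol1] e(1)[OF X2 sol2] by (simp add: algebra_simps)
      also have "(\<integral>x. ?p1 x \<bullet> grad \<phi> x) - (\<integral>x. ?p2 x \<bullet> grad \<phi> x) = (\<integral>x. P x \<bullet> grad \<phi> x)"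
        using e(2)[OF X1 sol1] e(2)[OF X2 sol2] by (simp add: P_def inner_diff_left)
      finally show ?thesis by simp
    qed

    have FP: "weak_drift \<kappa> \<mu> G"
      unfolding weak_drift_def
    proof (intro conjI allI ballI \<mu>)
      show "ess_bdd (\<lambda>x. G x $ i)" for i
        unfolding G_def by (simp, intro ess_bdd_diff ess_bdd_mult r1 r2)
      fix \<phi> :: "real^'n \<Rightarrow> real" assume \<phi>: "\<phi> \<in> trig"
      have \<phi>': "ess_bdd (laplacian \<phi>)" "ess_bdd (\<lambda>x. grad \<phi> x $ i)" for i
        unfolding laplacian_def[abs_def] grad_def
        using trig_ess_bdd[OF partial_deriv_trig[OF \<phi>]]
          trig_ess_bdd[OF partial_deriv_trig[OF partial_deriv_trig[OF \<phi>]]]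
        by (auto intro: ess_bdd_sum)
      have int: "integrable torus (\<lambda>x. - \<kappa> * m x * laplacian \<phi> x + (m x *\<^sub>R b x) \<bullet> grad \<phi> x)"
        if "ess_bdd m" "\<And>i. ess_bdd (\<lambda>x. b x $ i)" for m :: "real^'n \<Rightarrow> real" and b
        using that by (auto intro!: ess_bdd_rules ess_bdd_inner \<phi>')
      have "(\<integral>x. - \<kappa> * \<mu> x * laplacian \<phi> x + G x \<bullet> grad \<phi> x)
          = (\<integral>x. (- \<kappa> * m\<^sub>1 x * laplacian \<phi> x + (m\<^sub>1 x *\<^sub>R ?b1 x) \<bullet> grad \<phi> x)
            - (- \<kappa> * m\<^sub>2 x * laplacian \<phi> x + (m\<^sub>2 x *\<^sub>R ?b2 x) \<bullet> grad \<phi> x))"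
        by (simp add: \<mu>_def G_def inner_diff_left algebra_simps)
      also have "\<dots> = (\<integral>x. - \<kappa> * m\<^sub>1 x * laplacian \<phi> x + (m\<^sub>1 x *\<^sub>R ?b1 x) \<bullet> grad \<phi> x)
            - (\<integral>x. - \<kappa> * m\<^sub>2 x * laplacian \<phi> x + (m\<^sub>2 x *\<^sub>R ?b2 x) \<bullet> grad \<phi> x)"
        by (intro Bochner_Integration.integral_diff int r1 r2)
      also have "\<dots> = 0"
        using r1(9) r2(9) \<phi> unfolding weak_drift_def by simp
      finally show "(\<integral>x. - \<kappa> * \<mu> x * laplacian \<phi> x + G x \<bullet> grad \<phi> x) = 0" .
    qed

    have mass: "integral\<^sup>L torus m\<^sub>1 = 1" "integral\<^sup>L torus m\<^sub>2 = 1"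
      and mean: "integral\<^sup>L torus u\<^sub>1 = 0" "integral\<^sup>L torus u\<^sub>2 = 0"
      using sol1 sol2 by (auto simp: ergodic_solution_def)
    have \<mu>0: "integral\<^sup>L torus \<mu> = 0"
      unfolding \<mu>_def[abs_def]
      using r1(2)[THEN ess_bdd_integrable] r2(2)[THEN ess_bdd_integrable] by (simp add: mass)
    have w0: "integral\<^sup>L torus w = 0"
      unfolding w_def[abs_def]
      using r1(1)[THEN ess_bdd_integrable] r2(1)[THEN ess_bdd_integrable] by (simp add: mean)
    have G: "ess_bdd (\<lambda>x. G x $ i)" for i using FP by (simp add: weak_drift_def)

    define Y1 where "Y1 = (\<integral>x. m\<^sub>1 x * (norm (P x))^2)"
    define Y2 where "Y2 = (\<integral>x. m\<^sub>2 x * (norm (P x))^2)"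
    define S where "S = (\<integral>x. (\<mu> x)^2)"
    have iY: "integrable torus (\<lambda>x. m\<^sub>1 x * (norm (P x))^2)" "integrable torus (\<lambda>x. m\<^sub>2 x * (norm (P x))^2)"
      and iS: "integrable torus (\<lambda>x. (\<mu> x)^2)" and i\<mu>: "integrable torus \<mu>"
      by (intro ess_bdd_rules r1(2) r2(2) Pn \<mu>)+
    have nn: "AE x in torus. 0 \<le> m\<^sub>1 x * (norm (P x))^2" "AE x in torus. 0 \<le> m\<^sub>2 x * (norm (P x))^2"
      using r1(3) r2(3) by (auto elim: eventually_mono)
    have Y: "Y1 \<ge> 0" "Y2 \<ge> 0" unfolding Y1_def Y2_def using nn by (auto intro: integral_nonneg_AE)

    \<comment> \<open>The constant \<open>lam\<^sub>1 - lam\<^sub>2\<close> drops out since \<open>\<mu>\<close> has mean zero.\<close>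
    have "\<alpha> / 2 * (Y1 + Y2) - \<gamma> * S
        = (\<integral>x. \<alpha> / 2 * (m\<^sub>1 x * (norm (P x))^2 + m\<^sub>2 x * (norm (P x))^2) - \<gamma> * (\<mu> x)^2)"
      using iY iS by (simp add: Y1_def Y2_def S_def)
    also have "\<dots> \<le> (\<integral>x. \<mu> x * f x + G x \<bullet> P x + (lam\<^sub>1 - lam\<^sub>2) * \<mu> x)"
    proof (rule integral_mono_AE)
      show "AE x in torus. \<alpha> / 2 * (m\<^sub>1 x * (norm (P x))^2 + m\<^sub>2 x * (norm (P x))^2) - \<gamma> * (\<mu> x)^2
          \<le> \<mu> x * f x + G x \<bullet> P x + (lam\<^sub>1 - lam\<^sub>2) * \<mu> x"
        using pointwise r1(3) r2(3)
      proof eventually_elim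
        case (elim x)
        let ?Q = "\<alpha> / 2 * (norm (P x))^2"
        have 1: "m\<^sub>1 x * ?Q \<le> m\<^sub>1 x * (?b1 x \<bullet> P x - dH x)" "m\<^sub>2 x * ?Q \<le> m\<^sub>2 x * (dH x - ?b2 x \<bullet> P x)"
          by (rule mult_left_mono, use elim in blast, use elim in blast)+
        have 2: "0 \<le> \<mu> x * (dF x + \<gamma> * \<mu> x)"
        proof -
          have mo: "F x r + \<gamma> * r \<le> F x s + \<gamma> * s" if "0 \<le> r" "r \<le> s" "s \<le> M" for r s
            using mono that by (auto simp: mono_on_def)
          show ?thesis
          proof (cases "m\<^sub>1 x \<le> m\<^sub>2 x")
            case True
            then have "dF x + \<gamma> * \<mu> x \<le> 0" "\<mu> x \<le> 0"
              using mo[of "m\<^sub>1 x" "m\<^sub>2 x"] elim by (auto simp: dF_def \<mu>_def algebra_simps)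
            then show ?thesis by (intro mult_nonpos_nonpos)
          next
            case False
            then have "0 \<le> dF x + \<gamma> * \<mu> x" "0 \<le> \<mu> x"
              using mo[of "m\<^sub>2 x" "m\<^sub>1 x"] elim by (auto simp: dF_def \<mu>_def algebra_simps)
            then show ?thesis by (intro mult_nonneg_nonneg)
          qed
        qed
        have "\<mu> x * f x + G x \<bullet> P x + (lam\<^sub>1 - lam\<^sub>2) * \<mu> x
            = \<mu> x * (dF x + \<gamma> * \<mu> x) + m\<^sub>1 x * (?b1 x \<bullet> P x - dH x) + m\<^sub>2 x * (dH x - ?b2 x \<bullet> P x) - \<gamma> * (\<mu> x)^2"
          by (simp add: \<mu>_def f_def G_def inner_diff_left power2_eq_square algebra_simps)
        also have "\<dots> \<ge> m\<^sub>1 x * ?Q + m\<^sub>2 x * ?Q - \<gamma> * (\<mu> x)^2" using 1 2 by linarith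
        finally show ?case by (simp add: algebra_simps)
      qed
    qed (intro ess_bdd_rules ess_bdd_inner r1(2) r2(2) Pn \<mu> f G P)+
    also have "\<dots> = (\<integral>x. \<mu> x * f x + G x \<bullet> P x) + (lam\<^sub>1 - lam\<^sub>2) * integral\<^sup>L torus \<mu>"
    proof -
      have "integrable torus (\<lambda>x. \<mu> x * f x + G x \<bullet> P x)"
        by (intro ess_bdd_rules ess_bdd_inner \<mu> f G P)
      then show ?thesis using i\<mu> by simp
    qed
    also have "\<dots> = 0" using duality_pairing[OF FP w P f wg HJB] by (simp add: \<mu>0)
    finally have monotonicity: "\<alpha> / 2 * (Y1 + Y2) \<le> \<gamma> * S" by simp

    have S_le: "S \<le> C * M * \<beta>^2 * Y2"
    proof -
      have "S \<le> C * (\<integral>x. (norm (G x - \<mu> x *\<^sub>R ?b1 x))^2)"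
        unfolding S_def by (rule L2_bound[OF FP r1(7,8) \<mu>0])
      also have "(\<integral>x. (norm (G x - \<mu> x *\<^sub>R ?b1 x))^2) \<le> (\<integral>x. M * \<beta>^2 * (m\<^sub>2 x * (norm (P x))^2))"
      proof (rule integral_mono_AE)
        show "AE x in torus. (norm (G x - \<mu> x *\<^sub>R ?b1 x))^2 \<le> M * \<beta>^2 * (m\<^sub>2 x * (norm (P x))^2)"
          using pointwise r2(3)
        proof eventually_elim
          case (elim x)
          have "G x - \<mu> x *\<^sub>R ?b1 x = m\<^sub>2 x *\<^sub>R (?b1 x - ?b2 x)"
            by (simp add: G_def \<mu>_def algebra_simps)
          then have "(norm (G x - \<mu> x *\<^sub>R ?b1 x))^2 = m\<^sub>2 x * m\<^sub>2 x * (norm (?b1 x - ?b2 x))^2"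
            by (simp add: power2_eq_square power_mult_distrib mult_ac)
          also have "\<dots> \<le> M * m\<^sub>2 x * (\<beta> * norm (P x))^2"
            using elim \<open>M > 0\<close> by (intro mult_mono power_mono) auto
          finally show ?case by (simp add: power_mult_distrib mult_ac)
        qed
        have "ess_bdd (\<lambda>x. norm (G x - \<mu> x *\<^sub>R ?b1 x))"
          by (intro ess_bdd_norm, simp, intro ess_bdd_intros G \<mu> r1)
        then show "integrable torus (\<lambda>x. (norm (G x - \<mu> x *\<^sub>R ?b1 x))^2)"
          by (intro ess_bdd_integrable ess_bdd_power)
      qed (use iY in simp)
      also have "(\<integral>x. M * \<beta>^2 * (m\<^sub>2 x * (norm (P x))^2)) = M * \<beta>^2 * Y2"
        unfolding Y2_def by (rule integral_mult_right_zero)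
      finally show ?thesis using C by (simp add: mult_left_mono mult_ac)
    qed
    have "\<gamma> * S \<le> \<gamma> * (C * M * \<beta>^2 * Y2)" using S_le \<gamma> by (intro mult_left_mono) auto
    also have "\<dots> = \<alpha> / 4 * Y2" using assms C by (simp add: \<gamma>_def)
    finally have "\<alpha> / 2 * (Y1 + Y2) \<le> \<alpha> / 4 * Y2" using monotonicity by linarith
    then have "\<alpha> * (2 * Y1 + Y2) \<le> 0" by (simp add: algebra_simps)
    then have "2 * Y1 + Y2 \<le> 0" using \<open>\<alpha> > 0\<close> by (simp add: mult_le_0_iff)
    then have Y0: "Y1 = 0" "Y2 = 0" using Y by auto
    have S0: "S = 0" using S_le Y0 by (simp add: S_def order_antisym)

    have "AE x in torus. (\<mu> x)^2 = 0"
      using S0 iS unfolding S_def by (subst (asm) integral_nonneg_eq_0_iff_AE) auto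
    then have m_eq: "AE x in torus. m\<^sub>1 x = m\<^sub>2 x" by (simp add: \<mu>_def)
    have "AE x in torus. m\<^sub>1 x * (norm (P x))^2 = 0"
      using Y0(1) iY(1) nn(1) unfolding Y1_def by (subst (asm) integral_nonneg_eq_0_iff_AE) auto
    moreover have "AE x in torus. 0 < m\<^sub>1 x"
      using r1(3) by (intro density_positive[OF \<open>\<kappa> > 0\<close> r1(9,7,8) _ mass(1)]) (auto elim: eventually_mono)
    ultimately have P0: "AE x in torus. P x = 0" by eventually_elim auto
    have "AE x in torus. w x = 0" by (rule weak_gradient_zero[OF w w0 wg P0])
    then have u_eq: "AE x in torus. u\<^sub>1 x = u\<^sub>2 x" by (simp add: w_def)
    have "lam\<^sub>1 = lam\<^sub>2"
    proof -
      have "(\<integral>x. f x * 1) = \<kappa> * (\<integral>x. P x \<bullet> grad (\<lambda>x. 1) x)"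
        using HJB[OF trig.const] by simp
      also have "(\<integral>x. P x \<bullet> grad (\<lambda>x. 1) x) = 0"
        by (rule integral_eq_zero_AE) (use P0 in \<open>auto elim: eventually_mono\<close>)
      finally have "integral\<^sup>L torus f = 0" by simp
      moreover have "integral\<^sup>L torus f = (\<integral>x. - (lam\<^sub>1 - lam\<^sub>2) \<partial>(torus :: (real^'n) measure))"
      proof (rule integral_cong_AE)
        show "AE x in torus. f x = - (lam\<^sub>1 - lam\<^sub>2)"
          using m_eq P0 by eventually_elim (simp add: f_def dF_def dH_def P_def)
      qed (use ess_bdd_measurable[OF f] in auto)
      ultimately show ?thesis by (simp add: torus.prob_space)
    qed
    with u_eq m_eq show "lam\<^sub>1 = lam\<^sub>2" "AE x in torus. u\<^sub>1 x = u\<^sub>2 x" "AE x in torus. m\<^sub>1 x = m\<^sub>2 x"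
      by auto
  qed
qed

end
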